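(* Let $M$ be a $(2n+s)$-dimensional $S$-manifold with $n\geq 2$, and let $\nabla$ be its Riemannian (Levi-Civita) connection. If the $\mathcal{L}$-sectional curvature $K_{\mathcal{L}}$ with respect to $\nabla$ is constant equal to $c$, then $c=s$. In this case, the scalar curvature of $M$ with respect to $\nabla$ is $\tau=ns(2n+1)$.
   Context: A metric $f$-manifold is a $(2n+s)$-dimensional differentiable manifold $M$ ($n,s\geq 1$) with a $(1,1)$ tensor field $f$, vector fields $\xi_1,\dots,\xi_s$ (structure vector fields), 1-forms $\eta^1,\dots,\eta^s$ and a Riemannian metric $g$ such that $f^2=-I+\sum_{\alpha=1}^s\eta^\alpha\otimes\xi_\alpha$, $\eta^\alpha(\xi_\beta)=\delta_{\alpha\beta}$, $f\xi_\alpha=0$, $\eta^\alpha\circ f=0$, $g(fX,fY)=g(X,Y)-\sum_{\alpha=1}^s\eta^\alpha(X)\eta^\alpha(Y)$; moreover $\eta^\alpha(X)=g(X,\xi_\alpha)$ and $g(X,fY)=-g(fX,Y)$. The fundamental 2-form is $\Phi(X,Y)=g(X,fY)$. $M$ is an $S$-manifold if it is normal, i.e. $[f,f]+2\sum_{\alpha=1}^s d\eta^\alpha\otimes\xi_\alpha=0$ with $[f,f](X,Y)=f^2[X,Y]+[fX,fY]-f[fX,Y]-f[X,fY]$, and for every $1\leq\alpha\leq s$: $\eta^1\wedge\cdots\wedge\eta^s\wedge(d\eta^\alpha)^n\neq 0$ everywhere and $\Phi=d\eta^\alpha$. Convention: $d\eta(X,Y)=\frac12\left(X\eta(Y)-Y\eta(X)-\eta([X,Y])\right)$.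 $\mathcal{L}$ is the distribution orthogonal to the span of $\xi_1,\dots,\xi_s$. For a linear connection $\nabla$ with curvature $R(X,Y)Z=\nabla_X\nabla_YZ-\nabla_Y\nabla_XZ-\nabla_{[X,Y]}Z$, put $R(X,Y,Z,W)=g(R(X,Y)Z,W)$ and, for orthonormal $X,Y$, $K(X,Y)=R(X,Y,Y,X)$. The $\mathcal{L}$-sectional curvature $K_{\mathcal{L}}$ is $K_{\mathcal{L}}(X,Y)=K(X,Y)$ for orthonormal $X,Y\in\mathcal{L}$; it is constant equal to $c$ if this value is $c$ at every point and for all orthonormal $X,Y\in\mathcal{L}$. The scalar curvature with respect to $\nabla$ is $\tau=\frac12\sum_{i,j=1}^{2n+s}K(e_i,e_j)$ for any local orthonormal frame $\{e_1,\dots,e_{2n+s}\}$, the terms with $i=j$ being zero. *)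

theory Defs
  imports "HOL-Analysis.Analysis" "HOL-Library.Function_Algebras"
begin

text \<open>
  Sums, differences and products of real functions and of vector fields are the pointwise ones
  of \<^theory>\<open>HOL-Library.Function_Algebras\<close>.
\<close>

section \<open>Smooth manifolds\<close>

text \<open>Only used on open sets, where it is the usual notion of class \<open>C\<^sup>k\<close>.\<close>

primrec Ck_on :: "nat \<Rightarrow> 'e::euclidean_space set \<Rightarrow> ('e \<Rightarrow> 'b::real_normed_vector) \<Rightarrow> bool" where
  "Ck_on 0 S h \<longleftrightarrow> continuous_on S h"
| "Ck_on (Suc k) S h \<longleftrightarrow>
     (\<forall>x\<in>S. h differentiable (at x)) \<and> (\<forall>v. Ck_on k S (\<lambda>x. frechet_derivative h (at x) v))"

definition smooth_on :: "'e::euclidean_space set \<Rightarrow> ('e \<Rightarrow> 'b::real_normed_vector) \<Rightarrow> bool" where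
  "smooth_on S h \<longleftrightarrow> (\<forall>k. Ck_on k S h)"

text \<open>
  The manifold is the whole type \<open>'a\<close>; its smooth structure is given by an atlas \<open>A\<close> (not
  necessarily maximal), whose elements are pairs of a domain and a coordinate map into the
  model space \<open>'e\<close>. The dimension of the manifold is \<open>DIM('e)\<close>.
\<close>

type_synonym ('a, 'e) atlas = "('a set \<times> ('a \<Rightarrow> 'e)) set"

locale smooth_manifold =
  fixes A :: "('a::{t2_space,second_countable_topology}, 'e::euclidean_space) atlas"
  assumes chart_open: "\<And>U \<phi>. (U, \<phi>) \<in> A \<Longrightarrow> open U \<and> open (\<phi> ` U)"
    and chart_homeomorphism:
      "\<And>U \<phi>. (U, \<phi>) \<in> A \<Longrightarrow> homeomorphism U (\<phi> ` U) \<phi> (inv_into U \<phi>)"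
    and charts_cover: "(\<Union>(U, \<phi>)\<in>A. U) = UNIV"
    and charts_compatible:
      "\<And>U \<phi> V \<psi>. (U, \<phi>) \<in> A \<Longrightarrow> (V, \<psi>) \<in> A \<Longrightarrow>
         smooth_on (\<phi> ` (U \<inter> V)) (\<psi> \<circ> inv_into U \<phi>)"

definition smooth_functions ::
  "('a::topological_space, 'e::euclidean_space) atlas \<Rightarrow> ('a \<Rightarrow> real) set" where
  "smooth_functions A = {h. \<forall>(U, \<phi>)\<in>A. smooth_on (\<phi> ` U) (h \<circ> inv_into U \<phi>)}"

section \<open>Vector fields and tensor fields\<close>

text \<open>
  A vector field is a derivation of the algebra of smooth functions; its value at a point \<open>p\<close> is
  the tangent vector \<open>\<lambda>h. X h p\<close>. It is set to zero on non-smooth functions, so that equality of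
  vector fields is equality in HOL.
\<close>

type_synonym 'a vfield = "('a \<Rightarrow> real) \<Rightarrow> 'a \<Rightarrow> real"

definition vector_fields ::
  "('a::topological_space, 'e::euclidean_space) atlas \<Rightarrow> 'a vfield set" where
  "vector_fields A = {X.
     (\<forall>a\<in>smooth_functions A. X a \<in> smooth_functions A) \<and>
     (\<forall>a\<in>smooth_functions A. \<forall>b\<in>smooth_functions A. X (a + b) = X a + X b) \<and>
     (\<forall>r. \<forall>a\<in>smooth_functions A. X (\<lambda>p. r * a p) = (\<lambda>p. r * X a p)) \<and>
     (\<forall>a\<in>smooth_functions A. \<forall>b\<in>smooth_functions A. X (a * b) = a * X b + X a * b) \<and>
     (\<forall>a. a \<notin> smooth_functions A \<longrightarrow> X a = 0)}"

definition vscale :: "('a \<Rightarrow> real) \<Rightarrow> 'a vfield \<Rightarrow> 'a vfield" (infixr \<open>\<odot>\<close> 75) where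
  "a \<odot> X = (\<lambda>h. a * X h)"

definition lie_bracket :: "'a vfield \<Rightarrow> 'a vfield \<Rightarrow> 'a vfield" where
  "lie_bracket X Y = (\<lambda>h. X (Y h) - Y (X h))"

text \<open>
  Tensor fields are multilinear maps over the ring of smooth functions. Only their values on
  \<^term>\<open>vector_fields A\<close> are meaningful.
\<close>

definition one_form ::
  "('a::topological_space, 'e::euclidean_space) atlas \<Rightarrow> ('a vfield \<Rightarrow> 'a \<Rightarrow> real) \<Rightarrow> bool" where
  "one_form A \<eta> \<longleftrightarrow>
     (\<forall>X\<in>vector_fields A. \<eta> X \<in> smooth_functions A) \<and>
     (\<forall>X\<in>vector_fields A. \<forall>Y\<in>vector_fields A. \<eta> (X + Y) = \<eta> X + \<eta> Y) \<and>
     (\<forall>a\<in>smooth_functions A. \<forall>X\<in>vector_fields A. \<eta> (a \<odot> X) = a * \<eta> X)"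

definition tensor_field_1_1 ::
  "('a::topological_space, 'e::euclidean_space) atlas \<Rightarrow> ('a vfield \<Rightarrow> 'a vfield) \<Rightarrow> bool" where
  "tensor_field_1_1 A f \<longleftrightarrow>
     (\<forall>X\<in>vector_fields A. f X \<in> vector_fields A) \<and>
     (\<forall>X\<in>vector_fields A. \<forall>Y\<in>vector_fields A. f (X + Y) = f X + f Y) \<and>
     (\<forall>a\<in>smooth_functions A. \<forall>X\<in>vector_fields A. f (a \<odot> X) = a \<odot> f X)"

definition riemannian_metric ::
  "('a::topological_space, 'e::euclidean_space) atlas \<Rightarrow>
   ('a vfield \<Rightarrow> 'a vfield \<Rightarrow> 'a \<Rightarrow> real) \<Rightarrow> bool" where
  "riemannian_metric A g \<longleftrightarrow>
     (\<forall>X\<in>vector_fields A. one_form A (g X)) \<and>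
     (\<forall>X\<in>vector_fields A. \<forall>Y\<in>vector_fields A. g X Y = g Y X) \<and>
     (\<forall>X\<in>vector_fields A. \<forall>p. (\<exists>h. X h p \<noteq> 0) \<longrightarrow> g X X p > 0)"

text \<open>Exterior derivative of a 1-form, with the factor \<open>1/2\<close>.\<close>

definition ext_deriv ::
  "('a vfield \<Rightarrow> 'a \<Rightarrow> real) \<Rightarrow> 'a vfield \<Rightarrow> 'a vfield \<Rightarrow> 'a \<Rightarrow> real" where
  "ext_deriv \<eta> X Y = (\<lambda>p. (X (\<eta> Y) p - Y (\<eta> X) p - \<eta> (lie_bracket X Y) p) / 2)"

text \<open>
  A \<open>k\<close>-form is a function of a sequence of vector fields that depends only on the entries
  \<open>0, \<dots>, k - 1\<close>. The wedge product of a \<open>k\<close>-form and an \<open>l\<close>-form carries the factor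
  \<open>1/(k + l)!\<close>, the normalization that goes with the factor \<open>1/2\<close> in \<^const>\<open>ext_deriv\<close>.
\<close>

type_synonym 'a dform = "(nat \<Rightarrow> 'a vfield) \<Rightarrow> 'a \<Rightarrow> real"

definition wedge :: "nat \<Rightarrow> nat \<Rightarrow> 'a dform \<Rightarrow> 'a dform \<Rightarrow> 'a dform" where
  "wedge k l \<omega> \<theta> = (\<lambda>X p.
     (\<Sum>\<pi> | \<pi> permutes {..<k + l}.
        of_int (sign \<pi>) * \<omega> (\<lambda>i. X (\<pi> i)) p * \<theta> (\<lambda>i. X (\<pi> (k + i))) p) / fact (k + l))"

primrec wedge_one_forms :: "(nat \<Rightarrow> 'a vfield \<Rightarrow> 'a \<Rightarrow> real) \<Rightarrow> nat \<Rightarrow> 'a dform" where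
  "wedge_one_forms \<eta> 0 = (\<lambda>X p. 1)"
| "wedge_one_forms \<eta> (Suc k) = wedge k 1 (wedge_one_forms \<eta> k) (\<lambda>X. \<eta> (Suc k) (X 0))"

primrec wedge_power :: "('a vfield \<Rightarrow> 'a vfield \<Rightarrow> 'a \<Rightarrow> real) \<Rightarrow> nat \<Rightarrow> 'a dform" where
  "wedge_power \<Omega> 0 = (\<lambda>X p. 1)"
| "wedge_power \<Omega> (Suc k) = wedge (2 * k) 2 (wedge_power \<Omega> k) (\<lambda>X. \<Omega> (X 0) (X 1))"

definition nowhere_vanishing ::
  "('a::topological_space, 'e::euclidean_space) atlas \<Rightarrow> 'a dform \<Rightarrow> bool" where
  "nowhere_vanishing A \<omega> \<longleftrightarrow> (\<forall>p. \<exists>X. (\<forall>i. X i \<in> vector_fields A) \<and> \<omega> X p \<noteq> 0)"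

section \<open>Metric f-manifolds and S-manifolds\<close>

locale metric_f_manifold = smooth_manifold A
  for A :: "('a::{t2_space,second_countable_topology}, 'e::euclidean_space) atlas" +
  fixes n s :: nat
    and f :: "'a vfield \<Rightarrow> 'a vfield"
    and \<xi> :: "nat \<Rightarrow> 'a vfield"
    and \<eta> :: "nat \<Rightarrow> 'a vfield \<Rightarrow> 'a \<Rightarrow> real"
    and g :: "'a vfield \<Rightarrow> 'a vfield \<Rightarrow> 'a \<Rightarrow> real"
  assumes n_pos: "n \<ge> 1" and s_pos: "s \<ge> 1"
    and dimension: "DIM('e) = 2 * n + s"
    and f_tensor: "tensor_field_1_1 A f"
    and \<xi>_field: "\<And>\<alpha>. \<alpha> \<in> {1..s} \<Longrightarrow> \<xi> \<alpha> \<in> vector_fields A"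
    and \<eta>_form: "\<And>\<alpha>. \<alpha> \<in> {1..s} \<Longrightarrow> one_form A (\<eta> \<alpha>)"
    and g_metric: "riemannian_metric A g"
    and f_square: "\<And>X. X \<in> vector_fields A \<Longrightarrow> f (f X) = - X + (\<Sum>\<alpha>\<in>{1..s}. \<eta> \<alpha> X \<odot> \<xi> \<alpha>)"
    and \<eta>_\<xi>: "\<And>\<alpha> \<beta>. \<alpha> \<in> {1..s} \<Longrightarrow> \<beta> \<in> {1..s} \<Longrightarrow>
           \<eta> \<alpha> (\<xi> \<beta>) = (\<lambda>p. if \<alpha> = \<beta> then 1 else 0)"
    and f_\<xi>: "\<And>\<alpha>. \<alpha> \<in> {1..s} \<Longrightarrow> f (\<xi> \<alpha>) = 0"
    and \<eta>_f: "\<And>\<alpha> X. \<alpha> \<in> {1..s} \<Longrightarrow> X \<in> vector_fields A \<Longrightarrow> \<eta> \<alpha> (f X) = 0"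
    and g_f_f: "\<And>X Y. X \<in> vector_fields A \<Longrightarrow> Y \<in> vector_fields A \<Longrightarrow>
           g (f X) (f Y) = g X Y - (\<Sum>\<alpha>\<in>{1..s}. \<eta> \<alpha> X * \<eta> \<alpha> Y)"
    and \<eta>_g: "\<And>\<alpha> X. \<alpha> \<in> {1..s} \<Longrightarrow> X \<in> vector_fields A \<Longrightarrow> \<eta> \<alpha> X = g X (\<xi> \<alpha>)"
    and g_f_skew: "\<And>X Y. X \<in> vector_fields A \<Longrightarrow> Y \<in> vector_fields A \<Longrightarrow>
           g X (f Y) = - g (f X) Y"

definition fundamental_form ::
  "('a vfield \<Rightarrow> 'a vfield) \<Rightarrow> ('a vfield \<Rightarrow> 'a vfield \<Rightarrow> 'a \<Rightarrow> real) \<Rightarrow>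
   'a vfield \<Rightarrow> 'a vfield \<Rightarrow> 'a \<Rightarrow> real" where
  "fundamental_form f g X Y = g X (f Y)"

definition nijenhuis ::
  "('a vfield \<Rightarrow> 'a vfield) \<Rightarrow> 'a vfield \<Rightarrow> 'a vfield \<Rightarrow> 'a vfield" where
  "nijenhuis f X Y = f (f (lie_bracket X Y)) + lie_bracket (f X) (f Y)
     - f (lie_bracket (f X) Y) - f (lie_bracket X (f Y))"

locale S_manifold = metric_f_manifold A n s f \<xi> \<eta> g
  for A :: "('a::{t2_space,second_countable_topology}, 'e::euclidean_space) atlas"
    and n s f \<xi> \<eta> g +
  assumes normal: "\<And>X Y. X \<in> vector_fields A \<Longrightarrow> Y \<in> vector_fields A \<Longrightarrow>
        nijenhuis f X Y + (\<Sum>\<alpha>\<in>{1..s}. (\<lambda>p. 2 * ext_deriv (\<eta> \<alpha>) X Y p) \<odot> \<xi> \<alpha>) = 0"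
    and volume: "\<And>\<alpha>. \<alpha> \<in> {1..s} \<Longrightarrow>
        nowhere_vanishing A
          (wedge s (2 * n) (wedge_one_forms \<eta> s) (wedge_power (ext_deriv (\<eta> \<alpha>)) n))"
    and fundamental_eq: "\<And>\<alpha> X Y. \<alpha> \<in> {1..s} \<Longrightarrow> X \<in> vector_fields A \<Longrightarrow> Y \<in> vector_fields A \<Longrightarrow>
        fundamental_form f g X Y = ext_deriv (\<eta> \<alpha>) X Y"

section \<open>Connections and curvature\<close>

definition linear_connection ::
  "('a::topological_space, 'e::euclidean_space) atlas \<Rightarrow>
   ('a vfield \<Rightarrow> 'a vfield \<Rightarrow> 'a vfield) \<Rightarrow> bool" where
  "linear_connection A D \<longleftrightarrow>
     (\<forall>X\<in>vector_fields A. \<forall>Y\<in>vector_fields A. D X Y \<in> vector_fields A) \<and>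
     (\<forall>X\<in>vector_fields A. \<forall>Y\<in>vector_fields A. \<forall>Z\<in>vector_fields A.
        D (X + Y) Z = D X Z + D Y Z \<and> D X (Y + Z) = D X Y + D X Z) \<and>
     (\<forall>a\<in>smooth_functions A. \<forall>X\<in>vector_fields A. \<forall>Y\<in>vector_fields A.
        D (a \<odot> X) Y = a \<odot> D X Y \<and> D X (a \<odot> Y) = X a \<odot> Y + a \<odot> D X Y)"

definition levi_civita_connection ::
  "('a::topological_space, 'e::euclidean_space) atlas \<Rightarrow>
   ('a vfield \<Rightarrow> 'a vfield \<Rightarrow> 'a \<Rightarrow> real) \<Rightarrow> ('a vfield \<Rightarrow> 'a vfield \<Rightarrow> 'a vfield) \<Rightarrow> bool" where
  "levi_civita_connection A g D \<longleftrightarrow>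
     linear_connection A D \<and>
     (\<forall>X\<in>vector_fields A. \<forall>Y\<in>vector_fields A. D X Y - D Y X = lie_bracket X Y) \<and>
     (\<forall>X\<in>vector_fields A. \<forall>Y\<in>vector_fields A. \<forall>Z\<in>vector_fields A.
        X (g Y Z) = g (D X Y) Z + g Y (D X Z))"

definition curvature ::
  "('a vfield \<Rightarrow> 'a vfield \<Rightarrow> 'a vfield) \<Rightarrow> 'a vfield \<Rightarrow> 'a vfield \<Rightarrow> 'a vfield \<Rightarrow> 'a vfield" where
  "curvature D X Y Z = D X (D Y Z) - D Y (D X Z) - D (lie_bracket X Y) Z"

text \<open>\<open>K(X, Y) = R(X, Y, Y, X)\<close>, used at points where \<open>X\<close> and \<open>Y\<close> are orthonormal.\<close>

definition sectional_curvature ::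
  "('a vfield \<Rightarrow> 'a vfield \<Rightarrow> 'a \<Rightarrow> real) \<Rightarrow> ('a vfield \<Rightarrow> 'a vfield \<Rightarrow> 'a vfield) \<Rightarrow>
   'a vfield \<Rightarrow> 'a vfield \<Rightarrow> 'a \<Rightarrow> real" where
  "sectional_curvature g D X Y = g (curvature D X Y Y) X"

text \<open>\<open>X\<close> takes at \<open>p\<close> a value in the distribution orthogonal to the structure vector fields.\<close>

definition in_L_at ::
  "('a vfield \<Rightarrow> 'a vfield \<Rightarrow> 'a \<Rightarrow> real) \<Rightarrow> nat \<Rightarrow> (nat \<Rightarrow> 'a vfield) \<Rightarrow> 'a \<Rightarrow> 'a vfield \<Rightarrow> bool" where
  "in_L_at g s \<xi> p X \<longleftrightarrow> (\<forall>\<alpha>\<in>{1..s}. g X (\<xi> \<alpha>) p = 0)"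

text \<open>
  Tangent vectors at \<open>p\<close> are represented by vector fields through their value at \<open>p\<close>:
  every tangent vector extends to a vector field, and by tensoriality the curvature at \<open>p\<close> does
  not depend on the extension. So the fields below have to be orthonormal at \<open>p\<close> only.
\<close>

definition constant_L_sectional_curvature ::
  "('a::topological_space, 'e::euclidean_space) atlas \<Rightarrow>
   ('a vfield \<Rightarrow> 'a vfield \<Rightarrow> 'a \<Rightarrow> real) \<Rightarrow> nat \<Rightarrow> (nat \<Rightarrow> 'a vfield) \<Rightarrow>
   ('a vfield \<Rightarrow> 'a vfield \<Rightarrow> 'a vfield) \<Rightarrow> real \<Rightarrow> bool" where
  "constant_L_sectional_curvature A g s \<xi> D c \<longleftrightarrow>
     (\<forall>p. \<forall>X\<in>vector_fields A. \<forall>Y\<in>vector_fields A.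
        in_L_at g s \<xi> p X \<and> in_L_at g s \<xi> p Y \<and>
        g X X p = 1 \<and> g Y Y p = 1 \<and> g X Y p = 0 \<longrightarrow>
        sectional_curvature g D X Y p = c)"

definition orthonormal_frame_at ::
  "('a::topological_space, 'e::euclidean_space) atlas \<Rightarrow>
   ('a vfield \<Rightarrow> 'a vfield \<Rightarrow> 'a \<Rightarrow> real) \<Rightarrow> 'a \<Rightarrow> (nat \<Rightarrow> 'a vfield) \<Rightarrow> bool" where
  "orthonormal_frame_at A g p e \<longleftrightarrow>
     (\<forall>i\<in>{1..DIM('e)}. e i \<in> vector_fields A) \<and>
     (\<forall>i\<in>{1..DIM('e)}. \<forall>j\<in>{1..DIM('e)}. g (e i) (e j) p = (if i = j then 1 else 0))"

text \<open>
  The description asserts nothing by itself: a value of \<open>scalar_curvature\<close> can only be computed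
  from the existence of a frame and from the independence of the sum of the chosen frame.
\<close>

definition scalar_curvature ::
  "('a::topological_space, 'e::euclidean_space) atlas \<Rightarrow>
   ('a vfield \<Rightarrow> 'a vfield \<Rightarrow> 'a \<Rightarrow> real) \<Rightarrow> ('a vfield \<Rightarrow> 'a vfield \<Rightarrow> 'a vfield) \<Rightarrow> 'a \<Rightarrow> real" where
  "scalar_curvature A g D p =
     (THE t. \<exists>e. orthonormal_frame_at A g p e \<and>
        t = (\<Sum>i\<in>{1..DIM('e)}. \<Sum>j\<in>{1..DIM('e)} - {i}. sectional_curvature g D (e i) (e j) p) / 2)"

end

theory Submission
  imports Defs
begin

text \<open>
  Write \<open>\<xi> = \<Sum>\<^sub>\<alpha> \<xi>\<^sub>\<alpha>\<close> and \<open>\<eta> = \<Sum>\<^sub>\<alpha> \<eta>\<^sup>\<alpha>\<close>. Normality makes the \<open>\<xi>\<^sub>\<alpha>\<close> Killing fields, hence \<open>\<nabla>\<^sub>X \<xi>\<^sub>\<alpha> = - fX\<close>,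
  and then forces \<open>(\<nabla>\<^sub>X f) Y = g(fX,fY) \<xi> + \<eta>(Y) f\<^sup>2 X\<close>. The first formula determines \<open>R(X,Y) \<xi>\<^sub>\<alpha>\<close>, the
  second one determines \<open>R(X,Y) \<circ> f - f \<circ> R(X,Y)\<close> on \<open>\<L>\<close>. If \<open>X, fX, Y, fY\<close> are orthonormal in \<open>\<L>\<close>, which
  is possible for \<open>n \<ge> 2\<close>, this commutator gives \<open>R(X,Y,fY,fX) - K(X,Y) = - s\<close>; polarizing the constant
  curvature \<open>c\<close> of \<open>\<L>\<close> gives \<open>R(X,Y,fY,fX) = 0\<close>, so \<open>c = s\<close>. Now \<open>K(X,Y)\<close> is known for all \<open>X\<close> and \<open>Y\<close>, and
  it is summed over a frame with Parseval's identity.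

  Vector fields are given as derivations. That their values at a point form a space of dimension
  \<open>DIM('e)\<close> follows from Hadamard's lemma and bump functions.
\<close>

section \<open>Smooth functions on open sets\<close>

text \<open>Vector fields are only known as derivations of globally defined functions, so
  coordinates, frames and the pointwise nature of tensors have to be recovered first; this is done
  at one point at a time. In the curvature computations the coefficients of linear combinations are
  frozen to their values at that point. The formula for \<nabla>f is obtained by comparing its two
  sides: both satisfy the same inhomogeneous identities (skewness, cyclicity, derivative of f^2,
  normality), so their difference satisfies the homogeneous ones, and these leave only zero. The
  number s enters because all \<xi>_\<alpha> have the same derivative - fX, so that their sum has
  derivative - s fX; this sum occurs in \<nabla>f and is differentiated once more in the commutator
  of curvature and f. The scalar curvature refers to arbitrary orthonormal frames, which need not
  contain the \<xi>_\<alpha>. Hence K is computed for vectors with both horizontal and vertical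
  parts, and its sum is controlled by the matrix g(f e_i, f e_j) of the orthogonal projection onto
  the distribution orthogonal to the \<xi>_\<alpha>.\<close>

lemma Ck_on_cong:
  assumes "open S" "\<And>x. x \<in> S \<Longrightarrow> h x = k x"
  shows "Ck_on m S h \<longleftrightarrow> Ck_on m S k"
  using assms(2)
proof (induction m arbitrary: h k)
  case 0
  then show ?case by (simp cong: continuous_on_cong)
next
  case (Suc m)
  have *: "(h has_derivative D) (at x) \<longleftrightarrow> (k has_derivative D) (at x)" if "x \<in> S" for x D
    using has_derivative_transform_within_open[OF _ assms(1) that, of h D UNIV k]
      has_derivative_transform_within_open[OF _ assms(1) that, of k D UNIV h] Suc.prems
    by (metis)
  then have "frechet_derivative h (at x) = frechet_derivative k (at x)" if "x \<in> S" for x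
    using that by (simp add: frechet_derivative_def)
  then have "Ck_on m S (\<lambda>x. frechet_derivative h (at x) v) =
      Ck_on m S (\<lambda>x. frechet_derivative k (at x) v)" for v
    by (intro Suc.IH) simp
  then show ?case using * by (simp add: differentiable_def)
qed

lemma smooth_on_cong:
  assumes "open S" "\<And>x. x \<in> S \<Longrightarrow> h x = k x"
  shows "smooth_on S h \<longleftrightarrow> smooth_on S k"
  using Ck_on_cong[OF assms] by (simp add: smooth_on_def)

lemma Ck_on_subset: "Ck_on m S h \<Longrightarrow> T \<subseteq> S \<Longrightarrow> Ck_on m T h"
proof (induction m arbitrary: h)
  case 0
  then show ?case by (auto intro: continuous_on_subset)
qed auto

lemma smooth_on_subset: "smooth_on S h \<Longrightarrow> T \<subseteq> S \<Longrightarrow> smooth_on T h"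
  unfolding smooth_on_def by (blast intro: Ck_on_subset)

lemma Ck_on_Un:
  assumes "open S" "open T" "Ck_on m S h" "Ck_on m T h"
  shows "Ck_on m (S \<union> T) h"
  using assms(3,4)
proof (induction m arbitrary: h)
  case 0
  then show ?case using assms by (auto intro: continuous_on_open_Un)
qed auto

lemma smooth_on_Un:
  "open S \<Longrightarrow> open T \<Longrightarrow> smooth_on S h \<Longrightarrow> smooth_on T h \<Longrightarrow> smooth_on (S \<union> T) h"
  unfolding smooth_on_def by (blast intro: Ck_on_Un)

text \<open>On an open set the derivative is unique, so any explicit formula for it may replace the
  choice made by \<open>frechet_derivative\<close>. All closure properties below go through this
  rule.\<close>

lemma Ck_on_SucI:
  assumes "open S" "\<And>x. x \<in> S \<Longrightarrow> (h has_derivative h' x) (at x)"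
    and "\<And>v. Ck_on m S (\<lambda>x. h' x v)"
  shows "Ck_on (Suc m) S h"
proof -
  have "frechet_derivative h (at x) = h' x" if "x \<in> S" for x
    using frechet_derivative_at[OF assms(2)[OF that]] by simp
  then have "Ck_on m S (\<lambda>x. frechet_derivative h (at x) v)" for v
    using assms(3)[of v] by (subst Ck_on_cong[OF assms(1), of _ "\<lambda>x. h' x v"]) auto
  then show ?thesis using assms(2) by (auto simp: differentiable_def)
qed

lemma Ck_on_has_derivative:
  "Ck_on (Suc m) S h \<Longrightarrow> x \<in> S \<Longrightarrow> (h has_derivative frechet_derivative h (at x)) (at x)"
  using frechet_derivative_works by auto

lemma Ck_on_SucD: "Ck_on (Suc m) S h \<Longrightarrow> Ck_on m S h"
proof (induction m arbitrary: h)
  case 0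
  then show ?case
    by (auto intro!: continuous_at_imp_continuous_on differentiable_imp_continuous_within)
qed simp

lemma smooth_on_has_derivative:
  "smooth_on S h \<Longrightarrow> x \<in> S \<Longrightarrow> (h has_derivative frechet_derivative h (at x)) (at x)"
  using Ck_on_has_derivative unfolding smooth_on_def by blast

lemma smooth_on_frechet_derivative:
  "smooth_on S h \<Longrightarrow> smooth_on S (\<lambda>x. frechet_derivative h (at x) v)"
  unfolding smooth_on_def by (metis Ck_on.simps(2))

lemma smooth_on_imp_continuous_on: "smooth_on S h \<Longrightarrow> continuous_on S h"
  unfolding smooth_on_def by (metis Ck_on.simps(1))

lemma Ck_on_const: "open S \<Longrightarrow> Ck_on m S (\<lambda>x. c)"
proof (induction m arbitrary: c)
  case (Suc m)
  then show ?case by (intro Ck_on_SucI[where h' = "\<lambda>x v. 0"]) auto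
qed simp

lemma smooth_on_const: "open S \<Longrightarrow> smooth_on S (\<lambda>x. c)"
  by (simp add: smooth_on_def Ck_on_const)

lemma smooth_on_bounded_linear:
  assumes "open S" "bounded_linear h"
  shows "smooth_on S h"
  unfolding smooth_on_def
proof
  fix m show "Ck_on m S h"
  proof (cases m)
    case 0
    then show ?thesis using assms by (simp add: linear_continuous_on)
  next
    case (Suc k)
    then show ?thesis unfolding Suc using assms
      by (intro Ck_on_SucI[where h' = "\<lambda>x. h"])
        (auto intro: Ck_on_const bounded_linear_imp_has_derivative)
  qed
qed

lemma Ck_on_bounded_linear:
  assumes "open S" "bounded_linear L" "Ck_on m S h"
  shows "Ck_on m S (\<lambda>x. L (h x))"
  using assms(3)
proof (induction m arbitrary: h)
  case 0
  then show ?case using assms(2) by (auto intro: bounded_linear.continuous_on)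
next
  case (Suc m)
  show ?case
  proof (rule Ck_on_SucI[OF assms(1)])
    show "((\<lambda>x. L (h x)) has_derivative (\<lambda>v. L (frechet_derivative h (at x) v))) (at x)"
      if "x \<in> S" for x
      using bounded_linear.has_derivative[OF assms(2) Ck_on_has_derivative[OF Suc.prems that]] .
    show "Ck_on m S (\<lambda>x. L (frechet_derivative h (at x) v))" for v
      using Suc.prems by (intro Suc.IH) auto
  qed
qed

lemma Ck_on_add:
  assumes "open S" "Ck_on m S h" "Ck_on m S k"
  shows "Ck_on m S (\<lambda>x. h x + k x)"
  using assms(2,3)
proof (induction m arbitrary: h k)
  case 0
  then show ?case by (simp add: continuous_on_add continuous_on_mult)
next
  case (Suc m)
  show ?case
  proof (rule Ck_on_SucI[OF assms(1)])
    show "((\<lambda>x. h x + k x) has_derivative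
        (\<lambda>v. frechet_derivative h (at x) v + frechet_derivative k (at x) v)) (at x)"
      if "x \<in> S" for x
      using that Suc.prems by (intro has_derivative_add Ck_on_has_derivative)
    show "Ck_on m S (\<lambda>x. frechet_derivative h (at x) v + frechet_derivative k (at x) v)" for v
      using Suc.prems by (intro Suc.IH) auto
  qed
qed

lemma smooth_on_add:
  "open S \<Longrightarrow> smooth_on S h \<Longrightarrow> smooth_on S k \<Longrightarrow> smooth_on S (\<lambda>x. h x + k x)"
  by (simp add: smooth_on_def Ck_on_add)

lemma Ck_on_sum:
  assumes "open S" "\<And>i. i \<in> I \<Longrightarrow> Ck_on m S (h i)"
  shows "Ck_on m S (\<lambda>x. \<Sum>i\<in>I. h i x)"
  using assms(2)
proof (induction I rule: infinite_finite_induct)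
  case (insert i I)
  then show ?case using Ck_on_add[OF assms(1), of m "h i"] by simp
qed (simp_all add: Ck_on_const assms(1))

lemma Ck_on_mult:
  fixes h k :: "'e::euclidean_space \<Rightarrow> real"
  assumes "open S" "Ck_on m S h" "Ck_on m S k"
  shows "Ck_on m S (\<lambda>x. h x * k x)"
  using assms(2,3)
proof (induction m arbitrary: h k)
  case 0
  then show ?case by (simp add: continuous_on_add continuous_on_mult)
next
  case (Suc m)
  show ?case
  proof (rule Ck_on_SucI[OF assms(1)])
    show "((\<lambda>x. h x * k x) has_derivative
        (\<lambda>v. h x * frechet_derivative k (at x) v + frechet_derivative h (at x) v * k x)) (at x)"
      if "x \<in> S" for x
      using that Suc.prems by (intro has_derivative_mult Ck_on_has_derivative)
    show "Ck_on m S (\<lambda>x. h x * frechet_derivative k (at x) v + frechet_derivative h (at x) v * k x)"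
      for v
      using Suc.prems Ck_on_SucD[OF Suc.prems(1)] Ck_on_SucD[OF Suc.prems(2)]
      by (intro Ck_on_add Suc.IH assms(1)) auto
  qed
qed

lemma smooth_on_mult:
  fixes h k :: "'e::euclidean_space \<Rightarrow> real"
  shows "open S \<Longrightarrow> smooth_on S h \<Longrightarrow> smooth_on S k \<Longrightarrow> smooth_on S (\<lambda>x. h x * k x)"
  by (simp add: smooth_on_def Ck_on_mult)

text \<open>The chain rule is expanded over \<open>Basis\<close>: the derivative of the composite is
  a sum of products of components of the derivative of \<open>G\<close> with partial derivatives of
  \<open>F\<close> at \<open>G x\<close>. The latter are composites with the same \<open>G\<close>,
  so the induction keeps \<open>G\<close> fixed and varies \<open>F\<close>.\<close>

lemma Ck_on_compose:
  fixes F :: "'b::euclidean_space \<Rightarrow> real" and G :: "'a::euclidean_space \<Rightarrow> 'b"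
  assumes "open S" "G ` S \<subseteq> T" "Ck_on m T F" "Ck_on m S G"
  shows "Ck_on m S (\<lambda>x. F (G x))"
  using assms(3,4)
proof (induction m arbitrary: F)
  case 0
  then show ?case
    using assms(2) by (auto intro: continuous_on_compose2)
next
  case (Suc m)
  let ?h' = "\<lambda>x v. \<Sum>i\<in>Basis. (frechet_derivative G (at x) v \<bullet> i) * frechet_derivative F (at (G x)) i"
  show ?case
  proof (rule Ck_on_SucI[OF assms(1)])
    fix x assume x: "x \<in> S"
    have F: "(F has_derivative frechet_derivative F (at (G x))) (at (G x))"
      using x assms(2) Suc.prems(1) by (intro Ck_on_has_derivative) auto
    interpret L: linear "frechet_derivative F (at (G x))"
      using F by (rule has_derivative_linear)
    have "((\<lambda>x. F (G x)) has_derivative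
        (\<lambda>v. frechet_derivative F (at (G x)) (frechet_derivative G (at x) v))) (at x)"
      by (rule has_derivative_compose[OF Ck_on_has_derivative[OF Suc.prems(2) x] F])
    moreover have rep: "frechet_derivative F (at (G x)) w
        = (\<Sum>i\<in>Basis. (w \<bullet> i) * frechet_derivative F (at (G x)) i)" for w
    proof -
      have "frechet_derivative F (at (G x)) w =
          frechet_derivative F (at (G x)) (\<Sum>i\<in>Basis. (w \<bullet> i) *\<^sub>R i)"
        by (simp only: euclidean_representation)
      then show ?thesis by (simp only: L.sum L.scale real_scaleR_def)
    qed
    ultimately show "((\<lambda>x. F (G x)) has_derivative ?h' x) (at x)"
      by (subst (asm) rep)
  next
    fix v
    show "Ck_on m S (\<lambda>x. ?h' x v)"
      using Suc.prems Ck_on_SucD[OF Suc.prems(2)]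
      by (intro Ck_on_sum Ck_on_mult Suc.IH assms(1)
          Ck_on_bounded_linear[OF assms(1) bounded_linear_inner_left]) auto
  qed
qed

lemma smooth_on_compose:
  fixes F :: "'b::euclidean_space \<Rightarrow> real" and G :: "'a::euclidean_space \<Rightarrow> 'b"
  shows "open S \<Longrightarrow> G ` S \<subseteq> T \<Longrightarrow> smooth_on T F \<Longrightarrow> smooth_on S G \<Longrightarrow> smooth_on S (\<lambda>x. F (G x))"
  unfolding smooth_on_def using Ck_on_compose by blast

section \<open>Bump functions\<close>

text \<open>The powers of \<open>x\<close> in the denominator make the family closed under
  differentiation up to linear combinations, so smoothness of all members follows by one
  induction.\<close>

definition flat_exp :: "nat \<Rightarrow> real \<Rightarrow> real" where
  "flat_exp j x = (if x > 0 then exp (- 1 / x) / x ^ j else 0)"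

lemma flat_exp_has_derivative:
  "(flat_exp j has_real_derivative flat_exp (j + 2) x - real j * flat_exp (j + 1) x) (at x)"
proof (cases x "0::real" rule: linorder_cases)
  case less
  then have "((\<lambda>_. 0::real) has_real_derivative flat_exp (j + 2) x - real j * flat_exp (j + 1) x) (at x)"
    by (simp add: flat_exp_def)
  then show ?thesis
    by (rule has_field_derivative_transform_within_open[OF _ open_lessThan[of 0]])
      (use less in \<open>auto simp: flat_exp_def\<close>)
next
  case greater
  have "((\<lambda>x. exp (- 1 / x) / x ^ j) has_real_derivative
      flat_exp (j + 2) x - real j * flat_exp (j + 1) x) (at x)"
    using greater
    apply (auto intro!: derivative_eq_intros simp: flat_exp_def)
    \<comment> \<open>The derivative of \<open>x ^ j\<close> has the truncated exponent
      \<open>j - 1\<close>, so \<open>j = 0\<close> is treated apart.\<close>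
    apply (cases j)
     apply (simp_all add: field_simps power2_eq_square)
    done
  then show ?thesis
    by (rule has_field_derivative_transform_within_open[OF _ open_greaterThan[of 0]])
      (use greater in \<open>auto simp: flat_exp_def\<close>)
next
  case equal
  \<comment> \<open>The difference quotient of \<open>flat_exp j\<close> at 0 is
    \<open>flat_exp (Suc j)\<close>. With y replaced by 1/y its limit from the right is that of
    \<open>y ^ Suc j / exp y\<close> at infinity.\<close>
  have r: "((\<lambda>y. flat_exp (Suc j) y) \<longlongrightarrow> 0) (at_right 0)"
  proof (rule Lim_transform_eventually)
    have "((\<lambda>y::real. y ^ Suc j / exp y) \<longlongrightarrow> 0) at_top" by (rule tendsto_power_div_exp_0)
    from filterlim_compose[OF this filterlim_inverse_at_top_right]
    show "((\<lambda>y::real. inverse y ^ Suc j / exp (inverse y)) \<longlongrightarrow> 0) (at_right 0)" .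
    show "\<forall>\<^sub>F y in at_right 0. inverse y ^ Suc j / exp (inverse y) = flat_exp (Suc j) y"
      using eventually_at_right_less[of "0::real"]
      by eventually_elim (auto simp: flat_exp_def field_simps exp_minus)
  qed
  have l: "((\<lambda>y. flat_exp (Suc j) y) \<longlongrightarrow> 0) (at_left 0)"
    by (rule tendsto_eventually) (auto simp: flat_exp_def eventually_at_filter)
  have "((\<lambda>y. flat_exp (Suc j) y) \<longlongrightarrow> 0) (at 0)"
    using l r by (simp add: filterlim_split_at)
  moreover have "flat_exp (Suc j) y = (flat_exp j y - flat_exp j 0) / (y - 0)" if "y \<noteq> 0" for y
    using that by (auto simp: flat_exp_def)
  ultimately have "((\<lambda>y. (flat_exp j y - flat_exp j 0) / (y - 0)) \<longlongrightarrow> 0) (at 0)"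
    by (smt (verit) Lim_cong_within UNIV_I)
  then show ?thesis unfolding equal by (simp add: has_field_derivative_iff flat_exp_def)
qed

lemma smooth_on_flat_exp: "smooth_on UNIV (flat_exp j)"
  unfolding smooth_on_def
proof
  fix m show "Ck_on m UNIV (flat_exp j)"
  proof (induction m arbitrary: j)
    case 0
    then show ?case
      using flat_exp_has_derivative by (auto intro!: DERIV_isCont continuous_at_imp_continuous_on)
  next
    case (Suc m)
    have "Ck_on m UNIV (\<lambda>x. (flat_exp (j + 2) x + (- real j) * flat_exp (j + 1) x) * v)" for v
      by (intro Ck_on_mult Ck_on_add Ck_on_const Suc.IH open_UNIV)
    then show ?case
      using flat_exp_has_derivative[of j]
      by (intro Ck_on_SucI[where h' = "\<lambda>x v. (flat_exp (j + 2) x + (- real j) * flat_exp (j + 1) x) * v"])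
        (auto simp: has_field_derivative_def)
  qed
qed

lemma bump_function_exists:
  fixes c :: "'e::euclidean_space" and r :: real
  assumes "r > 0"
  obtains b :: "'e \<Rightarrow> real" where "smooth_on UNIV b" "b c > 0" "\<And>x. x \<notin> ball c r \<Longrightarrow> b x = 0"
proof -
  \<comment> \<open>This is r^2 minus the squared distance to c, positive exactly inside the ball.
    It is spelled out in sums and products so that the closure rules for \<open>Ck_on\<close> apply
    literally.\<close>
  let ?q = "\<lambda>x. r\<^sup>2 + (- 1) * (\<Sum>i\<in>Basis. ((x + - c) \<bullet> i) * ((x + - c) \<bullet> i))"
  let ?b = "\<lambda>x. flat_exp 0 (?q x)"
  have sq: "(\<Sum>i\<in>Basis. ((x + - c) \<bullet> i) * ((x + - c) \<bullet> i)) = (dist c x)\<^sup>2" for x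
    by (subst euclidean_inner[symmetric]) (simp add: power2_norm_eq_inner[symmetric] dist_norm norm_minus_commute)
  have d: "Ck_on k UNIV (\<lambda>x::'e. (x + - c) \<bullet> i)" for k i
    using smooth_on_bounded_linear[OF open_UNIV bounded_linear_ident]
    by (intro Ck_on_bounded_linear[where L = "\<lambda>z. z \<bullet> i" and h = "\<lambda>x. x + - c"]
        bounded_linear_inner_left Ck_on_add Ck_on_const open_UNIV) (unfold smooth_on_def, blast)
  have "smooth_on UNIV ?q"
    unfolding smooth_on_def
    by (intro allI Ck_on_add Ck_on_mult Ck_on_const open_UNIV
        Ck_on_sum[where h = "\<lambda>i x. ((x + - c) \<bullet> i) * ((x + - c) \<bullet> i)"] d)
  then have 1: "smooth_on UNIV ?b"
    by (rule smooth_on_compose[OF open_UNIV subset_UNIV smooth_on_flat_exp])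
  have 2: "?b c > 0" using assms by (simp add: flat_exp_def)
  have 3: "?b x = 0" if "x \<notin> ball c r" for x
  proof -
    have "r\<^sup>2 \<le> (dist c x)\<^sup>2" using that assms by (intro power_mono) auto
    then show ?thesis unfolding sq by (simp add: flat_exp_def)
  qed
  show thesis using 1 2 3 by (rule that)
qed

section \<open>Hadamard's lemma\<close>

text \<open>Differentiation under the integral sign produces a factor t from the inner map. Allowing
  a weight \<open>t ^ j\<close> therefore gives a family of integrals closed under differentiation,
  with \<open>F\<close> replaced by a directional derivative.\<close>

lemma has_derivative_ray_integral:
  fixes F :: "'e::euclidean_space \<Rightarrow> real"
  assumes "open W" "convex W" "c \<in> W" "smooth_on W F" "x \<in> W"
  shows "((\<lambda>y. integral {0..1} (\<lambda>t. t ^ j * F (c + t *\<^sub>R (y - c)))) has_derivative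
     (\<lambda>v. integral {0..1} (\<lambda>t. t ^ Suc j * frechet_derivative F (at (c + t *\<^sub>R (x - c))) v))) (at x)"
proof -
  let ?dF = "\<lambda>y. frechet_derivative F (at y)"
  \<comment> \<open>\<open>leibniz_rule\<close> wants the derivative of the integrand as a
    continuous family of bounded linear maps; continuity is checked componentwise.\<close>
  let ?fx = "\<lambda>y t. Blinfun (\<lambda>v. t ^ Suc j * ?dF (c + t *\<^sub>R (y - c)) v)"
  have in_W: "c + t *\<^sub>R (y - c) \<in> W" if "y \<in> W" "t \<in> {0..1}" for y t
  proof -
    have "(1 - t) *\<^sub>R c + t *\<^sub>R y \<in> W"
      using that assms(2,3) by (intro convexD) auto
    then show ?thesis by (simp add: algebra_simps)
  qed
  have lin: "bounded_linear (\<lambda>v. t ^ Suc j * ?dF (c + t *\<^sub>R (y - c)) v)" if "y \<in> W" "t \<in> {0..1}" for y t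
    using has_derivative_bounded_linear[OF smooth_on_has_derivative[OF assms(4) in_W[OF that]]]
    by (rule bounded_linear_const_mult)
  have app: "blinfun_apply (?fx y t) = (\<lambda>v. t ^ Suc j * ?dF (c + t *\<^sub>R (y - c)) v)"
    if "y \<in> W" "t \<in> {0..1}" for y t
    using lin[OF that] by (rule bounded_linear_Blinfun_apply)
  have ray: "continuous_on (W \<times> {0..1}) (\<lambda>z. c + snd z *\<^sub>R (fst z - c))"
    by (intro continuous_intros)
  have cont: "continuous_on (W \<times> cbox 0 1) (\<lambda>(y, t). ?fx y t)"
  proof -
    have *: "continuous_on (W \<times> {0..1}) (\<lambda>z. snd z ^ Suc j * ?dF (c + snd z *\<^sub>R (fst z - c)) v)" for v
      using in_W
      by (intro continuous_intros continuous_on_compose2[OF smooth_on_imp_continuous_on[OF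
              smooth_on_frechet_derivative[OF assms(4)]] ray]) auto
    have "continuous_on (W \<times> {0..1}) (\<lambda>z. blinfun_apply (?fx (fst z) (snd z)) v)" for v
      using *[of v] by (rule continuous_on_eq) (auto simp: app simp del: power_Suc)
    then show ?thesis
      unfolding split_beta by (intro continuous_on_blinfun_componentwise) simp
  qed
  have "((\<lambda>y. integral (cbox 0 1) (\<lambda>t. t ^ j * F (c + t *\<^sub>R (y - c)))) has_derivative
      integral (cbox 0 1) (?fx x)) (at x within W)"
  proof (rule leibniz_rule[OF _ _ cont assms(5,2)])
    fix y t assume y: "y \<in> W" and t: "t \<in> cbox 0 (1::real)"
    then have t': "t \<in> {0..1}" by simp
    have "((\<lambda>y. c + t *\<^sub>R (y - c)) has_derivative (\<lambda>v. t *\<^sub>R v)) (at y)"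
      by (auto intro!: derivative_eq_intros)
    from has_derivative_compose[OF this smooth_on_has_derivative[OF assms(4) in_W[OF y t']]]
    have "((\<lambda>y. t ^ j * F (c + t *\<^sub>R (y - c))) has_derivative
        (\<lambda>v. t ^ j * ?dF (c + t *\<^sub>R (y - c)) (t *\<^sub>R v))) (at y)"
      by (rule has_derivative_mult_right)
    moreover have "linear (?dF (c + t *\<^sub>R (y - c)))"
      using has_derivative_linear[OF smooth_on_has_derivative[OF assms(4) in_W[OF y t']]] .
    ultimately show "((\<lambda>y. t ^ j * F (c + t *\<^sub>R (y - c))) has_derivative
        blinfun_apply (?fx y t)) (at y within W)"
      unfolding app[OF y t']
      by (auto simp: linear_cmul mult_ac intro: has_derivative_at_withinI)
  next
    fix y assume y: "y \<in> W"
    have "continuous_on {0..1} (\<lambda>t. c + t *\<^sub>R (y - c))"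
      by (intro continuous_intros)
    then have "continuous_on {0..1} (\<lambda>t. t ^ j * F (c + t *\<^sub>R (y - c)))"
      using in_W[OF y]
      by (intro continuous_intros continuous_on_compose2[OF smooth_on_imp_continuous_on[OF assms(4)]])
        auto
    then show "(\<lambda>t. t ^ j * F (c + t *\<^sub>R (y - c))) integrable_on cbox 0 1"
      by (simp add: integrable_continuous_real)
  qed
  moreover have "?fx x integrable_on cbox 0 1"
  proof (rule integrable_continuous)
    have "continuous_on (cbox 0 1) (\<lambda>t. (\<lambda>(y, t). ?fx y t) (x, t))"
      using assms(5) by (intro continuous_on_compose2[OF cont]) (auto intro!: continuous_intros)
    then show "continuous_on (cbox 0 1) (?fx x)" by simp
  qed
  then have "blinfun_apply (integral (cbox 0 1) (?fx x)) =
      (\<lambda>v. integral (cbox 0 1) (\<lambda>t. blinfun_apply (?fx x t) v))"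
    by (intro ext blinfun_apply_integral)
  moreover have "(\<lambda>v. integral (cbox 0 1) (\<lambda>t. blinfun_apply (?fx x t) v)) =
      (\<lambda>v. integral {0..1} (\<lambda>t. t ^ Suc j * ?dF (c + t *\<^sub>R (x - c)) v))"
    unfolding cbox_interval by (intro ext integral_cong) (simp only: app[OF assms(5)])
  ultimately show ?thesis
    using assms(1,5) unfolding cbox_interval by (simp only: at_within_open)
qed

lemma smooth_on_ray_integral:
  fixes F :: "'e::euclidean_space \<Rightarrow> real"
  assumes "open W" "convex W" "c \<in> W" "smooth_on W F"
  shows "smooth_on W (\<lambda>y. integral {0..1} (\<lambda>t. t ^ j * F (c + t *\<^sub>R (y - c))))"
  unfolding smooth_on_def
proof
  fix m show "Ck_on m W (\<lambda>y. integral {0..1} (\<lambda>t. t ^ j * F (c + t *\<^sub>R (y - c))))"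
    using assms(4)
  proof (induction m arbitrary: F j)
    case 0
    then show ?case
      using has_derivative_ray_integral[OF assms(1-3) 0]
      by (auto intro!: continuous_at_imp_continuous_on has_derivative_continuous)
  next
    case (Suc m)
    show ?case
      using has_derivative_ray_integral[OF assms(1-3) Suc.prems]
      by (rule Ck_on_SucI[OF assms(1)]) (auto simp del: power_Suc intro: Suc.IH[OF smooth_on_frechet_derivative[OF Suc.prems]])
  qed
qed

text \<open>Integrate the derivative of \<open>F\<close> along the segment from c to y and expand
  the direction y - c over \<open>Basis\<close>: \<open>G i\<close> is the mean of the i-th partial
  derivative over the segment. It is smooth as a ray integral of weight 1.\<close>

lemma Hadamard:
  fixes F :: "'e::euclidean_space \<Rightarrow> real"
  assumes "open W" "convex W" "c \<in> W" "smooth_on W F"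
  obtains G where "\<And>i. smooth_on W (G i)"
    and "\<And>i. G i c = frechet_derivative F (at c) i"
    and "\<And>y. y \<in> W \<Longrightarrow> F y = F c + (\<Sum>i\<in>Basis. (y \<bullet> i - c \<bullet> i) * G i y)"
proof
  let ?dF = "\<lambda>y. frechet_derivative F (at y)"
  let ?G = "\<lambda>i y. integral {0..1} (\<lambda>t. ?dF (c + t *\<^sub>R (y - c)) i)"
  show smooth: "smooth_on W (?G i)" for i
    using smooth_on_ray_integral[OF assms(1-3) smooth_on_frechet_derivative[OF assms(4)], of 0 i] by simp
  show "?G i c = ?dF c i" for i by simp
  fix y assume y: "y \<in> W"
  have in_W: "c + t *\<^sub>R (y - c) \<in> W" if "t \<in> {0..1}" for t
  proof -
    have "(1 - t) *\<^sub>R c + t *\<^sub>R y \<in> W"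
      using that y assms(2,3) by (intro convexD) auto
    then show ?thesis by (simp add: algebra_simps)
  qed
  have "((\<lambda>t. ?dF (c + t *\<^sub>R (y - c)) (y - c)) has_integral
      F (c + 1 *\<^sub>R (y - c)) - F (c + 0 *\<^sub>R (y - c))) {0..1}"
  proof (rule fundamental_theorem_of_calculus)
    fix t assume t: "t \<in> {0..1::real}"
    have "((\<lambda>t. c + t *\<^sub>R (y - c)) has_derivative (\<lambda>u. u *\<^sub>R (y - c))) (at t)"
      by (auto intro!: derivative_eq_intros)
    from has_derivative_compose[OF this smooth_on_has_derivative[OF assms(4) in_W[OF t]]]
    have "((\<lambda>t. F (c + t *\<^sub>R (y - c))) has_derivative (\<lambda>u. ?dF (c + t *\<^sub>R (y - c)) (u *\<^sub>R (y - c)))) (at t)" .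
    moreover have "linear (?dF (c + t *\<^sub>R (y - c)))"
      using has_derivative_linear[OF smooth_on_has_derivative[OF assms(4) in_W[OF t]]] .
    ultimately show "((\<lambda>t. F (c + t *\<^sub>R (y - c))) has_vector_derivative
        ?dF (c + t *\<^sub>R (y - c)) (y - c)) (at t within {0..1})"
      by (auto simp: has_vector_derivative_def linear_cmul intro: has_derivative_at_withinI)
  qed simp
  then have "F y = F c + integral {0..1} (\<lambda>t. ?dF (c + t *\<^sub>R (y - c)) (y - c))"
    by (auto dest!: integral_unique)
  also have "integral {0..1} (\<lambda>t. ?dF (c + t *\<^sub>R (y - c)) (y - c)) =
      integral {0..1} (\<lambda>t. \<Sum>i\<in>Basis. ((y - c) \<bullet> i) * ?dF (c + t *\<^sub>R (y - c)) i)"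
  proof (rule integral_cong)
    fix t assume t: "t \<in> {0..1::real}"
    interpret linear "?dF (c + t *\<^sub>R (y - c))"
      using has_derivative_linear[OF smooth_on_has_derivative[OF assms(4) in_W[OF t]]] .
    show "?dF (c + t *\<^sub>R (y - c)) (y - c) = (\<Sum>i\<in>Basis. ((y - c) \<bullet> i) * ?dF (c + t *\<^sub>R (y - c)) i)"
    proof -
      have "?dF (c + t *\<^sub>R (y - c)) (y - c) =
          ?dF (c + t *\<^sub>R (y - c)) (\<Sum>i\<in>Basis. ((y - c) \<bullet> i) *\<^sub>R i)"
        by (simp only: euclidean_representation)
      then show ?thesis by (simp only: sum scale real_scaleR_def)
    qed
  qed
  also have "\<dots> = (\<Sum>i\<in>Basis. integral {0..1} (\<lambda>t. ((y - c) \<bullet> i) * ?dF (c + t *\<^sub>R (y - c)) i))"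
  proof (rule integral_sum)
    fix i :: 'e
    have "continuous_on {0..1} (\<lambda>t. c + t *\<^sub>R (y - c))"
      by (intro continuous_intros)
    then have "continuous_on {0..1} (\<lambda>t. ((y - c) \<bullet> i) * ?dF (c + t *\<^sub>R (y - c)) i)"
      using in_W
      by (intro continuous_intros continuous_on_compose2[OF smooth_on_imp_continuous_on[OF
              smooth_on_frechet_derivative[OF assms(4)]]]) auto
    then show "(\<lambda>t. ((y - c) \<bullet> i) * ?dF (c + t *\<^sub>R (y - c)) i) integrable_on {0..1}"
      by (rule integrable_continuous_real)
  qed simp
  finally show "F y = F c + (\<Sum>i\<in>Basis. (y \<bullet> i - c \<bullet> i) * ?G i y)"
    by (simp add: inner_diff_left)
qed

section \<open>Derivations in local coordinates\<close>

lemma vscale_apply: "(a \<odot> X) h p = a p * X h p"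
  by (simp add: vscale_def)

lemma vscale_zero_left: "0 \<odot> X = 0"
  by (simp add: vscale_def fun_eq_iff)

lemma vscale_minus_one: "(\<lambda>p. - 1) \<odot> X = - X"
  by (simp add: vscale_def fun_eq_iff)

lemma sum_fun_apply: "(\<Sum>i\<in>I. F i) x = (\<Sum>i\<in>I. F i x)"
  by (induction I rule: infinite_finite_induct) auto

context smooth_manifold
begin

abbreviation "SF \<equiv> smooth_functions A"
abbreviation "VF \<equiv> vector_fields A"

section \<open>The algebra of smooth functions and its derivations\<close>

lemma SF_iff:
  "h \<in> SF \<longleftrightarrow> (\<forall>U \<phi>. (U, \<phi>) \<in> A \<longrightarrow> smooth_on (\<phi> ` U) (\<lambda>y. h (inv_into U \<phi> y)))"
  by (auto simp: smooth_functions_def o_def)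

lemma SF_const: "(\<lambda>p. r) \<in> SF"
  using chart_open by (auto simp: SF_iff intro: smooth_on_const)

lemma SF_add: "a \<in> SF \<Longrightarrow> b \<in> SF \<Longrightarrow> a + b \<in> SF"
  using chart_open by (auto simp: SF_iff intro!: smooth_on_add)

lemma SF_mult: "a \<in> SF \<Longrightarrow> b \<in> SF \<Longrightarrow> a * b \<in> SF"
  using chart_open by (auto simp: SF_iff intro!: smooth_on_mult)

lemma SF_minus: "a \<in> SF \<Longrightarrow> - a \<in> SF"
  using SF_mult[OF SF_const[of "-1"], of a] by (simp add: times_fun_def fun_Compl_def)

lemma SF_diff: "a \<in> SF \<Longrightarrow> b \<in> SF \<Longrightarrow> a - b \<in> SF"
  using SF_add[OF _ SF_minus, of a b] by simp

lemma SF_zero: "0 \<in> SF"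
  using SF_const[of 0] by (simp add: zero_fun_def)

lemma SF_sum: "(\<And>i. i \<in> I \<Longrightarrow> a i \<in> SF) \<Longrightarrow> (\<Sum>i\<in>I. a i) \<in> SF"
  by (induction I rule: infinite_finite_induct) (auto intro: SF_add SF_zero)

lemmas SF_intros = SF_const SF_add SF_mult SF_minus SF_diff SF_zero SF_sum

lemma VFI:
  assumes "\<And>a. a \<in> SF \<Longrightarrow> X a \<in> SF"
    and "\<And>a b. a \<in> SF \<Longrightarrow> b \<in> SF \<Longrightarrow> X (a + b) = X a + X b"
    and "\<And>r a. a \<in> SF \<Longrightarrow> X (\<lambda>p. r * a p) = (\<lambda>p. r * X a p)"
    and "\<And>a b. a \<in> SF \<Longrightarrow> b \<in> SF \<Longrightarrow> X (a * b) = a * X b + X a * b"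
    and "\<And>a. a \<notin> SF \<Longrightarrow> X a = 0"
  shows "X \<in> VF"
  using assms unfolding vector_fields_def by blast

lemma
  assumes "X \<in> VF"
  shows VF_SF: "a \<in> SF \<Longrightarrow> X a \<in> SF"
    and VF_add_fun: "a \<in> SF \<Longrightarrow> b \<in> SF \<Longrightarrow> X (a + b) = X a + X b"
    and VF_scale_fun: "a \<in> SF \<Longrightarrow> X (\<lambda>p. r * a p) = (\<lambda>p. r * X a p)"
    and VF_mult_fun: "a \<in> SF \<Longrightarrow> b \<in> SF \<Longrightarrow> X (a * b) = a * X b + X a * b"
    and VF_nonsmooth: "a \<notin> SF \<Longrightarrow> X a = 0"
  using assms unfolding vector_fields_def by blast+

lemma VF_const: assumes "X \<in> VF" shows "X (\<lambda>p. r) = 0"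
proof -
  have "X ((\<lambda>p. 1) * (\<lambda>p. 1)) = (\<lambda>p. 1) * X (\<lambda>p. 1) + X (\<lambda>p. 1) * (\<lambda>p. 1)"
    using assms by (intro VF_mult_fun SF_const)
  then have "X (\<lambda>p. 1) = 0" by (auto simp: times_fun_def fun_eq_iff)
  then show ?thesis using VF_scale_fun[OF assms SF_const, of r 1] by (simp add: fun_eq_iff)
qed

lemma VF_zero_fun: "X \<in> VF \<Longrightarrow> X 0 = 0"
  using VF_const[of X 0] by (simp add: zero_fun_def)

lemma VF_minus_fun: "X \<in> VF \<Longrightarrow> a \<in> SF \<Longrightarrow> X (- a) = - X a"
  using VF_scale_fun[of X a "-1"] by (simp add: fun_Compl_def)

lemma VF_diff_fun: "X \<in> VF \<Longrightarrow> a \<in> SF \<Longrightarrow> b \<in> SF \<Longrightarrow> X (a - b) = X a - X b"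
  using VF_add_fun[of X a "-b"] VF_minus_fun[of X b] SF_minus[of b] by simp

lemma VF_sum_fun:
  assumes X: "X \<in> VF" and "\<And>i. i \<in> I \<Longrightarrow> a i \<in> SF"
  shows "X (\<Sum>i\<in>I. a i) = (\<Sum>i\<in>I. X (a i))"
  using assms(2)
  by (induction I rule: infinite_finite_induct)
    (simp_all add: VF_zero_fun[OF X] VF_add_fun[OF X] SF_sum)

lemma VF_zero: "0 \<in> VF"
  by (rule VFI) (auto simp: SF_zero zero_fun_def SF_const fun_eq_iff)

lemma VF_add: "X \<in> VF \<Longrightarrow> Y \<in> VF \<Longrightarrow> X + Y \<in> VF"
  by (rule VFI)
    (auto simp: VF_SF SF_add VF_add_fun VF_mult_fun VF_nonsmooth VF_scale_fun fun_eq_iff algebra_simps)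

lemma VF_vscale: "a \<in> SF \<Longrightarrow> X \<in> VF \<Longrightarrow> a \<odot> X \<in> VF"
  by (rule VFI)
    (auto simp: vscale_def VF_SF SF_mult VF_add_fun VF_mult_fun VF_nonsmooth VF_scale_fun fun_eq_iff
      algebra_simps)

lemma VF_minus: "X \<in> VF \<Longrightarrow> - X \<in> VF"
  using VF_vscale[OF SF_const, of X "-1"] by (simp add: vscale_minus_one)

lemma VF_diff: "X \<in> VF \<Longrightarrow> Y \<in> VF \<Longrightarrow> X - Y \<in> VF"
  using VF_add[OF _ VF_minus, of X Y] by simp

lemma VF_sum: "(\<And>i. i \<in> I \<Longrightarrow> X i \<in> VF) \<Longrightarrow> (\<Sum>i\<in>I. X i) \<in> VF"
  by (induction I rule: infinite_finite_induct) (auto intro: VF_add VF_zero)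

lemma VF_lie_bracket:
  assumes "X \<in> VF" "Y \<in> VF" shows "lie_bracket X Y \<in> VF"
proof -
  note X = VF_SF[OF assms(1)] VF_add_fun[OF assms(1)] VF_mult_fun[OF assms(1)] VF_scale_fun[OF assms(1)]
    VF_nonsmooth[OF assms(1)] VF_zero_fun[OF assms(1)]
  note Y = VF_SF[OF assms(2)] VF_add_fun[OF assms(2)] VF_mult_fun[OF assms(2)] VF_scale_fun[OF assms(2)]
    VF_nonsmooth[OF assms(2)] VF_zero_fun[OF assms(2)]
  show ?thesis
    by (rule VFI) (simp_all add: lie_bracket_def X Y SF_mult SF_diff fun_eq_iff algebra_simps)
qed

lemmas VF_intros = VF_zero VF_add VF_vscale VF_minus VF_diff VF_sum VF_lie_bracket

lemma
  assumes "one_form A T"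
  shows one_form_SF: "X \<in> VF \<Longrightarrow> T X \<in> SF"
    and one_form_add: "X \<in> VF \<Longrightarrow> Y \<in> VF \<Longrightarrow> T (X + Y) = T X + T Y"
    and one_form_vscale: "a \<in> SF \<Longrightarrow> X \<in> VF \<Longrightarrow> T (a \<odot> X) = a * T X"
  using assms by (auto simp: one_form_def)

lemma one_form_zero: "one_form A T \<Longrightarrow> T 0 = 0"
  using one_form_vscale[of T 0 0] by (simp add: SF_zero VF_zero vscale_zero_left)

lemma one_form_minus: "one_form A T \<Longrightarrow> X \<in> VF \<Longrightarrow> T (- X) = - T X"
  using one_form_vscale[OF _ SF_const, of T X "-1"]
  by (simp add: vscale_minus_one times_fun_def fun_Compl_def)

lemma one_form_diff: "one_form A T \<Longrightarrow> X \<in> VF \<Longrightarrow> Y \<in> VF \<Longrightarrow> T (X - Y) = T X - T Y"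
  using one_form_add[of T X "- Y"] one_form_minus[of T Y] VF_minus[of Y] by simp

lemma one_form_sum:
  assumes "one_form A T" "\<And>i. i \<in> I \<Longrightarrow> X i \<in> VF"
  shows "T (\<Sum>i\<in>I. X i) = (\<Sum>i\<in>I. T (X i))"
  using assms(2)
  by (induction I rule: infinite_finite_induct)
    (simp_all add: one_form_zero[OF assms(1)] one_form_add[OF assms(1)] VF_sum)

section \<open>Coordinates of tangent vectors\<close>

text \<open>A derivation accepts only functions on the whole manifold, so functions of the
  coordinates must be carried there before a field can be applied to them.\<close>

definition extend_by_zero :: "'a set \<Rightarrow> ('a \<Rightarrow> 'e) \<Rightarrow> 'e set \<Rightarrow> ('e \<Rightarrow> real) \<Rightarrow> 'a \<Rightarrow> real" where
  "extend_by_zero U \<phi> W u q = (if q \<in> U \<and> \<phi> q \<in> W then u (\<phi> q) else 0)"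

text \<open>Seen in another chart, the function is smooth on two open sets that cover the chart:
  where it is the pullback of \<open>u\<close>, and off the preimage of \<open>K\<close>, where it
  is zero. The second set is open because compact sets are closed in a Hausdorff space.\<close>

lemma extend_by_zero_SF:
  assumes chart: "(U, \<phi>) \<in> A" and W: "open W" "W \<subseteq> \<phi> ` U"
    and K: "compact K" "K \<subseteq> W"
    and u: "smooth_on W u" "\<And>y. y \<in> W - K \<Longrightarrow> u y = 0"
  shows "extend_by_zero U \<phi> W u \<in> SF"
  unfolding SF_iff
proof (intro allI impI)
  fix V \<psi> assume chart': "(V, \<psi>) \<in> A"
  let ?O = "{q \<in> U. \<phi> q \<in> W}" and ?C = "inv_into U \<phi> ` K"
  let ?E = "\<lambda>y. extend_by_zero U \<phi> W u (inv_into V \<psi> y)"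
  have hom: "homeomorphism U (\<phi> ` U) \<phi> (inv_into U \<phi>)" "homeomorphism V (\<psi> ` V) \<psi> (inv_into V \<psi>)"
    using chart_homeomorphism chart chart' by auto
  have open_image: "open (\<psi> ` (V \<inter> Q))" if "open Q" for Q
  proof -
    have "openin (top_of_set V) (V \<inter> Q)"
      using that by (simp add: openin_open_Int)
    from homeomorphism_imp_open_map[OF hom(2) this] show ?thesis
      using chart_open[OF chart'] by (auto simp: openin_open_eq)
  qed
  have "open ?O"
  proof -
    have "open (\<phi> -` W \<inter> U)"
      using hom(1) chart_open[OF chart] W(1)
      by (metis continuous_on_open_vimage homeomorphism_cont1)
    moreover have "\<phi> -` W \<inter> U = ?O" by auto
    ultimately show ?thesis by simp
  qed
  moreover have "closed ?C"
  proof -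
    have "continuous_on K (inv_into U \<phi>)"
      using hom(1) K W by (meson continuous_on_subset homeomorphism_cont2 subset_trans)
    then show ?thesis using K(1) by (intro compact_imp_closed compact_continuous_image)
  qed
  ultimately have opens: "open (\<psi> ` (V \<inter> ?O))" "open (\<psi> ` (V \<inter> - ?C))"
    using open_image by auto
  have inv: "inv_into V \<psi> (\<psi> q) = q" if "q \<in> V" for q
    using hom(2) that by (simp add: homeomorphism_apply1)
  have "smooth_on (\<psi> ` (V \<inter> ?O)) (\<lambda>y. u ((\<phi> \<circ> inv_into V \<psi>) y))"
    using inv
    by (intro smooth_on_compose[OF opens(1) _ u(1)]
        smooth_on_subset[OF charts_compatible[OF chart' chart]]) auto
  then have "smooth_on (\<psi> ` (V \<inter> ?O)) ?E"
    by (subst smooth_on_cong[OF opens(1)]) (auto simp: inv extend_by_zero_def)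
  moreover have "smooth_on (\<psi> ` (V \<inter> - ?C)) ?E"
  proof (subst smooth_on_cong[OF opens(2)])
    fix y assume "y \<in> \<psi> ` (V \<inter> - ?C)"
    then obtain q where q: "q \<in> V" "q \<notin> ?C" "y = \<psi> q" by auto
    have "\<phi> q \<notin> K" if "q \<in> U"
      using q(2) that homeomorphism_apply1[OF hom(1) that] by (metis imageI)
    then show "?E y = 0" using q(1,3) u(2) by (auto simp: inv extend_by_zero_def)
  qed (rule smooth_on_const[OF opens(2)])
  moreover have V_eq: "\<psi> ` V = \<psi> ` (V \<inter> ?O) \<union> \<psi> ` (V \<inter> - ?C)"
  proof -
    have "?C \<subseteq> ?O"
      using K W(2) homeomorphism_apply2[OF hom(1)] by (auto intro: inv_into_into dest!: subsetD)
    then show ?thesis by blast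
  qed
  ultimately show "smooth_on (\<psi> ` V) ?E"
    unfolding V_eq by (intro smooth_on_Un opens)
qed

text \<open>
  With a bump function \<open>\<beta>\<close> around \<open>p\<close> and coordinates \<open>x\<^sub>i\<close>, Hadamard's lemma gives
  \<open>\<beta>\<^sup>3 X = \<Sum>\<^sub>i (\<beta> X(\<beta> x\<^sub>i) - \<beta> x\<^sub>i X(\<beta>)) \<beta> \<partial>\<^sub>i\<close> globally, for every derivation \<open>X\<close>.
\<close>

definition tangent_coordinates :: "'a \<Rightarrow> ('a vfield \<Rightarrow> 'e) \<Rightarrow> bool" where
  "tangent_coordinates p \<kappa> \<longleftrightarrow>
     (\<forall>X\<in>VF. \<forall>Y\<in>VF. \<kappa> (X + Y) = \<kappa> X + \<kappa> Y) \<and>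
     (\<forall>r. \<forall>X\<in>VF. \<kappa> ((\<lambda>q. r) \<odot> X) = r *\<^sub>R \<kappa> X) \<and>
     (\<forall>v. \<exists>X\<in>VF. \<kappa> X = v) \<and>
     (\<forall>X\<in>VF. \<kappa> X = 0 \<longrightarrow> (\<forall>T. one_form A T \<longrightarrow> T X p = 0)) \<and>
     (\<forall>X\<in>VF. (\<forall>h. X h p = 0) \<longrightarrow> \<kappa> X = 0)"

lemma
  assumes "tangent_coordinates p \<kappa>"
  shows tangent_coordinates_add: "X \<in> VF \<Longrightarrow> Y \<in> VF \<Longrightarrow> \<kappa> (X + Y) = \<kappa> X + \<kappa> Y"
    and tangent_coordinates_scale: "X \<in> VF \<Longrightarrow> \<kappa> ((\<lambda>q. r) \<odot> X) = r *\<^sub>R \<kappa> X"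
    and tangent_coordinates_surj: "\<exists>X\<in>VF. \<kappa> X = v"
    and tangent_coordinates_null: "X \<in> VF \<Longrightarrow> \<kappa> X = 0 \<Longrightarrow> one_form A T \<Longrightarrow> T X p = 0"
    and tangent_coordinates_zero: "X \<in> VF \<Longrightarrow> (\<And>h. X h p = 0) \<Longrightarrow> \<kappa> X = 0"
  using assms by (simp_all add: tangent_coordinates_def)

text \<open>With b the bump function on the manifold, y_i the coordinates and x_i = b y_i, the
  quotient rule gives b X(x_i) - x_i X(b) = b^2 X(y_i), an expression in global functions only. The
  fields \<open>V i\<close> are the coordinate fields times b, whence the third power of b. The
  coordinate vector of \<open>X\<close> collects these expressions at \<open>p\<close>, so it is the
  usual one times a positive constant.\<close>

lemma tangent_coordinates_exist: "\<exists>\<kappa>. tangent_coordinates p \<kappa>"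
proof -
  obtain U \<phi> where chart: "(U, \<phi>) \<in> A" and p: "p \<in> U"
  proof -
    have "p \<in> (\<Union>(U, \<phi>)\<in>A. U)" using charts_cover by simp
    then show ?thesis using that by auto
  qed
  define c where "c = \<phi> p"
  have "c \<in> \<phi> ` U" "open (\<phi> ` U)" using p chart_open[OF chart] by (auto simp: c_def)
  then obtain R where R: "R > 0" "ball c R \<subseteq> \<phi> ` U"
    by (meson open_contains_ball)
  define W where "W = ball c R"
  \<comment> \<open>The bump function vanishes off the open ball of radius R/2, hence off this
    compact set inside \<open>W\<close>.\<close>
  define K where "K = cball c (R / 2)"
  have W: "open W" "convex W" "W \<subseteq> \<phi> ` U" "c \<in> W" and K: "compact K" "K \<subseteq> W"
    using R by (auto simp: W_def K_def)
  obtain \<beta> :: "'e \<Rightarrow> real" where \<beta>: "smooth_on UNIV \<beta>" "\<beta> c > 0"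
    and \<beta>0: "\<And>x. x \<notin> ball c (R / 2) \<Longrightarrow> \<beta> x = 0"
    using bump_function_exists[of "R / 2" c] R(1) by auto
  have \<beta>W: "smooth_on W \<beta>" using smooth_on_subset[OF \<beta>(1)] by simp
  define L where "L w = extend_by_zero U \<phi> W (\<lambda>y. \<beta> y * w y)" for w
  have L_SF: "L w \<in> SF" if "smooth_on W w" for w
    unfolding L_def
    by (rule extend_by_zero_SF[OF chart W(1,3) K])
      (use that \<beta>W W(1) in \<open>auto intro!: smooth_on_mult \<beta>0 simp: K_def\<close>)
  define H where "H h y = h (inv_into U \<phi> y)" for h :: "'a \<Rightarrow> real" and y
  have H: "smooth_on W (H h)" if "h \<in> SF" for h
    using that chart W(3) unfolding SF_iff H_def by (blast intro: smooth_on_subset)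
  have H_\<phi>: "H h (\<phi> q) = h q" if "q \<in> U" for h q
    using homeomorphism_apply1[OF chart_homeomorphism[OF chart] that] by (simp add: H_def)
  define dH where "dH i h y = frechet_derivative (H h) (at y) i" for i h y
  have dH_smooth: "smooth_on W (dH i h)" if "h \<in> SF" for i h
    unfolding dH_def using smooth_on_frechet_derivative[OF H[OF that]] .
  have dH_eqI: "dH i h y = D i" if "(H h has_derivative D) (at y)" for i h y D
    using frechet_derivative_at[OF that] by (simp add: dH_def)
  have H_deriv: "(H h has_derivative (\<lambda>i. dH i h y)) (at y)" if "h \<in> SF" "y \<in> W" for h y
    using smooth_on_has_derivative[OF H[OF that(1)] that(2)] by (simp add: dH_def)
  define b where "b = L (\<lambda>y. 1)"
  define x where "x i = L (\<lambda>y. y \<bullet> i)" for i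
  define V where "V i h = (if h \<in> SF then L (dH i h) else 0)" for i h
  have b: "b \<in> SF" unfolding b_def by (intro L_SF smooth_on_const W(1))
  have x: "x i \<in> SF" for i
    unfolding x_def by (intro L_SF smooth_on_bounded_linear W(1) bounded_linear_inner_left)
  have pW: "p \<in> U \<and> \<phi> p \<in> W" using p W(4) by (simp add: c_def)
  have bp: "b p > 0" using pW \<beta>(2) by (simp add: b_def L_def extend_by_zero_def c_def)
  have V: "V i \<in> VF" for i
  proof (rule VFI)
    fix a b assume ab: "a \<in> SF" "b \<in> SF"
    have "dH i (a + b) y = dH i a y + dH i b y" if "y \<in> W" for y
      using has_derivative_add[OF H_deriv[OF ab(1) that] H_deriv[OF ab(2) that]]
      by (intro dH_eqI) (simp add: H_def[abs_def])
    then show "V i (a + b) = V i a + V i b"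
      using ab by (auto simp: V_def SF_add L_def extend_by_zero_def fun_eq_iff algebra_simps)
    have "dH i (a * b) y = H a y * dH i b y + dH i a y * H b y" if "y \<in> W" for y
      using has_derivative_mult[OF H_deriv[OF ab(1) that] H_deriv[OF ab(2) that]]
      by (intro dH_eqI) (simp add: H_def[abs_def])
    then show "V i (a * b) = a * V i b + V i a * b"
      using ab by (auto simp: V_def SF_mult L_def extend_by_zero_def fun_eq_iff algebra_simps H_\<phi>)
  next
    fix r a assume a: "a \<in> SF"
    have "dH i (\<lambda>p. r * a p) y = r * dH i a y" if "y \<in> W" for y
      using has_derivative_mult_right[OF H_deriv[OF a that], of r]
      by (intro dH_eqI) (simp add: H_def[abs_def])
    moreover have "(\<lambda>p. r * a p) \<in> SF"
      using SF_mult[OF SF_const a] by (simp add: times_fun_def)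
    ultimately show "V i (\<lambda>p. r * a p) = (\<lambda>p. r * V i a p)"
      using a by (auto simp: V_def L_def extend_by_zero_def fun_eq_iff algebra_simps)
  qed (auto simp: V_def intro: L_SF dH_smooth)
  define a where "a X i = b * X (x i) - x i * X b" for X :: "'a vfield" and i
  have a_SF: "a X i \<in> SF" if "X \<in> VF" for X i
    unfolding a_def by (intro SF_diff SF_mult VF_SF[OF that] b x)
  have expansion: "(b * b * b) \<odot> X = (\<Sum>i\<in>Basis. a X i \<odot> V i)" if X: "X \<in> VF" for X
  proof -
    have "b q * b q * b q * X h q = (\<Sum>i\<in>Basis. a X i q * V i h q)" if h: "h \<in> SF" for h q
    proof (cases "q \<in> U \<and> \<phi> q \<in> W")
      case False
      then have "b q = 0" "\<And>i. V i h q = 0"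
        by (auto simp: b_def V_def L_def extend_by_zero_def)
      then show ?thesis by simp
    next
      case True
      obtain G where G: "\<And>i. smooth_on W (G i)" "\<And>i. G i (\<phi> q) = dH i h (\<phi> q)"
        and G_eq: "\<And>y. y \<in> W \<Longrightarrow> H h y = H h (\<phi> q) + (\<Sum>i\<in>Basis. (y \<bullet> i - \<phi> q \<bullet> i) * G i y)"
        using True unfolding dH_def by (blast intro: Hadamard[OF W(1,2) _ H[OF h], of "\<phi> q"])
      \<comment> \<open>This is b (y_i - y_i(q)), so it vanishes at q, as does h - h(q). When
        \<open>X\<close> is applied to the identity below and evaluated at q, the Leibniz rule
        therefore leaves one term per product.\<close>
      let ?z = "\<lambda>i. x i - (\<lambda>_. \<phi> q \<bullet> i) * b"
      have eq: "b * b * (h - (\<lambda>_. h q)) = (\<Sum>i\<in>Basis. ?z i * L (G i))"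
      proof
        fix q'
        show "(b * b * (h - (\<lambda>_. h q))) q' = (\<Sum>i\<in>Basis. ?z i * L (G i)) q'"
        proof (cases "q' \<in> U \<and> \<phi> q' \<in> W")
          case True': True
          then have "h q' = h q + (\<Sum>i\<in>Basis. (\<phi> q' \<bullet> i - \<phi> q \<bullet> i) * G i (\<phi> q'))"
            using G_eq[of "\<phi> q'"] True by (simp add: H_\<phi>)
          then show ?thesis
            using True' by (simp add: sum_fun_apply b_def x_def L_def extend_by_zero_def
                sum_distrib_left algebra_simps)
        qed (auto simp: sum_fun_apply b_def x_def L_def extend_by_zero_def)
      qed
      have z: "?z i \<in> SF" for i using x b by (intro SF_intros)
      have "X (b * b * (h - (\<lambda>_. h q))) q = b q * b q * X h q"
        using b h by (simp add: VF_mult_fun[OF X] VF_diff_fun[OF X] VF_const[OF X] SF_intros)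
      moreover have "X (\<Sum>i\<in>Basis. ?z i * L (G i)) q =
          (\<Sum>i\<in>Basis. (X (x i) q - \<phi> q \<bullet> i * X b q) * L (G i) q)"
      proof -
        have "X (?z i * L (G i)) q = (X (x i) q - \<phi> q \<bullet> i * X b q) * L (G i) q" for i
        proof -
          have "?z i q = 0" using True by (simp add: b_def x_def L_def extend_by_zero_def)
          moreover have "X (?z i) = X (x i) - (\<lambda>_. \<phi> q \<bullet> i) * X b"
            using x b by (simp add: VF_mult_fun[OF X] VF_diff_fun[OF X] VF_const[OF X] SF_intros)
          moreover have "X (?z i * L (G i)) = ?z i * X (L (G i)) + X (?z i) * L (G i)"
            using X z L_SF[OF G(1)] by (rule VF_mult_fun)
          ultimately show ?thesis by simp
        qed
        moreover have "X (\<Sum>i\<in>Basis. ?z i * L (G i)) = (\<Sum>i\<in>Basis. X (?z i * L (G i)))"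
          using X z L_SF[OF G(1)] by (intro VF_sum_fun SF_mult)
        ultimately show ?thesis by (simp add: sum_fun_apply)
      qed
      ultimately have "b q * b q * X h q =
          (\<Sum>i\<in>Basis. (X (x i) q - \<phi> q \<bullet> i * X b q) * L (G i) q)"
        using eq by metis
      \<comment> \<open>One more factor b turns y_i(q) b(q) into x_i(q), so the coefficient becomes
        \<open>a X i q\<close>.\<close>
      then have "b q * (b q * b q * X h q) =
          (\<Sum>i\<in>Basis. b q * (X (x i) q - \<phi> q \<bullet> i * X b q) * L (G i) q)"
        by (simp add: sum_distrib_left mult.assoc)
      also have "\<dots> = (\<Sum>i\<in>Basis. a X i q * V i h q)"
        using True h G(2)
        by (intro sum.cong)
          (auto simp: a_def V_def b_def x_def L_def extend_by_zero_def algebra_simps)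
      finally show ?thesis by (simp add: mult.assoc)
    qed
    \<comment> \<open>On non-smooth functions both sides are zero by convention, so the expansion is
      an equality of fields in HOL.\<close>
    moreover have "X h = 0" "\<And>i. V i h = 0" if "h \<notin> SF" for h
      using that X V by (auto intro: VF_nonsmooth)
    ultimately show ?thesis
      by (intro ext; rename_tac h q; case_tac "h \<in> SF") (auto simp: sum_fun_apply vscale_apply)
  qed
  define \<kappa> where "\<kappa> X = (\<Sum>i\<in>Basis. a X i p *\<^sub>R i)" for X
  have \<kappa>_nth: "\<kappa> X \<bullet> i = a X i p" if "i \<in> Basis" for X i
    using that by (simp add: \<kappa>_def)
  have add: "\<kappa> (X + Y) = \<kappa> X + \<kappa> Y" for X Y
    by (rule euclidean_eqI) (simp add: \<kappa>_nth inner_add_left a_def algebra_simps)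
  have scale: "\<kappa> ((\<lambda>q. r) \<odot> X) = r *\<^sub>R \<kappa> X" for r X
    by (rule euclidean_eqI) (simp add: \<kappa>_nth a_def vscale_apply algebra_simps)
  have \<kappa>_sum: "\<kappa> (\<Sum>i\<in>I. X i) = (\<Sum>i\<in>I. \<kappa> (X i))" for X :: "'e \<Rightarrow> 'a vfield" and I
  proof -
    have "\<kappa> 0 = 0" by (rule euclidean_eqI) (simp add: \<kappa>_nth a_def)
    then show ?thesis
      by (induction I rule: infinite_finite_induct) (simp_all add: add)
  qed
  \<comment> \<open>The terms with the derivative of the bump function cancel. What remains is a
    positive multiple of the basis vector, which gives surjectivity after division.\<close>
  have \<kappa>_V: "\<kappa> (V j) = (b p ^ 3) *\<^sub>R j" if j: "j \<in> Basis" for j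
  proof (rule euclidean_eqI)
    fix i :: 'e assume i: "i \<in> Basis"
    let ?d = "frechet_derivative \<beta> (at c)"
    have \<beta>': "(\<beta> has_derivative ?d) (at c)"
      using smooth_on_has_derivative[OF \<beta>(1)] by simp
    have H_L: "H (L w) y = \<beta> y * w y" if "y \<in> W" for w y
      using that W(3) homeomorphism_apply2[OF chart_homeomorphism[OF chart]]
      by (auto simp: H_def L_def extend_by_zero_def intro: inv_into_into)
    have "((\<lambda>y. \<beta> y * 1) has_derivative ?d) (at c)" using \<beta>' by simp
    then have "(H b has_derivative ?d) (at c)"
      unfolding b_def
      by (rule has_derivative_transform_within_open[OF _ W(1,4)]) (simp add: H_L)
    then have 1: "V j b p = b p * ?d j"
      using pW b by (simp add: V_def L_def extend_by_zero_def dH_eqI b_def c_def[symmetric])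
    have "((\<lambda>y. \<beta> y * (y \<bullet> i)) has_derivative (\<lambda>v. \<beta> c * (v \<bullet> i) + ?d v * (c \<bullet> i))) (at c)"
      using \<beta>' by (auto intro!: derivative_eq_intros)
    then have "(H (x i) has_derivative (\<lambda>v. \<beta> c * (v \<bullet> i) + ?d v * (c \<bullet> i))) (at c)"
      unfolding x_def
      by (rule has_derivative_transform_within_open[OF _ W(1,4)]) (simp add: H_L)
    then have 2: "V j (x i) p = b p * (\<beta> c * (j \<bullet> i) + ?d j * (c \<bullet> i))"
      using pW x[of i] by (simp add: V_def L_def extend_by_zero_def dH_eqI b_def c_def[symmetric])
    have "\<beta> c = b p" "x i p = b p * (c \<bullet> i)"
      using pW by (simp_all add: b_def x_def L_def extend_by_zero_def c_def)
    then show "\<kappa> (V j) \<bullet> i = (b p ^ 3) *\<^sub>R j \<bullet> i"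
      using i by (simp add: \<kappa>_nth a_def 1 2 power3_eq_cube algebra_simps)
  qed
  have surj: "\<exists>X\<in>VF. \<kappa> X = v" for v
  proof
    let ?X = "\<Sum>j\<in>Basis. (\<lambda>_. (v \<bullet> j) / b p ^ 3) \<odot> V j"
    have "\<kappa> ?X = (\<Sum>j\<in>Basis. (v \<bullet> j) *\<^sub>R j)"
      using bp by (simp add: \<kappa>_sum scale \<kappa>_V)
    then show "\<kappa> ?X = v" by (simp add: euclidean_representation)
    show "?X \<in> VF" using V by (intro VF_intros SF_const)
  qed
  have null: "T X p = 0" if X: "X \<in> VF" and T: "one_form A T" and 0: "\<kappa> X = 0" for X T
  proof -
    have a0: "a X i p = 0" if "i \<in> Basis" for i using \<kappa>_nth[OF that, of X] 0 by simp
    have "b * b * b * T X = T ((b * b * b) \<odot> X)"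
      using X b by (simp add: one_form_vscale[OF T] SF_mult)
    also have "\<dots> = (\<Sum>i\<in>Basis. a X i * T (V i))"
      unfolding expansion[OF X] using V a_SF[OF X]
      by (simp add: one_form_sum[OF T] one_form_vscale[OF T] VF_vscale)
    finally have "(b * b * b * T X) p = (\<Sum>i\<in>Basis. a X i * T (V i)) p" by (rule fun_cong)
    then have "b p * b p * b p * T X p = (\<Sum>i\<in>Basis. a X i p * T (V i) p)"
      by (simp only: times_fun_apply sum_fun_apply)
    also have "\<dots> = 0" by (intro sum.neutral ballI) (simp add: a0)
    finally show ?thesis using bp by simp
  qed
  have zero: "\<kappa> X = 0" if "\<And>h. X h p = 0" for X
    using that by (simp add: \<kappa>_def a_def)
  have "tangent_coordinates p \<kappa>"
    unfolding tangent_coordinates_def using add scale surj null zero by simp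
  then show ?thesis by blast
qed

end

section \<open>Orthonormal families at a point\<close>

text \<open>Linearity over smooth functions is turned into dependence on the value at the point
  alone: a field vanishing at \<open>p\<close> has zero coordinates there, and the expansion in
  coordinate fields does the rest.\<close>

lemma (in smooth_manifold) one_form_pointwise:
  assumes "X \<in> VF" "\<And>h. X h p = 0" "one_form A T" shows "T X p = 0"
proof -
  obtain \<kappa> where \<kappa>: "tangent_coordinates p \<kappa>"
    using tangent_coordinates_exist by blast
  note null = tangent_coordinates_null[OF \<kappa>] and zero = tangent_coordinates_zero[OF \<kappa>]
  show ?thesis by (rule null[OF assms(1) zero[OF assms(1,2)] assms(3)])
qed

locale riemannian_manifold = smooth_manifold A
  for A :: "('a::{t2_space,second_countable_topology}, 'e::euclidean_space) atlas" +
  fixes g :: "'a vfield \<Rightarrow> 'a vfield \<Rightarrow> 'a \<Rightarrow> real"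
  assumes metric: "riemannian_metric A g"
begin

lemma g_one_form: "X \<in> VF \<Longrightarrow> one_form A (g X)"
  using metric by (simp add: riemannian_metric_def)

lemma g_sym: "X \<in> VF \<Longrightarrow> Y \<in> VF \<Longrightarrow> g X Y = g Y X"
  using metric by (simp add: riemannian_metric_def)

lemma g_SF: "X \<in> VF \<Longrightarrow> Y \<in> VF \<Longrightarrow> g X Y \<in> SF"
  by (intro one_form_SF[OF g_one_form])

lemma g_right:
  assumes "X \<in> VF"
  shows g_add_right: "Y \<in> VF \<Longrightarrow> Z \<in> VF \<Longrightarrow> g X (Y + Z) = g X Y + g X Z"
    and g_diff_right: "Y \<in> VF \<Longrightarrow> Z \<in> VF \<Longrightarrow> g X (Y - Z) = g X Y - g X Z"
    and g_minus_right: "Y \<in> VF \<Longrightarrow> g X (- Y) = - g X Y"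
    and g_zero_right: "g X 0 = 0"
    and g_vscale_right: "a \<in> SF \<Longrightarrow> Y \<in> VF \<Longrightarrow> g X (a \<odot> Y) = a * g X Y"
    and g_sum_right: "(\<And>i. i \<in> I \<Longrightarrow> V i \<in> VF) \<Longrightarrow> g X (\<Sum>i\<in>I. V i) = (\<Sum>i\<in>I. g X (V i))"
  using one_form_add[OF g_one_form[OF assms]] one_form_diff[OF g_one_form[OF assms]]
    one_form_minus[OF g_one_form[OF assms]] one_form_zero[OF g_one_form[OF assms]]
    one_form_vscale[OF g_one_form[OF assms]] one_form_sum[OF g_one_form[OF assms], of I V]
  by simp_all

lemma g_left:
  assumes "X \<in> VF"
  shows g_add_left: "Y \<in> VF \<Longrightarrow> Z \<in> VF \<Longrightarrow> g (Y + Z) X = g Y X + g Z X"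
    and g_diff_left: "Y \<in> VF \<Longrightarrow> Z \<in> VF \<Longrightarrow> g (Y - Z) X = g Y X - g Z X"
    and g_minus_left: "Y \<in> VF \<Longrightarrow> g (- Y) X = - g Y X"
    and g_zero_left: "g 0 X = 0"
    and g_vscale_left: "a \<in> SF \<Longrightarrow> Y \<in> VF \<Longrightarrow> g (a \<odot> Y) X = a * g Y X"
    and g_sum_left: "(\<And>i. i \<in> I \<Longrightarrow> V i \<in> VF) \<Longrightarrow> g (\<Sum>i\<in>I. V i) X = (\<Sum>i\<in>I. g (V i) X)"
  using assms by (simp_all add: g_right VF_intros g_sym[of _ X])

lemmas g_linear = g_left g_right

lemma g_pos: "X \<in> VF \<Longrightarrow> X h p \<noteq> 0 \<Longrightarrow> g X X p > 0"
  using metric unfolding riemannian_metric_def by blast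

lemma g_nonneg: assumes "X \<in> VF" shows "g X X p \<ge> 0"
proof (cases "\<exists>h. X h p \<noteq> 0")
  case False
  then show ?thesis using one_form_pointwise[OF assms _ g_one_form[OF assms]] by fastforce
qed (use assms g_pos[of X _ p] in \<open>auto intro: less_imp_le\<close>)

lemma g_null:
  assumes "X \<in> VF" "g X X p = 0" "one_form A T" shows "T X p = 0"
proof -
  have "X h p = 0" for h using g_pos[OF assms(1), of h p] assms(2) by auto
  then show ?thesis using one_form_pointwise assms(1,3) by blast
qed

lemma g_eqI:
  assumes "X \<in> VF" "Y \<in> VF" "\<And>Z p. Z \<in> VF \<Longrightarrow> g X Z p = g Y Z p"
  shows "X = Y"
proof -
  have "g (X - Y) (X - Y) p = 0" for p
    using assms by (simp add: g_linear VF_intros)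
  then have "(X - Y) h p = 0" for h p
    using g_pos[of "X - Y" h p] assms by (auto simp: VF_intros)
  then show ?thesis by (simp add: fun_eq_iff)
qed

lemma additive_sum:
  fixes \<kappa> :: "'a vfield \<Rightarrow> 'c::real_vector"
  assumes "\<And>X Y. X \<in> VF \<Longrightarrow> Y \<in> VF \<Longrightarrow> \<kappa> (X + Y) = \<kappa> X + \<kappa> Y"
    and "\<And>i. i \<in> I \<Longrightarrow> V i \<in> VF"
  shows "\<kappa> (\<Sum>i\<in>I. V i) = (\<Sum>i\<in>I. \<kappa> (V i))"
proof -
  have "\<kappa> 0 = 0" using assms(1)[OF VF_zero VF_zero] by simp
  then show ?thesis
    using assms(2)
    by (induction I rule: infinite_finite_induct) (simp_all add: assms(1) VF_sum)
qed

section \<open>Gram-Schmidt and Parseval at a point\<close>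

definition orthonormal_at :: "'a \<Rightarrow> 'i set \<Rightarrow> ('i \<Rightarrow> 'a vfield) \<Rightarrow> bool" where
  "orthonormal_at p I e \<longleftrightarrow> (\<forall>i\<in>I. e i \<in> VF) \<and>
     (\<forall>i\<in>I. \<forall>j\<in>I. g (e i) (e j) p = (if i = j then 1 else 0))"

text \<open>One Gram-Schmidt step. For lack of dimension some coordinate vector lies outside the
  span of those of the family; a field realizing it is made orthogonal and normalized with constant
  coefficients, which is enough because only the values at \<open>p\<close> are compared.\<close>

lemma orthonormal_at_extend:
  assumes "finite I" "card I < DIM('e)" and e: "orthonormal_at p I e"
  shows "\<exists>X\<in>VF. g X X p = 1 \<and> (\<forall>i\<in>I. g X (e i) p = 0)"
proof -
  obtain \<kappa> where \<kappa>: "tangent_coordinates p \<kappa>"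
    using tangent_coordinates_exist by blast
  note add = tangent_coordinates_add[OF \<kappa>] and scale = tangent_coordinates_scale[OF \<kappa>]
    and surj = tangent_coordinates_surj[OF \<kappa>] and zero = tangent_coordinates_zero[OF \<kappa>]
  have eV: "\<And>i. i \<in> I \<Longrightarrow> e i \<in> VF" using e by (simp add: orthonormal_at_def)
  let ?S = "span ((\<lambda>i. \<kappa> (e i)) ` I)"
  have "dim ?S < DIM('e)"
    using dim_le_card'[of "(\<lambda>i. \<kappa> (e i)) ` I"] card_image_le[OF assms(1), of "\<lambda>i. \<kappa> (e i)"] assms(1,2)
    by simp
  then have "?S \<noteq> UNIV" by (metis dim_UNIV less_irrefl)
  then obtain v where v: "v \<notin> ?S" by blast
  obtain X0 where X0: "X0 \<in> VF" "\<kappa> X0 = v" using surj by blast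
  define Y where "Y = (\<Sum>i\<in>I. (\<lambda>_. - g X0 (e i) p) \<odot> e i)"
  define X where "X = X0 + Y"
  have Y: "Y \<in> VF" unfolding Y_def using eV by (intro VF_intros SF_const)
  then have X: "X \<in> VF" unfolding X_def using X0(1) by (intro VF_intros)
  have "\<kappa> X \<noteq> 0"
  proof
    assume "\<kappa> X = 0"
    moreover have "\<kappa> Y \<in> ?S"
    proof -
      have "\<kappa> Y = (\<Sum>i\<in>I. (- g X0 (e i) p) *\<^sub>R \<kappa> (e i))"
        unfolding Y_def using eV scale
        by (subst additive_sum[of \<kappa>]) (auto intro!: add VF_vscale SF_const)
      also have "\<dots> \<in> ?S" by (intro span_sum span_scale) (auto intro: span_base)
      finally show ?thesis .
    qed
    ultimately show False
      using v X0 Y by (metis X_def add add_eq_0_iff2 span_neg)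
  qed
  then obtain h where "X h p \<noteq> 0" using zero[OF X] by blast
  then have pos: "g X X p > 0" using g_pos[OF X] by blast
  have orth: "g X (e j) p = 0" if j: "j \<in> I" for j
  proof -
    have "g X (e j) p = g X0 (e j) p - (\<Sum>i\<in>I. g X0 (e i) p * g (e i) (e j) p)"
      unfolding X_def Y_def using j eV X0(1)
      by (simp add: g_linear VF_intros SF_const sum_fun_apply sum_negf)
    also have "(\<Sum>i\<in>I. g X0 (e i) p * g (e i) (e j) p) = (\<Sum>i\<in>I. if i = j then g X0 (e i) p else 0)"
      using e j by (intro sum.cong) (auto simp: orthonormal_at_def)
    also have "\<dots> = g X0 (e j) p" using j assms(1) by simp
    finally show ?thesis by simp
  qed
  let ?r = "\<lambda>q::'a. 1 / sqrt (g X X p)"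
  have "?r \<odot> X \<in> VF" using X by (intro VF_intros SF_const)
  moreover have "g (?r \<odot> X) (?r \<odot> X) p = 1"
    using X pos by (simp add: g_linear VF_intros SF_const)
  moreover have "\<forall>i\<in>I. g (?r \<odot> X) (e i) p = 0"
    using X eV orth by (simp add: g_linear SF_const)
  ultimately show ?thesis by blast
qed

lemma orthonormal_at_frame_exists: "\<exists>e. orthonormal_at p {1..DIM('e)} e"
proof -
  have "\<exists>e. orthonormal_at p {1..m} e" if "m \<le> DIM('e)" for m
    using that
  proof (induction m)
    case (Suc m)
    then obtain e where e: "orthonormal_at p {1..m} e" by auto
    obtain X where X: "X \<in> VF" "g X X p = 1" "\<forall>i\<in>{1..m}. g X (e i) p = 0"
      using orthonormal_at_extend[OF _ _ e] Suc.prems by auto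
    then have "\<forall>i\<in>{1..m}. g (e i) X p = 0"
      using e g_sym unfolding orthonormal_at_def by metis
    then have "orthonormal_at p {1..Suc m} (e(Suc m := X))"
      using e X by (auto simp: orthonormal_at_def atLeastAtMostSuc_conv)
    then show ?case by blast
  next
    case 0
    have "orthonormal_at p {1..0::nat} (\<lambda>_. 0)" by (simp add: orthonormal_at_def)
    then show ?case by blast
  qed
  then show ?thesis by blast
qed

text \<open>Pairing with \<open>e j\<close> at \<open>p\<close> recovers the coefficients of a
  combination, so the coordinate vectors of the frame are independent and, by their number, span.
  Hence \<open>X\<close> has the same coordinates as a combination of the \<open>e i\<close> with
  constant coefficients, and \<open>g\<close> at \<open>p\<close> cannot tell the two apart.\<close>

lemma Parseval:
  assumes "finite I" "card I = DIM('e)" and e: "orthonormal_at p I e"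
    and X: "X \<in> VF" and Y: "Y \<in> VF"
  shows "(\<Sum>i\<in>I. g X (e i) p * g Y (e i) p) = g X Y p"
proof -
  obtain \<kappa> where \<kappa>: "tangent_coordinates p \<kappa>"
    using tangent_coordinates_exist by blast
  note add = tangent_coordinates_add[OF \<kappa>] and scale = tangent_coordinates_scale[OF \<kappa>]
    and null = tangent_coordinates_null[OF \<kappa>]
  have eV: "\<And>i. i \<in> I \<Longrightarrow> e i \<in> VF" using e by (simp add: orthonormal_at_def)
  define C where "C u = (\<Sum>i\<in>I. (\<lambda>_. u i) \<odot> e i)" for u
  have C: "C u \<in> VF" for u unfolding C_def using eV by (intro VF_intros SF_const)
  have \<kappa>C: "\<kappa> (C u) = (\<Sum>i\<in>I. u i *\<^sub>R \<kappa> (e i))" for u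
    unfolding C_def using eV scale
    by (subst additive_sum[of \<kappa>]) (auto intro!: add VF_vscale SF_const)
  have gC: "g (C u) Z p = (\<Sum>i\<in>I. u i * g (e i) Z p)" if "Z \<in> VF" for u Z
    unfolding C_def using that eV by (simp add: g_linear VF_intros SF_const sum_fun_apply)
  have gCe: "g (C u) (e j) p = u j" if j: "j \<in> I" for u j
  proof -
    have "g (C u) (e j) p = (\<Sum>i\<in>I. if i = j then u i else 0)"
      unfolding gC[OF eV[OF j]] using e j by (intro sum.cong) (auto simp: orthonormal_at_def)
    then show ?thesis using j assms(1) by simp
  qed
  have indep: "u j = 0" if "(\<Sum>i\<in>I. u i *\<^sub>R \<kappa> (e i)) = 0" "j \<in> I" for u j
  proof -
    have "g (C u) (e j) p = 0"
      using null[OF C _ g_one_form[OF eV[OF that(2)]], of u] that \<kappa>C[of u] C[of u] eV[OF that(2)]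
      by (simp add: g_sym)
    then show ?thesis using gCe[OF that(2)] by simp
  qed
  have inj: "inj_on (\<lambda>i. \<kappa> (e i)) I"
  proof (rule inj_onI, rule ccontr)
    fix i j assume ij: "i \<in> I" "j \<in> I" "\<kappa> (e i) = \<kappa> (e j)" "i \<noteq> j"
    let ?u = "\<lambda>k. if k = i then 1 else if k = j then -1 else 0::real"
    have "(\<Sum>k\<in>I. ?u k *\<^sub>R \<kappa> (e k)) =
        (\<Sum>k\<in>I. (if k = i then \<kappa> (e k) else 0) - (if k = j then \<kappa> (e k) else 0))"
      using ij(4) by (intro sum.cong) auto
    also have "\<dots> = 0" using ij assms(1) by (simp add: sum_subtractf)
    finally show False using indep[of ?u i] ij(1) by simp
  qed
  have "independent ((\<lambda>i. \<kappa> (e i)) ` I)"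
  proof (rule independent_if_scalars_zero)
    fix u x assume "(\<Sum>x\<in>(\<lambda>i. \<kappa> (e i)) ` I. u x *\<^sub>R x) = 0" and x: "x \<in> (\<lambda>i. \<kappa> (e i)) ` I"
    then have "(\<Sum>i\<in>I. u (\<kappa> (e i)) *\<^sub>R \<kappa> (e i)) = 0"
      using inj by (simp add: sum.reindex)
    then show "u x = 0" using indep[of "\<lambda>i. u (\<kappa> (e i))"] x by auto
  qed (use assms(1) in simp)
  moreover have "card ((\<lambda>i. \<kappa> (e i)) ` I) = dim (UNIV :: 'e set)"
    using inj assms(2) by (simp add: card_image dim_UNIV)
  ultimately have "UNIV \<subseteq> span ((\<lambda>i. \<kappa> (e i)) ` I)"
    using card_eq_dim[of "(\<lambda>i. \<kappa> (e i)) ` I" UNIV] assms(1) by auto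
  then have "\<kappa> X \<in> span ((\<lambda>i. \<kappa> (e i)) ` I)" by blast
  then obtain w where "\<kappa> X = (\<Sum>x\<in>(\<lambda>i. \<kappa> (e i)) ` I. w x *\<^sub>R x)"
    using assms(1) by (auto simp: span_finite)
  then have w: "\<kappa> X = \<kappa> (C (\<lambda>i. w (\<kappa> (e i))))"
    using inj by (simp add: \<kappa>C sum.reindex)
  define u where "u = (\<lambda>i. w (\<kappa> (e i)))"
  have "\<kappa> (X - C u) = 0"
    using add[of "X - C u" "C u"] w X C[of u] by (simp add: u_def VF_diff)
  then have *: "g X Z p = g (C u) Z p" if "Z \<in> VF" for Z
    using null[OF VF_diff[OF X C[of u]] _ g_one_form[OF that]] that X C[of u]
    by (simp add: g_linear g_sym)
  have "(\<Sum>i\<in>I. g X (e i) p * g Y (e i) p) = (\<Sum>i\<in>I. u i * g (e i) Y p)"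
    using eV Y by (intro sum.cong) (simp_all add: * gCe g_sym)
  also have "\<dots> = g X Y p" using *[OF Y] gC[OF Y] by simp
  finally show ?thesis .
qed

end

section \<open>The Levi-Civita connection and its curvature\<close>

lemma (in smooth_manifold) lie_bracket_skew: "lie_bracket Y X = - lie_bracket X Y"
  by (simp add: lie_bracket_def fun_eq_iff)

lemma (in smooth_manifold) lie_bracket_jacobi:
  assumes "X \<in> VF" "Y \<in> VF" "Z \<in> VF"
  shows "lie_bracket X (lie_bracket Y Z) + lie_bracket Y (lie_bracket Z X)
    + lie_bracket Z (lie_bracket X Y) = 0"
proof
  fix h
  note SF = VF_SF[OF assms(1)] VF_SF[OF assms(2)] VF_SF[OF assms(3)]
  show "(lie_bracket X (lie_bracket Y Z) + lie_bracket Y (lie_bracket Z X)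
      + lie_bracket Z (lie_bracket X Y)) h = 0 h"
  proof (cases "h \<in> SF")
    case True
    then show ?thesis
      by (simp add: lie_bracket_def SF VF_diff_fun[OF assms(1)] VF_diff_fun[OF assms(2)]
          VF_diff_fun[OF assms(3)])
  next
    \<comment> \<open>On non-smooth functions brackets of fields vanish by convention.\<close>
    case False
    have "lie_bracket U (lie_bracket V W) h = 0" if "U \<in> VF" "V \<in> VF" "W \<in> VF" for U V W
      using that by (intro VF_nonsmooth[OF _ False] VF_lie_bracket)
    from this[OF assms] this[OF assms(2,3,1)] this[OF assms(3,1,2)] show ?thesis by simp
  qed
qed

locale levi_civita_manifold = riemannian_manifold A g
  for A :: "('a::{t2_space,second_countable_topology}, 'e::euclidean_space) atlas" and g +
  fixes D :: "'a vfield \<Rightarrow> 'a vfield \<Rightarrow> 'a vfield"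
  assumes levi_civita: "levi_civita_connection A g D"
begin

lemma D_connection: "linear_connection A D"
  using levi_civita by (simp add: levi_civita_connection_def)

lemma D_VF: "X \<in> VF \<Longrightarrow> Y \<in> VF \<Longrightarrow> D X Y \<in> VF"
  using D_connection by (simp add: linear_connection_def)

lemmas field_mem = VF_intros SF_intros g_SF D_VF

lemma torsion_free: "X \<in> VF \<Longrightarrow> Y \<in> VF \<Longrightarrow> lie_bracket X Y = D X Y - D Y X"
  using levi_civita by (simp add: levi_civita_connection_def)

lemma D_metric:
  "X \<in> VF \<Longrightarrow> Y \<in> VF \<Longrightarrow> Z \<in> VF \<Longrightarrow> X (g Y Z) = g (D X Y) Z + g Y (D X Z)"
  using levi_civita unfolding levi_civita_connection_def by blast

lemma D_vscale_left: "a \<in> SF \<Longrightarrow> X \<in> VF \<Longrightarrow> Y \<in> VF \<Longrightarrow> D (a \<odot> X) Y = a \<odot> D X Y"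
  using D_connection by (simp add: linear_connection_def)

lemma D_vscale_right:
  "a \<in> SF \<Longrightarrow> X \<in> VF \<Longrightarrow> Y \<in> VF \<Longrightarrow> D X (a \<odot> Y) = X a \<odot> Y + a \<odot> D X Y"
  using D_connection by (simp add: linear_connection_def)

lemma D_const_right:
  "X \<in> VF \<Longrightarrow> Y \<in> VF \<Longrightarrow> D X ((\<lambda>_. r) \<odot> Y) = (\<lambda>_. r) \<odot> D X Y"
  using D_vscale_right[OF SF_const, of X Y r] VF_const[of X r] by (simp add: vscale_zero_left)

lemma D_add_left: "X \<in> VF \<Longrightarrow> Y \<in> VF \<Longrightarrow> Z \<in> VF \<Longrightarrow> D (X + Y) Z = D X Z + D Y Z"
  using D_connection by (simp add: linear_connection_def)

lemma D_add_right: "X \<in> VF \<Longrightarrow> Y \<in> VF \<Longrightarrow> Z \<in> VF \<Longrightarrow> D X (Y + Z) = D X Y + D X Z"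
  using D_connection by (simp add: linear_connection_def)

lemma D_minus_left: "X \<in> VF \<Longrightarrow> Y \<in> VF \<Longrightarrow> D (- X) Y = - D X Y"
  using D_vscale_left[OF SF_const, of X Y "-1"] by (simp add: vscale_minus_one)

lemma D_minus_right: "X \<in> VF \<Longrightarrow> Y \<in> VF \<Longrightarrow> D X (- Y) = - D X Y"
  using D_const_right[of X Y "-1"] by (simp add: vscale_minus_one)

lemma D_diff_left: "X \<in> VF \<Longrightarrow> Y \<in> VF \<Longrightarrow> Z \<in> VF \<Longrightarrow> D (X - Y) Z = D X Z - D Y Z"
  using D_add_left[of X "- Y" Z] by (simp add: D_minus_left VF_minus)

lemma D_diff_right: "X \<in> VF \<Longrightarrow> Y \<in> VF \<Longrightarrow> Z \<in> VF \<Longrightarrow> D X (Y - Z) = D X Y - D X Z"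
  using D_add_right[of X Y "- Z"] by (simp add: D_minus_right VF_minus)

lemma D_zero_left: "X \<in> VF \<Longrightarrow> D 0 X = 0"
  using D_diff_left[of X X X] by simp

lemma D_zero_right: "X \<in> VF \<Longrightarrow> D X 0 = 0"
  using D_diff_right[of X X X] by simp

lemma D_sum_right:
  assumes "X \<in> VF" "\<And>i. i \<in> I \<Longrightarrow> V i \<in> VF"
  shows "D X (\<Sum>i\<in>I. V i) = (\<Sum>i\<in>I. D X (V i))"
  using assms(2)
  by (induction I rule: infinite_finite_induct)
    (simp_all add: D_zero_right D_add_right VF_sum assms(1))

lemmas D_linear = D_add_left D_add_right D_minus_left D_minus_right D_diff_left D_diff_right
  D_zero_left D_zero_right

section \<open>Symmetries of the curvature\<close>

abbreviation "R \<equiv> curvature D"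

lemma curvature_eq:
  assumes "X \<in> VF" "Y \<in> VF" "Z \<in> VF"
  shows "R X Y Z = D X (D Y Z) - D Y (D X Z) - D (D X Y) Z + D (D Y X) Z"
  using assms by (simp add: curvature_def torsion_free D_linear field_mem)

lemma curvature_VF: "X \<in> VF \<Longrightarrow> Y \<in> VF \<Longrightarrow> Z \<in> VF \<Longrightarrow> R X Y Z \<in> VF"
  by (simp add: curvature_def field_mem)

definition Rm :: "'a \<Rightarrow> 'a vfield \<Rightarrow> 'a vfield \<Rightarrow> 'a vfield \<Rightarrow> 'a vfield \<Rightarrow> real" where
  "Rm p X Y Z W = g (R X Y Z) W p"

lemma Rm_add:
  assumes "X \<in> VF" "Y \<in> VF" "Z \<in> VF" "W \<in> VF" "V \<in> VF"
  shows "Rm p (X + V) Y Z W = Rm p X Y Z W + Rm p V Y Z W"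
    and "Rm p X (Y + V) Z W = Rm p X Y Z W + Rm p X V Z W"
    and "Rm p X Y (Z + V) W = Rm p X Y Z W + Rm p X Y V W"
    and "Rm p X Y Z (W + V) = Rm p X Y Z W + Rm p X Y Z V"
  using assms by (simp_all add: Rm_def curvature_eq D_linear g_linear field_mem)

text \<open>Constants are the scalars that occur later: coefficients are evaluated at the point
  beforehand, so none of them gets differentiated.\<close>

lemma Rm_scale:
  assumes "X \<in> VF" "Y \<in> VF" "Z \<in> VF" "W \<in> VF"
  shows "Rm p ((\<lambda>_. r) \<odot> X) Y Z W = r * Rm p X Y Z W"
    and "Rm p X ((\<lambda>_. r) \<odot> Y) Z W = r * Rm p X Y Z W"
    and "Rm p X Y ((\<lambda>_. r) \<odot> Z) W = r * Rm p X Y Z W"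
    and "Rm p X Y Z ((\<lambda>_. r) \<odot> W) = r * Rm p X Y Z W"
  using assms
  by (simp_all add: Rm_def curvature_eq D_linear D_vscale_left D_const_right g_linear field_mem
      algebra_simps)

lemma Rm_sum_right:
  assumes "X \<in> VF" "Y \<in> VF" "Z \<in> VF" "\<And>i. i \<in> I \<Longrightarrow> V i \<in> VF"
  shows "Rm p X Y Z (\<Sum>i\<in>I. (\<lambda>_. r i) \<odot> V i) = (\<Sum>i\<in>I. r i * Rm p X Y Z (V i))"
  using assms by (simp add: Rm_def curvature_VF g_linear field_mem sum_fun_apply)

lemma Rm_skew12: "Rm p Y X Z W = - Rm p X Y Z W" if "X \<in> VF" "Y \<in> VF" "Z \<in> VF" "W \<in> VF"
  using that by (simp add: Rm_def curvature_eq g_linear field_mem)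

text \<open>After regrouping the nine terms, vanishing torsion turns each group of three into a
  double bracket, and the sum is that of the Jacobi identity.\<close>

lemma first_Bianchi:
  assumes "X \<in> VF" "Y \<in> VF" "Z \<in> VF"
  shows "R X Y Z + R Y Z X + R Z X Y = 0"
proof -
  have *: "D U (D V W) - D U (D W V) - D (lie_bracket V W) U = lie_bracket U (lie_bracket V W)"
    if "U \<in> VF" "V \<in> VF" "W \<in> VF" for U V W
    using that by (simp add: torsion_free D_linear field_mem)
  have "R X Y Z + R Y Z X + R Z X Y =
      (D X (D Y Z) - D X (D Z Y) - D (lie_bracket Y Z) X)
      + (D Y (D Z X) - D Y (D X Z) - D (lie_bracket Z X) Y)
      + (D Z (D X Y) - D Z (D Y X) - D (lie_bracket X Y) Z)"
    by (simp add: curvature_def)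
  also have "\<dots> = 0"
    using assms lie_bracket_jacobi by (simp only: *)
  finally show ?thesis .
qed

lemma Rm_Bianchi:
  assumes "X \<in> VF" "Y \<in> VF" "Z \<in> VF" "W \<in> VF"
  shows "Rm p X Y Z W + Rm p Y Z X W + Rm p Z X Y W = 0"
proof -
  have "g (R X Y Z + R Y Z X + R Z X Y) W p = 0"
    using assms by (simp only: first_Bianchi g_zero_left zero_fun_apply)
  then show ?thesis using assms by (simp add: Rm_def g_linear curvature_VF field_mem)
qed

text \<open>Apply the commutator of \<open>X\<close> and \<open>Y\<close> to \<open>g Z W\<close>.
  Among the second derivatives the mixed products are symmetric in \<open>X\<close> and
  \<open>Y\<close> and cancel; the bracket term accounts for the rest.\<close>

lemma Rm_skew34:
  assumes "X \<in> VF" "Y \<in> VF" "Z \<in> VF" "W \<in> VF"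
  shows "Rm p X Y W Z = - Rm p X Y Z W"
proof -
  have second: "U (V (g Z W)) p = g (D U (D V Z)) W p + g (D V Z) (D U W) p
      + g (D U Z) (D V W) p + g Z (D U (D V W)) p" if "U \<in> VF" "V \<in> VF" for U V
    unfolding D_metric[OF that(2) assms(3,4)] using that assms(3,4)
    by (simp add: VF_add_fun[OF that(1)] D_metric[OF that(1)] g_SF D_VF)
  have "X (Y (g Z W)) p - Y (X (g Z W)) p = lie_bracket X Y (g Z W) p"
    by (simp add: lie_bracket_def)
  also have "\<dots> = g (D (lie_bracket X Y) Z) W p + g Z (D (lie_bracket X Y) W) p"
    using D_metric[OF VF_lie_bracket[OF assms(1,2)] assms(3,4)] by simp
  finally show ?thesis
    using assms second[of X Y] second[of Y X] fun_cong[OF g_sym[of Z "R X Y W"], of p]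
    by (simp add: Rm_def curvature_def g_linear field_mem)
qed

text \<open>The classical combination of the Bianchi identities for the four cyclic shifts of X, Y,
  Z, W; the skew symmetries cancel all but the two wanted terms.\<close>

lemma Rm_pair:
  assumes "X \<in> VF" "Y \<in> VF" "Z \<in> VF" "W \<in> VF"
  shows "Rm p X Y Z W = Rm p Z W X Y"
  using Rm_Bianchi[of X Y Z W p] Rm_Bianchi[of Y Z W X p] Rm_Bianchi[of Z W X Y p] Rm_Bianchi[of W X Y Z p]
    Rm_skew34[of Y Z X W p] Rm_skew34[of Z W X Y p] Rm_skew12[of Y W Z X p]
    Rm_skew12[of X W Z Y p] Rm_skew34[of X W Y Z p] Rm_skew12[of Z X W Y p] Rm_skew34[of Z X Y W p]
    Rm_skew12[of X W Y Z p] Rm_skew34[of X Y Z W p] Rm_skew34[of Y W Z X p] assms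
  by (simp only: True_implies_equals)

end

section \<open>The structure vector fields are Killing\<close>

locale S_manifold_levi_civita = S_manifold A n s f \<xi> \<eta> g + levi_civita_manifold A g D
  for A :: "('a::{t2_space,second_countable_topology}, 'e::euclidean_space) atlas"
    and n s f \<xi> \<eta> g D
begin

lemma f_VF: "X \<in> VF \<Longrightarrow> f X \<in> VF"
  using f_tensor by (simp add: tensor_field_1_1_def)

lemma f_add: "X \<in> VF \<Longrightarrow> Y \<in> VF \<Longrightarrow> f (X + Y) = f X + f Y"
  using f_tensor by (simp add: tensor_field_1_1_def)

lemma f_vscale: "a \<in> SF \<Longrightarrow> X \<in> VF \<Longrightarrow> f (a \<odot> X) = a \<odot> f X"
  using f_tensor by (simp add: tensor_field_1_1_def)

lemma f_minus: "X \<in> VF \<Longrightarrow> f (- X) = - f X"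
  using f_vscale[OF SF_const, of X "-1"] by (simp add: vscale_minus_one)

lemma f_diff: "X \<in> VF \<Longrightarrow> Y \<in> VF \<Longrightarrow> f (X - Y) = f X - f Y"
  using f_add[of X "- Y"] by (simp add: f_minus VF_minus)

lemma f_zero: "f 0 = 0"
  using f_diff[OF VF_zero VF_zero] by simp

lemma f_sum: "(\<And>i. i \<in> I \<Longrightarrow> V i \<in> VF) \<Longrightarrow> f (\<Sum>i\<in>I. V i) = (\<Sum>i\<in>I. f (V i))"
  by (induction I rule: infinite_finite_induct) (simp_all add: f_zero f_add VF_sum)

lemmas f_linear = f_add f_minus f_diff f_zero

lemma \<eta>_SF: "\<alpha> \<in> {1..s} \<Longrightarrow> X \<in> VF \<Longrightarrow> \<eta> \<alpha> X \<in> SF"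
  using one_form_SF[OF \<eta>_form] .

lemmas S_mem = field_mem f_VF \<xi>_field \<eta>_SF

lemma vscale_zero_right: "a \<odot> 0 = (0 :: 'a vfield)"
  by (simp add: vscale_def fun_eq_iff)

lemma f_cube: assumes "X \<in> VF" shows "f (f (f X)) = - f X"
proof -
  have V: "\<eta> \<alpha> X \<odot> \<xi> \<alpha> \<in> VF" if "\<alpha> \<in> {1..s}" for \<alpha>
    using that assms by (intro VF_vscale \<eta>_SF \<xi>_field)
  have "f (\<eta> \<alpha> X \<odot> \<xi> \<alpha>) = 0" if "\<alpha> \<in> {1..s}" for \<alpha>
    using f_vscale[OF \<eta>_SF[OF that assms] \<xi>_field[OF that]] f_\<xi>[OF that]
    by (simp add: vscale_zero_right)
  then have "f (\<Sum>\<alpha>\<in>{1..s}. \<eta> \<alpha> X \<odot> \<xi> \<alpha>) = 0"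
    using V by (subst f_sum) (auto intro!: sum.neutral simp del: One_nat_def)
  moreover have "(\<Sum>\<alpha>\<in>{1..s}. \<eta> \<alpha> X \<odot> \<xi> \<alpha>) \<in> VF" by (intro VF_sum V)
  ultimately show ?thesis
    unfolding f_square[OF assms] using assms
    by (subst f_add) (simp_all add: f_minus VF_minus del: One_nat_def)
qed

lemma g_f_left: "X \<in> VF \<Longrightarrow> Y \<in> VF \<Longrightarrow> g (f X) Y = - g X (f Y)"
  by (simp add: g_f_skew)

lemma g_f_swap: "X \<in> VF \<Longrightarrow> Y \<in> VF \<Longrightarrow> g X (f Y) = - g Y (f X)"
  by (subst g_f_skew) (simp_all add: g_sym f_VF)

lemma g_f_square: "X \<in> VF \<Longrightarrow> Y \<in> VF \<Longrightarrow>
    g X (f (f Y)) = - g X Y + (\<Sum>\<alpha>\<in>{1..s}. \<eta> \<alpha> Y * \<eta> \<alpha> X)"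
  using g_f_f[of X Y] g_f_skew[of X "f Y"] by (simp add: f_VF mult.commute)

text \<open>The factor 2 undoes the 1/2 in \<open>ext_deriv\<close>.\<close>

lemma contact_condition:
  assumes "\<alpha> \<in> {1..s}" "X \<in> VF" "Y \<in> VF"
  shows "X (\<eta> \<alpha> Y) p - Y (\<eta> \<alpha> X) p - \<eta> \<alpha> (lie_bracket X Y) p = 2 * g X (f Y) p"
  using fun_cong[OF fundamental_eq[OF assms], of p]
  by (simp add: fundamental_form_def ext_deriv_def)

text \<open>All d\<eta>^\<alpha> are the same form, so the normality condition involves the
  structure fields only through their sum.\<close>

definition \<xi>sum :: "'a vfield" where "\<xi>sum = (\<Sum>\<alpha>\<in>{1..s}. \<xi> \<alpha>)"

lemma \<xi>sum_VF: "\<xi>sum \<in> VF"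
  unfolding \<xi>sum_def by (intro VF_sum \<xi>_field)

lemma vscale_\<xi>sum: "a \<odot> \<xi>sum = (\<Sum>\<alpha>\<in>{1..s}. a \<odot> \<xi> \<alpha>)"
  by (simp add: \<xi>sum_def vscale_def fun_eq_iff sum_fun_apply sum_distrib_left)

lemma normality:
  assumes "X \<in> VF" "Y \<in> VF"
  shows "nijenhuis f X Y + (\<lambda>p. 2 * g X (f Y) p) \<odot> \<xi>sum = 0"
proof -
  have "(\<lambda>p. 2 * ext_deriv (\<eta> \<alpha>) X Y p) = (\<lambda>p. 2 * g X (f Y) p)" if "\<alpha> \<in> {1..s}" for \<alpha>
    using fundamental_eq[OF that assms] by (simp add: fundamental_form_def)
  then show ?thesis
    using normal[OF assms] by (simp add: vscale_\<xi>sum)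
qed

lemma lie_bracket_minus_right:
  "X \<in> VF \<Longrightarrow> Y \<in> VF \<Longrightarrow> lie_bracket X (- Y) = - lie_bracket X Y"
  by (simp add: torsion_free D_linear VF_minus)

lemma lie_bracket_zero: "X \<in> VF \<Longrightarrow> lie_bracket 0 X = 0" "X \<in> VF \<Longrightarrow> lie_bracket X 0 = 0"
  by (simp_all add: torsion_free D_linear VF_zero)

lemma g_f_\<xi>: "\<alpha> \<in> {1..s} \<Longrightarrow> X \<in> VF \<Longrightarrow> g X (f (\<xi> \<alpha>)) = 0"
  by (simp add: f_\<xi> g_linear)

lemma g_\<xi>_f: "\<alpha> \<in> {1..s} \<Longrightarrow> X \<in> VF \<Longrightarrow> g (\<xi> \<alpha>) (f X) = 0"
  using g_f_swap[of "\<xi> \<alpha>" X] by (simp add: g_f_\<xi> \<xi>_field)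

lemma VF_\<eta>_\<xi>: "X \<in> VF \<Longrightarrow> \<alpha> \<in> {1..s} \<Longrightarrow> \<beta> \<in> {1..s} \<Longrightarrow> X (\<eta> \<alpha> (\<xi> \<beta>)) = 0"
  by (simp only: \<eta>_\<xi> VF_const)

text \<open>The form \<Phi> = d\<eta>^\<beta> annihilates \<xi>_\<alpha>, and
  \<eta>^\<beta>(\<xi>_\<alpha>) is constant; so the Lie derivative of \<eta>^\<beta> along
  \<xi>_\<alpha> is zero.\<close>

lemma lie_\<xi>_\<eta>:
  assumes "\<alpha> \<in> {1..s}" "\<beta> \<in> {1..s}" "X \<in> VF"
  shows "\<xi> \<alpha> (\<eta> \<beta> X) = \<eta> \<beta> (lie_bracket (\<xi> \<alpha>) X)"
proof
  fix p
  show "\<xi> \<alpha> (\<eta> \<beta> X) p = \<eta> \<beta> (lie_bracket (\<xi> \<alpha>) X) p"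
    using contact_condition[OF assms(2) \<xi>_field[OF assms(1)] assms(3), of p]
      VF_\<eta>_\<xi>[OF assms(3,2,1)] g_\<xi>_f[OF assms(1,3)] by simp
qed

lemma eq_0_of_f_\<eta>:
  assumes "X \<in> VF" "f (f X) = 0" "\<And>\<beta>. \<beta> \<in> {1..s} \<Longrightarrow> \<eta> \<beta> X = 0"
  shows "X = 0"
proof -
  have "- X + (\<Sum>\<alpha>\<in>{1..s}. \<eta> \<alpha> X \<odot> \<xi> \<alpha>) = 0"
    using f_square[OF assms(1)] assms(2) by simp
  moreover have "(\<Sum>\<alpha>\<in>{1..s}. \<eta> \<alpha> X \<odot> \<xi> \<alpha>) = 0"
    by (intro sum.neutral ballI) (simp add: assms(3) vscale_zero_left)
  ultimately show ?thesis by simp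
qed

text \<open>Normality with first argument \<xi>_\<alpha> gives the identity only after applying
  \<open>f\<close>. The lost vertical part is restored by the \<eta>^\<beta>, which vanish on both
  sides: on the right by \<eta> o f = 0, on the left by the invariance of \<eta>^\<beta>.\<close>

lemma lie_\<xi>_f:
  assumes "\<alpha> \<in> {1..s}" "X \<in> VF"
  shows "lie_bracket (\<xi> \<alpha>) (f X) = f (lie_bracket (\<xi> \<alpha>) X)"
proof -
  let ?L = "lie_bracket (\<xi> \<alpha>)"
  have V: "\<xi> \<alpha> \<in> VF" using assms by (simp add: \<xi>_field)
  have "(\<lambda>p. 2 * g (\<xi> \<alpha>) (f X) p) = 0"
    using assms by (simp add: g_\<xi>_f fun_eq_iff)
  then have eq: "f (f (?L X)) = f (?L (f X))"
    using normality[OF V assms(2)] assms V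
    by (simp add: nijenhuis_def f_\<xi> f_zero lie_bracket_zero f_VF vscale_zero_left)
  have "?L (f X) - f (?L X) = 0"
  proof (rule eq_0_of_f_\<eta>)
    show "f (f (?L (f X) - f (?L X))) = 0"
      using assms V eq by (simp add: f_linear S_mem)
    show "\<eta> \<beta> (?L (f X) - f (?L X)) = 0" if \<beta>: "\<beta> \<in> {1..s}" for \<beta>
    proof -
      have "\<eta> \<beta> (?L (f X)) = 0"
        using lie_\<xi>_\<eta>[OF assms(1) \<beta> f_VF[OF assms(2)]] \<beta> assms(2) VF_zero_fun[OF V]
        by (simp add: \<eta>_f)
      moreover have "\<eta> \<beta> (f (?L X)) = 0" using \<beta> V assms(2) by (simp add: \<eta>_f S_mem)
      ultimately show ?thesis
        using one_form_diff[OF \<eta>_form[OF \<beta>], of "?L (f X)" "f (?L X)"] V assms(2) by (simp add: S_mem)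
    qed
  qed (use assms V in \<open>simp add: S_mem\<close>)
  then show ?thesis by simp
qed

text \<open>Lie derivatives commute with d, and \<Phi> = d\<eta>^\<alpha> with \<eta>^\<alpha>
  invariant. In terms of fields: differentiate \<open>contact_condition\<close> along \<xi>_\<alpha>
  and commute with the brackets by Jacobi.\<close>

lemma lie_\<xi>_fundamental:
  assumes "\<alpha> \<in> {1..s}" "X \<in> VF" "Y \<in> VF"
  shows "\<xi> \<alpha> (g X (f Y)) p = g (lie_bracket (\<xi> \<alpha>) X) (f Y) p + g X (f (lie_bracket (\<xi> \<alpha>) Y)) p"
proof -
  let ?L = "lie_bracket (\<xi> \<alpha>)" and ?h = "\<eta> \<alpha>"
  have V: "\<xi> \<alpha> \<in> VF" using assms by (simp add: \<xi>_field)
  have LX: "?L X \<in> VF" and LY: "?L Y \<in> VF" and XY: "lie_bracket X Y \<in> VF"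
    using V assms by (simp_all add: S_mem)
  have h: "?h U \<in> SF" if "U \<in> VF" for U using \<eta>_SF[OF assms(1) that] .
  have "X (?h Y) - Y (?h X) - ?h (lie_bracket X Y) = (\<lambda>_. 2) * g X (f Y)"
    using contact_condition[OF assms] by (simp add: fun_eq_iff)
  then have "\<xi> \<alpha> (X (?h Y) - Y (?h X) - ?h (lie_bracket X Y)) = \<xi> \<alpha> ((\<lambda>_. 2) * g X (f Y))"
    by simp
  from fun_cong[OF this, of p] have 1: "\<xi> \<alpha> (X (?h Y)) p - \<xi> \<alpha> (Y (?h X)) p - \<xi> \<alpha> (?h (lie_bracket X Y)) p
      = 2 * \<xi> \<alpha> (g X (f Y)) p"
    using assms h XY
    by (simp add: VF_diff_fun[OF V] VF_mult_fun[OF V] VF_const[OF V] VF_SF[OF assms(2)]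
        VF_SF[OF assms(3)] SF_intros g_SF f_VF)
  have jac: "?L (lie_bracket X Y) = lie_bracket (?L X) Y + lie_bracket X (?L Y)"
    using lie_bracket_jacobi[OF V assms(2,3)] lie_bracket_skew[of Y "\<xi> \<alpha>"] LY assms(2)
      lie_bracket_skew[of Y "?L X"] by (simp add: lie_bracket_minus_right algebra_simps)
  have "\<xi> \<alpha> (?h (lie_bracket X Y)) p = ?h (lie_bracket (?L X) Y) p + ?h (lie_bracket X (?L Y)) p"
    unfolding lie_\<xi>_\<eta>[OF assms(1,1) XY] jac using assms LX LY
    by (subst one_form_add[OF \<eta>_form[OF assms(1)]]) (simp_all add: S_mem)
  moreover have "?L X (?h Y) p = \<xi> \<alpha> (X (?h Y)) p - X (\<xi> \<alpha> (?h Y)) p"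
    "?L Y (?h X) p = \<xi> \<alpha> (Y (?h X)) p - Y (\<xi> \<alpha> (?h X)) p"
    by (simp_all add: lie_bracket_def)
  moreover have "\<xi> \<alpha> (?h Y) = ?h (?L Y)" "\<xi> \<alpha> (?h X) = ?h (?L X)"
    using lie_\<xi>_\<eta>[OF assms(1,1)] assms by auto
  ultimately show ?thesis
    using 1 contact_condition[OF assms(1) LX assms(3), of p] contact_condition[OF assms(1,2) LY, of p]
    by simp
qed

text \<open>The invariance of \<open>\<Phi>\<close> and \<open>f\<close> under \<open>\<xi>\<^sub>\<alpha>\<close> makes \<open>\<xi>\<^sub>\<alpha>\<close> a Killing field.\<close>

lemma lie_\<xi>_g:
  assumes "\<alpha> \<in> {1..s}" "X \<in> VF" "Y \<in> VF"
  shows "\<xi> \<alpha> (g X Y) p = g (lie_bracket (\<xi> \<alpha>) X) Y p + g X (lie_bracket (\<xi> \<alpha>) Y) p"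
proof -
  let ?L = "lie_bracket (\<xi> \<alpha>)"
  have V: "\<xi> \<alpha> \<in> VF" using assms by (simp add: \<xi>_field)
  have LX: "?L X \<in> VF" and LY: "?L Y \<in> VF" using V assms by (simp_all add: S_mem)
  have \<eta>: "\<xi> \<alpha> (\<eta> \<beta> Y * \<eta> \<beta> X) p = \<eta> \<beta> Y p * \<eta> \<beta> (?L X) p + \<eta> \<beta> (?L Y) p * \<eta> \<beta> X p"
    if "\<beta> \<in> {1..s}" for \<beta>
    using assms that
    by (subst VF_mult_fun[OF V]) (simp_all add: \<eta>_SF lie_\<xi>_\<eta>)
  \<comment> \<open>The metric is recovered from \<Phi>(X, fY) = g(X, f^2 Y) = - g(X, Y) + \<Sum>
    \<eta>^\<beta>(X) \<eta>^\<beta>(Y), in which all other ingredients are invariant.\<close>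
  have "\<xi> \<alpha> (g X (f (f Y))) p = \<xi> \<alpha> (- g X Y + (\<Sum>\<beta>\<in>{1..s}. \<eta> \<beta> Y * \<eta> \<beta> X)) p"
    using assms by (simp add: g_f_square)
  also have "\<dots> = - \<xi> \<alpha> (g X Y) p + (\<Sum>\<beta>\<in>{1..s}. \<xi> \<alpha> (\<eta> \<beta> Y * \<eta> \<beta> X) p)"
  proof -
    have \<eta>\<eta>: "\<eta> \<beta> Y * \<eta> \<beta> X \<in> SF" if "\<beta> \<in> {1..s}" for \<beta>
      using that assms by (intro SF_mult \<eta>_SF)
    have "\<xi> \<alpha> (\<Sum>\<beta>\<in>{1..s}. \<eta> \<beta> Y * \<eta> \<beta> X) = (\<Sum>\<beta>\<in>{1..s}. \<xi> \<alpha> (\<eta> \<beta> Y * \<eta> \<beta> X))"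
      by (intro VF_sum_fun V \<eta>\<eta>)
    then show ?thesis
      using assms SF_sum[of "{1..s}" "\<lambda>\<beta>. \<eta> \<beta> Y * \<eta> \<beta> X"] \<eta>\<eta>
      by (simp add: VF_add_fun[OF V] VF_diff_fun[OF V] VF_minus_fun[OF V] SF_minus g_SF sum_fun_apply del: One_nat_def)
  qed
  finally have "\<xi> \<alpha> (g X (f (f Y))) p = - \<xi> \<alpha> (g X Y) p
      + (\<Sum>\<beta>\<in>{1..s}. \<eta> \<beta> Y p * \<eta> \<beta> (?L X) p) + (\<Sum>\<beta>\<in>{1..s}. \<eta> \<beta> (?L Y) p * \<eta> \<beta> X p)"
    using \<eta> by (simp add: sum.distrib)
  moreover have "\<xi> \<alpha> (g X (f (f Y))) p = g (?L X) (f (f Y)) p + g X (f (f (?L Y))) p"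
    using lie_\<xi>_fundamental[OF assms(1,2) f_VF[OF assms(3)]] lie_\<xi>_f[OF assms(1,3)] by simp
  ultimately show ?thesis
    using assms LX LY by (simp add: g_f_square sum_fun_apply)
qed

text \<open>The Killing equation says that g(\<nabla>_X \<xi>_\<alpha>, Y) is skew in X and Y; its
  skew part is d\<eta>^\<alpha> = \<Phi>. So it equals g(X, fY).\<close>

lemma D_\<xi>:
  assumes "\<alpha> \<in> {1..s}" "X \<in> VF"
  shows "D X (\<xi> \<alpha>) = - f X"
proof (rule g_eqI)
  fix Y p assume Y: "Y \<in> VF"
  have V: "\<xi> \<alpha> \<in> VF" using assms by (simp add: \<xi>_field)
  have "g (D X (\<xi> \<alpha>)) Y p + g X (D Y (\<xi> \<alpha>)) p = 0"
    using lie_\<xi>_g[OF assms Y, of p] fun_cong[OF D_metric[OF V assms(2) Y], of p] assms(2) V Y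
    by (simp add: torsion_free g_linear D_VF)
  moreover have "X (g Y (\<xi> \<alpha>)) p = g (D X Y) (\<xi> \<alpha>) p + g Y (D X (\<xi> \<alpha>)) p"
    "Y (g X (\<xi> \<alpha>)) p = g (D Y X) (\<xi> \<alpha>) p + g X (D Y (\<xi> \<alpha>)) p"
    using D_metric[OF assms(2) Y V] D_metric[OF Y assms(2) V] by simp_all
  moreover have "X (g Y (\<xi> \<alpha>)) p - Y (g X (\<xi> \<alpha>)) p - g (D X Y) (\<xi> \<alpha>) p + g (D Y X) (\<xi> \<alpha>) p
      = 2 * g X (f Y) p"
    using contact_condition[OF assms Y, of p] assms Y V
    by (simp add: \<eta>_g torsion_free g_linear D_VF VF_diff)
  moreover have "g Y (D X (\<xi> \<alpha>)) = g (D X (\<xi> \<alpha>)) Y" using assms Y V by (simp add: g_sym D_VF)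
  ultimately show "g (D X (\<xi> \<alpha>)) Y p = g (- f X) Y p"
    using assms Y by (simp add: g_linear g_f_left f_VF)
qed (use assms in \<open>simp_all add: S_mem\<close>)

text \<open>This is the source of the constant s in the curvature.\<close>

lemma D_\<xi>sum: assumes "X \<in> VF" shows "D X \<xi>sum = (\<lambda>_. - real s) \<odot> f X"
proof -
  have "D X \<xi>sum = (\<Sum>\<alpha>\<in>{1..s}. - f X)"
  proof -
    have "D X \<xi>sum = (\<Sum>\<alpha>\<in>{1..s}. D X (\<xi> \<alpha>))"
      unfolding \<xi>sum_def by (rule D_sum_right[OF assms \<xi>_field])
    also have "\<dots> = (\<Sum>\<alpha>\<in>{1..s}. - f X)"
      by (intro sum.cong refl D_\<xi> assms)
    finally show ?thesis .
  qed
  then show ?thesis by (simp add: fun_eq_iff sum_fun_apply vscale_apply)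
qed

lemma g_\<xi>sum: "X \<in> VF \<Longrightarrow> g X \<xi>sum = (\<Sum>\<alpha>\<in>{1..s}. \<eta> \<alpha> X)"
  unfolding \<xi>sum_def by (subst g_sum_right) (auto intro!: sum.cong simp: \<eta>_g \<xi>_field)

lemma f_\<xi>sum: "f \<xi>sum = 0"
  unfolding \<xi>sum_def by (subst f_sum) (auto intro!: sum.neutral simp: f_\<xi> \<xi>_field)

lemma g_f_\<xi>sum: "X \<in> VF \<Longrightarrow> g (f X) \<xi>sum = 0"
  by (simp add: g_f_left \<xi>sum_VF f_\<xi>sum g_linear)

lemma g_\<xi>sum_f: "X \<in> VF \<Longrightarrow> g \<xi>sum (f X) = 0"
  using g_f_\<xi>sum[of X] by (simp add: g_sym \<xi>sum_VF f_VF)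

lemma g_\<xi>_\<xi>sum: assumes "\<alpha> \<in> {1..s}" shows "g (\<xi> \<alpha>) \<xi>sum = (\<lambda>_. 1)"
  using assms by (simp add: g_\<xi>sum \<xi>_field \<eta>_\<xi> fun_eq_iff sum_fun_apply)

section \<open>The covariant derivative of f\<close>

lemmas f_mem = field_mem f_VF \<xi>sum_VF

definition nabla_f :: "'a vfield \<Rightarrow> 'a vfield \<Rightarrow> 'a vfield" where
  "nabla_f X Y = D X (f Y) - f (D X Y)"

text \<open>The value expected for (\<nabla>_X f)Y; \<open>g Y \<xi>sum\<close> is the sum of the
  \<eta>^\<alpha>(Y).\<close>

definition nabla_f_form :: "'a vfield \<Rightarrow> 'a vfield \<Rightarrow> 'a vfield" where
  "nabla_f_form X Y = g (f X) (f Y) \<odot> \<xi>sum + g Y \<xi>sum \<odot> f (f X)"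

text \<open>Measuring the error as a function of three fields lets the inhomogeneous terms of each
  identity for \<nabla>f drop out.\<close>

definition defect :: "'a \<Rightarrow> 'a vfield \<Rightarrow> 'a vfield \<Rightarrow> 'a vfield \<Rightarrow> real" where
  "defect p X Y Z = g (nabla_f X Y) Z p - g (nabla_f_form X Y) Z p"

lemma nabla_f_VF: "X \<in> VF \<Longrightarrow> Y \<in> VF \<Longrightarrow> nabla_f X Y \<in> VF"
  by (simp add: nabla_f_def f_mem)

lemma nabla_f_form_VF: "X \<in> VF \<Longrightarrow> Y \<in> VF \<Longrightarrow> nabla_f_form X Y \<in> VF"
  by (simp add: nabla_f_form_def f_mem)

lemma g_nabla_f:
  assumes "X \<in> VF" "Y \<in> VF" "Z \<in> VF"
  shows "g (nabla_f X Y) Z p = g (D X (f Y)) Z p + g (D X Y) (f Z) p"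
  using assms by (simp add: nabla_f_def g_linear g_f_left f_mem)

lemma g_nabla_f_form:
  assumes "X \<in> VF" "Y \<in> VF" "Z \<in> VF"
  shows "g (nabla_f_form X Y) Z p = g (f X) (f Y) p * g Z \<xi>sum p - g Y \<xi>sum p * g (f X) (f Z) p"
  using assms by (simp add: nabla_f_form_def g_linear g_f_left[of "f X" Z] g_sym[of \<xi>sum Z] f_mem)

text \<open>Since \<nabla>\<xi>_\<alpha> = - f, a second covariant derivative of \<xi>_\<alpha> is a
  first one of f. The formula serves twice: Bianchi gives cyclicity of \<nabla>f, and later
  \<nabla>f gives the curvature on \<xi>_\<alpha>.\<close>

lemma curvature_\<xi>_nabla_f:
  assumes "\<alpha> \<in> {1..s}" "X \<in> VF" "Y \<in> VF"
  shows "R X Y (\<xi> \<alpha>) = nabla_f Y X - nabla_f X Y"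
  using assms
  by (simp add: curvature_eq \<xi>_field D_\<xi> D_linear f_mem nabla_f_def)

text \<open>Differentiating the skewness of f shows that \<nabla>_X f is skew; the expected value
  visibly is.\<close>

lemma defect_skew:
  assumes "X \<in> VF" "Y \<in> VF" "Z \<in> VF"
  shows "defect p X Z Y = - defect p X Y Z"
proof -
  have "g (f Y) Z + g (f Z) Y = 0"
    using assms g_f_left[of Y Z] g_f_swap[of Y Z] g_sym[of "f Z" Y] by (simp add: f_VF)
  then have "X (g (f Y) Z + g (f Z) Y) = 0"
    using VF_zero_fun[OF assms(1)] by simp
  then have "X (g (f Y) Z) + X (g (f Z) Y) = 0"
    using assms VF_add_fun[OF assms(1), of "g (f Y) Z" "g (f Z) Y"] by (simp add: f_mem)
  from fun_cong[OF this, of p] have "X (g (f Y) Z) p + X (g (f Z) Y) p = 0" by simp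
  then show ?thesis
    using assms fun_cong[OF D_metric[OF assms(1) f_VF[OF assms(2)] assms(3)], of p]
      fun_cong[OF D_metric[OF assms(1) f_VF[OF assms(3)] assms(2)], of p]
      g_sym[of "f Y" "D X Z"] g_sym[of "f Z" "D X Y"] g_sym[of "f X" "f Y"] g_sym[of "f X" "f Z"]
    by (simp add: defect_def g_nabla_f g_nabla_f_form f_mem)
qed

text \<open>For \<open>nabla_f\<close> this says \<open>d\<Phi> = 0\<close>; since \<open>f = - \<nabla>\<xi>\<^sub>\<alpha>\<close>, it is the first Bianchi identity.\<close>

lemma defect_cyclic:
  assumes "X \<in> VF" "Y \<in> VF" "Z \<in> VF"
  shows "defect p X Y Z + defect p Y Z X + defect p Z X Y = 0"
proof -
  have 1: "1 \<in> {1..s}" using s_pos by simp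
  have R: "Rm p U V (\<xi> 1) W = g (nabla_f V U) W p - g (nabla_f U V) W p"
    if "U \<in> VF" "V \<in> VF" "W \<in> VF" for U V W
    using that curvature_\<xi>_nabla_f[OF 1 that(1,2)] by (simp add: Rm_def g_linear nabla_f_VF)
  have sk: "g (nabla_f U W) V p = - g (nabla_f U V) W p" if "U \<in> VF" "V \<in> VF" "W \<in> VF" for U V W
    using defect_skew[OF that, of p] that g_sym[of "f U" "f V"] g_sym[of "f U" "f W"]
    by (simp add: defect_def g_nabla_f_form f_VF algebra_simps)
  have "Rm p X Y (\<xi> 1) Z + Rm p Y Z (\<xi> 1) X + Rm p Z X (\<xi> 1) Y = 0"
    using Rm_Bianchi[OF assms \<xi>_field[OF 1], of p] assms \<xi>_field[OF 1]
      Rm_skew34[of X Y Z "\<xi> 1" p] Rm_skew34[of Y Z X "\<xi> 1" p] Rm_skew34[of Z X Y "\<xi> 1" p]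
    by simp
  then have "g (nabla_f X Y) Z p + g (nabla_f Y Z) X p + g (nabla_f Z X) Y p = 0"
    using R sk[of X Y Z] sk[of Y Z X] sk[of Z X Y] assms by simp
  moreover have "g (nabla_f_form X Y) Z p + g (nabla_f_form Y Z) X p + g (nabla_f_form Z X) Y p = 0"
    using assms g_sym[of "f X" "f Y"] g_sym[of "f Y" "f Z"] g_sym[of "f Z" "f X"]
    by (simp add: g_nabla_f_form f_VF)
  ultimately show ?thesis by (simp add: defect_def)
qed

text \<open>Differentiate f^2 = - I + \<Sum> \<eta>^\<alpha> \<otimes> \<xi>_\<alpha>. Both factors
  of each tensor product contribute through \<nabla>\<xi>_\<alpha> = - f, which yields the last two
  terms.\<close>

lemma D_f_square:
  assumes "X \<in> VF" "Y \<in> VF" "Z \<in> VF"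
  shows "g (D X (f (f Y))) Z p = g (D X Y) (f (f Z)) p
    - g Y (f X) p * g Z \<xi>sum p - g Y \<xi>sum p * g (f X) Z p"
proof -
  have V: "\<eta> \<alpha> Y \<odot> \<xi> \<alpha> \<in> VF" if "\<alpha> \<in> {1..s}" for \<alpha>
    using that assms by (intro VF_vscale \<eta>_SF \<xi>_field)
  have S: "(\<Sum>\<alpha>\<in>{1..s}. \<eta> \<alpha> Y \<odot> \<xi> \<alpha>) \<in> VF" by (intro VF_sum V)
  have summand: "g (D X (\<eta> \<alpha> Y \<odot> \<xi> \<alpha>)) Z p
      = \<eta> \<alpha> (D X Y) p * \<eta> \<alpha> Z p - g Y (f X) p * \<eta> \<alpha> Z p - \<eta> \<alpha> Y p * g (f X) Z p"
    if \<alpha>: "\<alpha> \<in> {1..s}" for \<alpha>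
  proof -
    have "D X (\<eta> \<alpha> Y \<odot> \<xi> \<alpha>) = X (\<eta> \<alpha> Y) \<odot> \<xi> \<alpha> + \<eta> \<alpha> Y \<odot> (- f X)"
      using \<alpha> assms by (subst D_vscale_right) (simp_all add: \<eta>_SF \<xi>_field D_\<xi>)
    moreover have "X (\<eta> \<alpha> Y) = \<eta> \<alpha> (D X Y) - g Y (f X)"
      using \<alpha> assms D_metric[of X Y "\<xi> \<alpha>"] by (simp add: \<eta>_g \<xi>_field D_\<xi> D_VF g_minus_right f_VF)
    moreover have "X (\<eta> \<alpha> Y) \<in> SF" using \<alpha> assms by (intro VF_SF[OF assms(1)] \<eta>_SF)
    moreover have "g (\<xi> \<alpha>) Z = \<eta> \<alpha> Z" using \<alpha> assms by (simp add: \<eta>_g g_sym \<xi>_field)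
    moreover have "\<eta> \<alpha> Y \<in> SF" "\<eta> \<alpha> (D X Y) \<in> SF" "\<xi> \<alpha> \<in> VF"
      using \<alpha> assms by (simp_all add: \<eta>_SF \<xi>_field D_VF)
    ultimately show ?thesis
      using \<alpha> assms by (simp add: g_linear f_mem algebra_simps)
  qed
  have "g (D X (f (f Y))) Z p
      = - g (D X Y) Z p + (\<Sum>\<alpha>\<in>{1..s}. g (D X (\<eta> \<alpha> Y \<odot> \<xi> \<alpha>)) Z p)"
  proof -
    have "D X (\<Sum>\<alpha>\<in>{1..s}. \<eta> \<alpha> Y \<odot> \<xi> \<alpha>) = (\<Sum>\<alpha>\<in>{1..s}. D X (\<eta> \<alpha> Y \<odot> \<xi> \<alpha>))"
      by (rule D_sum_right[OF assms(1) V])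
    moreover have "g (\<Sum>\<alpha>\<in>{1..s}. D X (\<eta> \<alpha> Y \<odot> \<xi> \<alpha>)) Z = (\<Sum>\<alpha>\<in>{1..s}. g (D X (\<eta> \<alpha> Y \<odot> \<xi> \<alpha>)) Z)"
      by (rule g_sum_left[OF assms(3) D_VF[OF assms(1) V]])
    moreover have "(\<Sum>\<alpha>\<in>{1..s}. D X (\<eta> \<alpha> Y \<odot> \<xi> \<alpha>)) \<in> VF"
      by (intro VF_sum D_VF assms V)
    ultimately show ?thesis
      using assms S
      by (simp add: f_square D_linear g_linear D_VF VF_minus sum_fun_apply del: One_nat_def)
  qed
  also have "(\<Sum>\<alpha>\<in>{1..s}. g (D X (\<eta> \<alpha> Y \<odot> \<xi> \<alpha>)) Z p) = (\<Sum>\<alpha>\<in>{1..s}.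
      \<eta> \<alpha> Z p * \<eta> \<alpha> (D X Y) p - g Y (f X) p * \<eta> \<alpha> Z p - \<eta> \<alpha> Y p * g (f X) Z p)"
    by (intro sum.cong refl) (simp only: summand mult.commute)
  also have "\<dots> = (\<Sum>\<alpha>\<in>{1..s}. \<eta> \<alpha> Z p * \<eta> \<alpha> (D X Y) p)
      - g Y (f X) p * g Z \<xi>sum p - g Y \<xi>sum p * g (f X) Z p"
    using assms by (simp add: sum_subtractf g_\<xi>sum sum_fun_apply sum_distrib_left sum_distrib_right)
  finally show ?thesis
    using assms by (simp add: g_f_square D_VF sum_fun_apply)
qed

text \<open>The operator (\<nabla>_X f) f + f (\<nabla>_X f) is the derivative of f^2 and agrees
  with the one built from the expected value. So the error anticommutes with f, and skewness of f
  removes the sign.\<close>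

lemma defect_f:
  assumes "X \<in> VF" "Y \<in> VF" "Z \<in> VF"
  shows "defect p X (f Y) Z = defect p X Y (f Z)"
proof -
  have "g (f X) (f (f Y)) p = g X (f Y) p" "g (f X) (f (f Z)) p = g X (f Z) p"
    using assms by (simp_all add: g_f_left[of X] f_cube f_VF g_linear)
  then show ?thesis
    using assms D_f_square[OF assms, of p]
      g_f_swap[of Y X] g_f_left[of X Z]
    by (simp add: defect_def g_nabla_f g_nabla_f_form f_VF g_f_\<xi>sum algebra_simps)
qed

text \<open>Without torsion the Nijenhuis tensor is (\<nabla>_{fX} f)Y - (\<nabla>_{fY} f)X +
  f(\<nabla>_Y f)X - f(\<nabla>_X f)Y. The expected values produce the same multiple of the sum of
  the \<xi>_\<alpha>, which cancels.\<close>

lemma defect_normality: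
  assumes "X \<in> VF" "Y \<in> VF" "Z \<in> VF"
  shows "defect p (f X) Y Z - defect p (f Y) X Z - defect p Y X (f Z) + defect p X Y (f Z) = 0"
proof -
  have "(\<lambda>p. 2 * g X (f Y) p) = (\<lambda>_. 2) * g X (f Y)" by (simp add: fun_eq_iff)
  then have "(\<lambda>p. 2 * g X (f Y) p) \<in> SF" using assms by (simp add: f_mem)
  then have "g (nijenhuis f X Y) Z p + 2 * g X (f Y) p * g \<xi>sum Z p = 0"
    using fun_cong[OF arg_cong[OF normality[OF assms(1,2)], of "\<lambda>V. g V Z"], of p] assms
    by (simp add: g_linear nijenhuis_def f_mem)
  then have "g (nabla_f (f X) Y) Z p - g (nabla_f (f Y) X) Z p - g (nabla_f Y X) (f Z) p + g (nabla_f X Y) (f Z) p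
      + 2 * g X (f Y) p * g \<xi>sum Z p = 0"
    using assms
    by (simp add: nijenhuis_def torsion_free nabla_f_def f_linear g_linear f_mem g_f_left)
  moreover have "g (nabla_f_form (f X) Y) Z p - g (nabla_f_form (f Y) X) Z p - g (nabla_f_form Y X) (f Z) p + g (nabla_f_form X Y) (f Z) p
      + 2 * g X (f Y) p * g \<xi>sum Z p = 0"
    using assms g_sym[of \<xi>sum Z] g_f_swap[of Y X] 
    by (simp add: g_nabla_f_form f_VF g_f_left f_cube g_linear g_f_\<xi>sum \<xi>sum_VF f_\<xi>sum)
  ultimately show ?thesis by (simp add: defect_def)
qed

text \<open>From f \<xi>_\<alpha> = 0 and \<nabla>\<xi>_\<alpha> = - f, both vectors compared are
  f^2 X.\<close>

lemma defect_\<xi>: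
  assumes "\<alpha> \<in> {1..s}" "X \<in> VF" "Z \<in> VF"
  shows "defect p X (\<xi> \<alpha>) Z = 0"
  using assms
  by (simp add: defect_def nabla_f_def nabla_f_form_def f_\<xi> D_\<xi> D_linear f_linear g_linear g_\<xi>_\<xi>sum f_mem \<xi>_field)

text \<open>
  Cyclicity turns \<open>defect_normality\<close> into a symmetry of \<open>defect p W (f U) V\<close> in \<open>U\<close> and \<open>V\<close>, in
  which it is skew by \<open>defect_skew\<close> and \<open>defect_f\<close>.
\<close>

lemma defect_eq_0:
  assumes "X \<in> VF" "Y \<in> VF" "Z \<in> VF"
  shows "defect p X Y Z = 0"
proof -
  have f0: "defect p W (f U) V = 0" if "U \<in> VF" "V \<in> VF" "W \<in> VF" for U V W
    using defect_normality[of U V W p] defect_f[of V U W p] defect_f[of U V W p] defect_f[of W U V p]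
      defect_cyclic[of "f U" V W p] defect_cyclic[of "f V" U W p]
      defect_skew[of V W "f U" p] defect_skew[of U W "f V" p] defect_skew[of W U "f V" p] that
    by (simp add: f_VF)
  have "f (f Z) = - Z + (\<Sum>\<alpha>\<in>{1..s}. \<eta> \<alpha> Z \<odot> \<xi> \<alpha>)" using assms by (simp add: f_square)
  \<comment> \<open>\<open>Z\<close> is split into its vertical part, where skewness and
    \<open>defect_\<xi>\<close> apply, and - f^2 Z, from which one f can be moved to
    \<open>Y\<close> so that \<open>f0\<close> applies.\<close>
  then have Z: "Z = (\<Sum>\<alpha>\<in>{1..s}. \<eta> \<alpha> Z \<odot> \<xi> \<alpha>) - f (f Z)" by simp
  have V: "\<eta> \<alpha> Z \<odot> \<xi> \<alpha> \<in> VF" if "\<alpha> \<in> {1..s}" for \<alpha>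
    using that assms by (intro VF_vscale \<eta>_SF \<xi>_field)
  have S: "(\<Sum>\<alpha>\<in>{1..s}. \<eta> \<alpha> Z \<odot> \<xi> \<alpha>) \<in> VF" by (intro VF_sum V)
  have eq: "defect p X Y U = g (nabla_f X Y - nabla_f_form X Y) U p" if "U \<in> VF" for U
    using that assms by (simp add: defect_def g_linear nabla_f_VF nabla_f_form_VF)
  have DT: "nabla_f X Y - nabla_f_form X Y \<in> VF" using assms by (simp add: nabla_f_VF nabla_f_form_VF VF_diff)
  have 0: "g (nabla_f X Y - nabla_f_form X Y) (\<eta> \<alpha> Z \<odot> \<xi> \<alpha>) p = 0" if \<alpha>: "\<alpha> \<in> {1..s}" for \<alpha>
    using eq[OF \<xi>_field[OF \<alpha>]] defect_skew[OF assms(1) \<xi>_field[OF \<alpha>] assms(2), of p]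
      defect_\<xi>[OF \<alpha> assms(1,2), of p] DT g_vscale_right[OF DT \<eta>_SF[OF \<alpha> assms(3)] \<xi>_field[OF \<alpha>]]
    by simp
  have "defect p X Y Z = g (nabla_f X Y - nabla_f_form X Y) ((\<Sum>\<alpha>\<in>{1..s}. \<eta> \<alpha> Z \<odot> \<xi> \<alpha>) - f (f Z)) p"
    using eq[OF assms(3)] Z by simp
  also have "\<dots> = g (nabla_f X Y - nabla_f_form X Y) (\<Sum>\<alpha>\<in>{1..s}. \<eta> \<alpha> Z \<odot> \<xi> \<alpha>) p - defect p X Y (f (f Z))"
    using DT S assms eq[of "f (f Z)"] by (simp add: g_diff_right f_VF)
  also have "g (nabla_f X Y - nabla_f_form X Y) (\<Sum>\<alpha>\<in>{1..s}. \<eta> \<alpha> Z \<odot> \<xi> \<alpha>)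
      = (\<Sum>\<alpha>\<in>{1..s}. g (nabla_f X Y - nabla_f_form X Y) (\<eta> \<alpha> Z \<odot> \<xi> \<alpha>))"
    by (rule g_sum_right[OF DT V])
  also have "\<dots> p = 0" unfolding sum_fun_apply by (intro sum.neutral ballI 0)
  also have "defect p X Y (f (f Z)) = 0"
    using defect_f[of X Y "f Z" p] f0[of Y "f Z" X] assms f_VF by simp
  finally show ?thesis by simp
qed

lemma nabla_f_eq: assumes "X \<in> VF" "Y \<in> VF" shows "nabla_f X Y = nabla_f_form X Y"
  using defect_eq_0[OF assms] assms by (intro g_eqI) (simp_all add: defect_def nabla_f_VF nabla_f_form_VF)

section \<open>Curvature of S-manifolds\<close>

text \<open>In the difference of the two values of \<nabla>f the multiples of the sum of the
  \<xi>_\<alpha> are symmetric in \<open>X\<close> and \<open>Y\<close> and cancel.\<close>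

lemma Rm_\<xi>:
  assumes "\<alpha> \<in> {1..s}" "X \<in> VF" "Y \<in> VF" "W \<in> VF"
  shows "Rm p X Y (\<xi> \<alpha>) W =
    g Y \<xi>sum p * g (f X) (f W) p - g X \<xi>sum p * g (f Y) (f W) p"
  using assms curvature_\<xi>_nabla_f[OF assms(1-3)] g_sym[of "f X" "f Y"]
  by (simp add: Rm_def nabla_f_eq g_diff_left nabla_f_form_VF g_nabla_f_form f_VF)

lemma g_\<xi>_\<xi>:
  assumes "\<alpha> \<in> {1..s}" "\<beta> \<in> {1..s}"
  shows "g (\<xi> \<alpha>) (\<xi> \<beta>) p = (if \<alpha> = \<beta> then 1 else 0)"
  using fun_cong[OF \<eta>_g[OF assms(2) \<xi>_field[OF assms(1)]], of p]
    fun_cong[OF \<eta>_\<xi>[OF assms(2,1)], of p] by auto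

lemma g_f_f_square: "X \<in> VF \<Longrightarrow> Y \<in> VF \<Longrightarrow> g (f (f X)) Y = - g (f X) (f Y)"
  by (rule g_f_left) (simp_all add: f_VF)

text \<open>The commutator of \<open>R(X,Y)\<close> and \<open>f\<close>; the sign of the second term is the skewness of \<open>f\<close>.\<close>

lemma Rm_f:
  assumes VF: "X \<in> VF" "Y \<in> VF" "Z \<in> VF" "W \<in> VF"
    and 0: "g Z \<xi>sum p = 0" "g W \<xi>sum p = 0"
  shows "Rm p X Y (f Z) W + Rm p X Y Z (f W) = real s *
    (g (f X) (f Z) p * g (f Y) W p - g (f Y) (f Z) p * g (f X) W p
     + g Z (f X) p * g (f Y) (f W) p - g Z (f Y) p * g (f X) (f W) p)"
proof -
  have Dsum: "D U (f V) = f (D U V) + nabla_f_form U V" if "U \<in> VF" "V \<in> VF" for U V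
    using nabla_f_eq[OF that] by (simp add: nabla_f_def algebra_simps)
  have DDf: "g (D U (D V (f Z))) W p = - g (D U (D V Z)) (f W) p
      - g (D V Z) \<xi>sum p * g (f U) (f W) p + g (D U (nabla_f_form V Z)) W p" if "U \<in> VF" "V \<in> VF" for U V
    using that VF 0 by (simp add: Dsum D_linear g_linear f_mem nabla_f_form_VF g_f_left g_nabla_f_form)
  \<comment> \<open>\<open>Z\<close> is horizontal at \<open>p\<close> only, so the derivative of
    \<open>g Z \<xi>sum\<close> survives there. Its part with \<open>D U Z\<close> cancels against
    \<open>DDf\<close> once X and Y are antisymmetrized; its other part and the derivative of
    \<open>\<xi>sum\<close> carry the factor s.\<close>
  have DT: "g (D U (nabla_f_form V Z)) W p = - real s * g (f V) (f Z) p * g (f U) W p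
      - (g (D U Z) \<xi>sum p - real s * g Z (f U) p) * g (f V) (f W) p" if UV: "U \<in> VF" "V \<in> VF" for U V
  proof -
    have "U (g Z \<xi>sum) = g (D U Z) \<xi>sum + g Z ((\<lambda>_. - real s) \<odot> f U)"
      using D_metric[OF that(1) VF(3) \<xi>sum_VF] that by (simp add: D_\<xi>sum)
    then have *: "U (g Z \<xi>sum) p = g (D U Z) \<xi>sum p - real s * g Z (f U) p"
      using that VF by (simp add: g_linear f_mem)
    have mem: "g (f V) (f Z) \<in> SF" "g Z \<xi>sum \<in> SF" "U (g (f V) (f Z)) \<in> SF" "U (g Z \<xi>sum) \<in> SF"
      using that VF by (simp_all add: f_mem VF_SF[OF that(1)])
    have "D U (nabla_f_form V Z) = (U (g (f V) (f Z)) \<odot> \<xi>sum + g (f V) (f Z) \<odot> D U \<xi>sum)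
        + (U (g Z \<xi>sum) \<odot> f (f V) + g Z \<xi>sum \<odot> D U (f (f V)))"
      using that VF mem by (simp add: nabla_f_form_def D_add_right D_vscale_right f_mem)
    then show ?thesis
      using that VF mem 0 * g_sym[of \<xi>sum W] \<xi>sum_VF
      by (simp add: D_\<xi>sum g_linear f_mem g_f_f_square)
  qed
  have TU: "g (D U (f Z)) W p = - g (D U Z) (f W) p" if "U \<in> VF" for U
    using that VF 0 by (simp add: Dsum g_linear f_mem nabla_f_form_VF g_f_left g_nabla_f_form)
  show ?thesis
    using VF DDf[of X Y] DDf[of Y X] DT[of X Y] DT[of Y X] TU[of "D X Y"] TU[of "D Y X"]
    by (simp add: Rm_def curvature_eq g_linear f_mem algebra_simps)
qed

section \<open>The horizontal distribution at a point\<close>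

definition horizontal_at :: "'a \<Rightarrow> 'a vfield \<Rightarrow> bool" where
  "horizontal_at p X \<longleftrightarrow> X \<in> VF \<and> in_L_at g s \<xi> p X"

lemma horizontal_VF: "horizontal_at p X \<Longrightarrow> X \<in> VF"
  by (simp add: horizontal_at_def)

lemma horizontal_\<eta>: "horizontal_at p X \<Longrightarrow> \<alpha> \<in> {1..s} \<Longrightarrow> \<eta> \<alpha> X p = 0"
  by (simp add: horizontal_at_def in_L_at_def \<eta>_g)

lemma horizontal_\<xi>sum: "horizontal_at p X \<Longrightarrow> g X \<xi>sum p = 0"
  using horizontal_\<eta>[of p X] by (simp add: g_\<xi>sum horizontal_VF sum_fun_apply)

lemma horizontalI: "X \<in> VF \<Longrightarrow> (\<And>\<alpha>. \<alpha> \<in> {1..s} \<Longrightarrow> g X (\<xi> \<alpha>) p = 0) \<Longrightarrow> horizontal_at p X"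
  by (simp add: horizontal_at_def in_L_at_def)

lemma horizontal_g_\<xi>: "horizontal_at p X \<Longrightarrow> \<alpha> \<in> {1..s} \<Longrightarrow> g X (\<xi> \<alpha>) p = 0"
  by (simp add: horizontal_at_def in_L_at_def)

lemma horizontal_add: "horizontal_at p X \<Longrightarrow> horizontal_at p Y \<Longrightarrow> horizontal_at p (X + Y)"
  by (rule horizontalI) (simp_all add: horizontal_VF VF_add g_add_left \<xi>_field horizontal_g_\<xi>)

lemma horizontal_scale: "horizontal_at p X \<Longrightarrow> horizontal_at p ((\<lambda>_. r) \<odot> X)"
  by (rule horizontalI)
    (simp_all add: horizontal_VF VF_vscale SF_const g_vscale_left \<xi>_field horizontal_g_\<xi>)

lemma horizontal_f: "X \<in> VF \<Longrightarrow> horizontal_at p (f X)"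
  by (rule horizontalI) (simp_all add: f_VF g_f_left \<xi>_field g_f_\<xi>)

lemma g_f_f_horizontal:
  assumes "horizontal_at p X" "Y \<in> VF" shows "g (f X) (f Y) p = g X Y p"
  using g_f_f[OF horizontal_VF[OF assms(1)] assms(2)] horizontal_\<eta>[OF assms(1)]
  by (simp add: sum_fun_apply)

lemma Rm_same: "X \<in> VF \<Longrightarrow> Z \<in> VF \<Longrightarrow> W \<in> VF \<Longrightarrow> Rm p X X Z W = 0"
  "X \<in> VF \<Longrightarrow> Z \<in> VF \<Longrightarrow> W \<in> VF \<Longrightarrow> Rm p Z W X X = 0"
  using Rm_skew12[of X X Z W p] Rm_skew34[of Z W X X p] by auto

text \<open>The curvature enters only as a vector paired with \<open>W\<close>, and a vector of
  length zero at \<open>p\<close> pairs to zero there. This covers the degenerate planes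
  below.\<close>

lemma Rm_null:
  assumes "X \<in> VF" "Y \<in> VF" "Z \<in> VF" "W \<in> VF" "g W W p = 0"
  shows "Rm p X Y Z W = 0"
  unfolding Rm_def by (rule g_null[OF assms(4,5) g_one_form[OF curvature_VF[OF assms(1-3)]]])

end

locale constant_L_curvature = S_manifold_levi_civita A n s f \<xi> \<eta> g D
  for A :: "('a::{t2_space,second_countable_topology}, 'e::euclidean_space) atlas"
    and n s f \<xi> \<eta> g D +
  fixes c :: real
  assumes constant_curvature: "constant_L_sectional_curvature A g s \<xi> D c"
begin

section \<open>Constant horizontal sectional curvature\<close>

lemma Rm_orthonormal:
  assumes "horizontal_at p X" "horizontal_at p Y" "g X X p = 1" "g Y Y p = 1" "g X Y p = 0"
  shows "Rm p X Y Y X = c"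
  using constant_curvature assms
  by (simp add: constant_L_sectional_curvature_def horizontal_at_def sectional_curvature_def Rm_def)

text \<open>Replace \<open>Y\<close> by its component \<open>Z\<close> orthogonal to
  \<open>X\<close>, which changes neither side, then normalize; \<open>a * b\<close> is the squared
  area of the parallelogram. If \<open>X\<close> or \<open>Z\<close> has length zero at
  \<open>p\<close>, both sides vanish.\<close>

lemma Rm_horizontal:
  assumes X: "horizontal_at p X" and Y: "horizontal_at p Y"
  shows "Rm p X Y Y X = c * (g X X p * g Y Y p - (g X Y p)\<^sup>2)"
proof (cases "g X X p = 0")
  case True
  have "g Y X p = 0" using g_null[OF _ True g_one_form] X Y by (simp add: horizontal_VF)
  then have "g X Y p = 0" using X Y g_sym[of X Y] by (simp add: horizontal_VF)
  moreover have "Rm p X Y Y X = 0" using X Y True by (intro Rm_null horizontal_VF)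
  ultimately show ?thesis using True by simp
next
  case False
  define a where "a = g X X p"
  define t where "t = g X Y p / a"
  define Z where "Z = Y + (\<lambda>_. - t) \<odot> X"
  define b where "b = g Z Z p"
  note VF = horizontal_VF[OF X] horizontal_VF[OF Y]
  have a: "a > 0" using False g_nonneg[OF VF(1), of p] by (simp add: a_def)
  have Z: "horizontal_at p Z" unfolding Z_def using X Y by (intro horizontal_add horizontal_scale)
  note VF_Z = horizontal_VF[OF Z]
  have XZ: "g X Z p = 0"
    using a VF by (simp add: Z_def g_linear field_mem t_def a_def)
  have "b = g Y Y p - 2 * t * g X Y p + t * t * a"
    using VF g_sym[of Y X] by (simp add: b_def Z_def g_linear field_mem a_def algebra_simps)
  then have ab: "a * b = a * g Y Y p - (g X Y p)\<^sup>2"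
    using a by (simp add: t_def field_simps power2_eq_square)
  have "Rm p X Z Z X = Rm p X Y Y X"
    using VF by (simp add: Z_def Rm_add Rm_scale field_mem Rm_same)
  moreover have "Rm p X Z Z X = c * (a * b)"
  proof (cases "b = 0")
    case True
    then have "Rm p X Z X Z = 0" using VF VF_Z by (intro Rm_null) (simp_all add: b_def)
    then show ?thesis using True Rm_skew34[of X Z X Z p] VF VF_Z by simp
  next
    case False
    have b: "b > 0" using False g_nonneg[OF VF_Z, of p] by (simp add: b_def)
    let ?X = "(\<lambda>_. 1 / sqrt a) \<odot> X" and ?Z = "(\<lambda>_. 1 / sqrt b) \<odot> Z"
    have "Rm p ?X ?Z ?Z ?X = c"
      using X Z VF VF_Z a b XZ
      by (intro Rm_orthonormal horizontal_scale)
        (simp_all add: g_linear field_mem a_def[symmetric] b_def[symmetric])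
    moreover have "Rm p ?X ?Z ?Z ?X = Rm p X Z Z X / (a * b)"
      using VF VF_Z a b by (simp add: Rm_scale field_mem field_simps)
    ultimately show ?thesis using a b by (simp add: field_simps)
  qed
  ultimately show ?thesis using ab by (simp add: a_def)
qed

text \<open>Compare the planes of \<open>X\<close> with \<open>Y\<close>, \<open>Z\<close> and
  \<open>Y + Z\<close>: the cross terms are equal by the curvature symmetries and sum to
  zero.\<close>

lemma Rm_orthogonal_triple:
  assumes "horizontal_at p X" "horizontal_at p Y" "horizontal_at p Z"
    and "g X Y p = 0" "g X Z p = 0" "g Y Z p = 0"
  shows "Rm p X Y Z X = 0"
proof -
  note VF = assms(1-3)[THEN horizontal_VF]
  have "g Z Y p = 0" using assms(6) g_sym[of Y Z] VF by simp
  moreover have "Rm p X Z Y X = Rm p X Y Z X"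
    using Rm_pair[of X Z Y X p] Rm_skew12[of X Y X Z p] Rm_skew34[of X Y X Z p] VF by simp
  ultimately show ?thesis
    using Rm_horizontal[OF assms(1) horizontal_add[OF assms(2,3)]]
      Rm_horizontal[OF assms(1,2)] Rm_horizontal[OF assms(1,3)] assms(4-6) VF
    by (simp add: Rm_add g_linear field_mem algebra_simps)
qed

text \<open>Polarizing once more in the outer arguments makes the value invariant under cyclic
  shifts of the last three arguments. The Bianchi identity then says that three times it is
  zero.\<close>

lemma Rm_orthogonal_quadruple:
  assumes hor: "horizontal_at p X" "horizontal_at p Y" "horizontal_at p Z" "horizontal_at p W"
    and orth: "g X Y p = 0" "g X Z p = 0" "g X W p = 0" "g Y Z p = 0" "g Y W p = 0" "g Z W p = 0"
  shows "Rm p X Y Z W = 0"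
proof -
  note VF = hor[THEN horizontal_VF]
  have swap: "Rm p X U V U' + Rm p U' U V X = 0"
    if "horizontal_at p U" "horizontal_at p V" "horizontal_at p U'" "g X U p = 0" "g X V p = 0"
      "g U' U p = 0" "g U' V p = 0" "g U V p = 0" for U V U'
  proof -
    have "Rm p (X + U') U V (X + U') = 0"
      using that hor VF horizontal_VF[OF that(1)] horizontal_VF[OF that(2)] horizontal_VF[OF that(3)]
      by (intro Rm_orthogonal_triple horizontal_add) (simp_all add: g_linear)
    then show ?thesis
      using Rm_orthogonal_triple[OF hor(1) that(1,2)] Rm_orthogonal_triple[OF that(3,1,2)] that VF
        horizontal_VF[OF that(1)] horizontal_VF[OF that(2)] horizontal_VF[OF that(3)]
      by (simp add: Rm_add field_mem)
  qed
  have sym: "g Z Y p = 0" "g W Y p = 0" "g W Z p = 0"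
    using orth g_sym[of Y Z] g_sym[of Y W] g_sym[of Z W] VF by simp_all
  have "Rm p X Y Z W = Rm p X Z W Y"
    using swap[OF hor(2,3,4)] orth sym Rm_pair[of W Y Z X p] Rm_skew12[of X Z W Y p] VF by simp
  moreover have "Rm p X Z W Y = Rm p X W Y Z"
    using swap[OF hor(3,4,2)] orth sym Rm_pair[of Y Z W X p] Rm_skew12[of X W Y Z p] VF by simp
  moreover have "Rm p Y Z X W = Rm p X W Y Z"
    using Rm_pair[of Y Z X W p] VF by simp
  moreover have "Rm p Z X Y W = Rm p X Z W Y"
    using Rm_skew12[of X Z Y W p] Rm_skew34[of X Z Y W p] VF by simp
  ultimately show ?thesis using Rm_Bianchi[of X Y Z W p] VF by simp
qed

lemma g_f_self: assumes "X \<in> VF" shows "g X (f X) p = 0" "g (f X) X p = 0"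
proof -
  show "g X (f X) p = 0" using fun_cong[OF g_f_swap[OF assms assms], of p] by simp
  then show "g (f X) X p = 0" using assms by (simp add: g_f_left)
qed

text \<open>The structure fields are extended by \<open>X\<close>, then by \<open>f X\<close>, then
  by \<open>Y\<close>. The last extension needs s + 2 < 2n + s, that is n \<ge> 2. Orthogonality to
  the \<xi>_\<alpha> makes \<open>X\<close> and \<open>Y\<close> horizontal.\<close>

lemma f_orthonormal_pair_exists:
  assumes "n \<ge> 2"
  obtains X Y where "horizontal_at p X" "horizontal_at p Y" "g X X p = 1" "g Y Y p = 1"
    "g X Y p = 0" "g Y (f X) p = 0"
proof -
  have "orthonormal_at p {1..s} \<xi>" by (simp add: orthonormal_at_def \<xi>_field g_\<xi>_\<xi>)
  then obtain X where X: "X \<in> VF" "g X X p = 1" "\<forall>\<alpha>\<in>{1..s}. g X (\<xi> \<alpha>) p = 0"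
    using orthonormal_at_extend[of "{1..s}" p \<xi>] assms dimension by auto
  then have hX: "horizontal_at p X" by (auto intro: horizontalI)
  define e where "e = \<xi>(Suc s := X, Suc (Suc s) := f X)"
  have e: "e \<alpha> = \<xi> \<alpha>" if "\<alpha> \<in> {1..s}" for \<alpha> using that by (simp add: e_def)
  have e': "e (Suc s) = X" "e (Suc (Suc s)) = f X" by (simp_all add: e_def)
  have I: "{1..Suc (Suc s)} = insert (Suc s) (insert (Suc (Suc s)) {1..s})" by auto
  have "g (\<xi> \<alpha>) X p = 0" "g (f X) (\<xi> \<alpha>) p = 0" "g (\<xi> \<alpha>) (f X) p = 0" if "\<alpha> \<in> {1..s}" for \<alpha>
    using X that g_sym[of "\<xi> \<alpha>" X] \<xi>_field[OF that]
    by (simp_all add: g_f_left g_f_\<xi> g_\<xi>_f)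
  moreover have "g (f X) (f X) p = 1" using g_f_f_horizontal[OF hX X(1)] X(2) by simp
  moreover have "Suc s \<notin> {1..s}" "Suc (Suc s) \<notin> {1..s}" by auto
  ultimately have "orthonormal_at p {1..Suc (Suc s)} e"
    unfolding I orthonormal_at_def
    using X g_\<xi>_\<xi> \<xi>_field g_f_self[OF X(1), of p] f_VF[OF X(1)]
    by (auto simp: e e' simp del: One_nat_def atLeastAtMost_iff)
  then obtain Y where Y: "Y \<in> VF" "g Y Y p = 1" "\<forall>i\<in>{1..Suc (Suc s)}. g Y (e i) p = 0"
    using orthonormal_at_extend[of "{1..Suc (Suc s)}" p e] assms dimension by auto
  have "g Y (\<xi> \<alpha>) p = 0" if "\<alpha> \<in> {1..s}" for \<alpha>
    using Y(3) e[OF that] that unfolding I by (metis insertI2)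
  then have hY: "horizontal_at p Y" using Y(1) by (intro horizontalI)
  have "g Y X p = 0" "g Y (f X) p = 0" using Y(3) e' unfolding I by (metis insertI1, metis insertI1 insertI2)
  then show thesis using that hX hY X Y g_sym[of X Y] by simp
qed

lemma curvature_constant_eq: assumes "n \<ge> 2" shows "c = real s"
proof -
  obtain X Y p where hor: "horizontal_at p X" "horizontal_at p Y"
    and orth: "g X X p = 1" "g Y Y p = 1" "g X Y p = 0" "g Y (f X) p = 0"
    \<comment> \<open>Any point will do; \<open>undefined\<close> names one, as HOL types are
      inhabited.\<close>
    using f_orthonormal_pair_exists[OF assms, of undefined] by metis
  note VF = horizontal_VF[OF hor(1)] horizontal_VF[OF hor(2)]
  have ff: "g (f X) (f X) p = 1" "g (f Y) (f Y) p = 1" "g (f X) (f Y) p = 0" "g (f Y) (f X) p = 0"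
    using g_f_f_horizontal[OF hor(1)] g_f_f_horizontal[OF hor(2)] orth VF g_sym[of X Y] by simp_all
  have "g X (f Y) p = 0" using orth(4) g_f_swap[of X Y] VF by simp
  then have "Rm p X Y (f Y) (f X) = 0"
    using hor orth VF ff g_f_self
    by (intro Rm_orthogonal_quadruple horizontal_f) simp_all
  moreover have "Rm p X Y Y (f (f X)) = - Rm p X Y Y X"
    using VF horizontal_\<eta>[OF hor(1)]
    by (simp add: Rm_def g_f_square curvature_VF sum_fun_apply)
  moreover have "Rm p X Y Y X = c" using Rm_orthonormal[OF hor orth(1-3)] .
  \<comment> \<open>\<open>Rm_f\<close> is used with Z = Y and W = fX. Of its four products only
    g(fY, fY) g(fX, fX) is nonzero, so the identity reads 0 - c = - s.\<close>
  ultimately show ?thesis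
    using Rm_f[OF VF(1,2,2) f_VF[OF VF(1)] horizontal_\<xi>sum[OF hor(2)]
        horizontal_\<xi>sum[OF horizontal_f[OF VF(1)]]] ff orth VF g_f_self
    by simp
qed

section \<open>Arbitrary planes and the scalar curvature\<close>

lemma Rm_vertical_part:
  assumes "X \<in> VF" "Y \<in> VF" "V \<in> VF" "W \<in> VF"
  shows "Rm p X Y W (\<Sum>\<alpha>\<in>{1..s}. (\<lambda>_. \<eta> \<alpha> V p) \<odot> \<xi> \<alpha>) =
    g V \<xi>sum p * (g X \<xi>sum p * g (f Y) (f W) p - g Y \<xi>sum p * g (f X) (f W) p)"
proof -
  have "Rm p X Y W (\<Sum>\<alpha>\<in>{1..s}. (\<lambda>_. \<eta> \<alpha> V p) \<odot> \<xi> \<alpha>)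
      = (\<Sum>\<alpha>\<in>{1..s}. \<eta> \<alpha> V p * Rm p X Y W (\<xi> \<alpha>))"
    by (rule Rm_sum_right[OF assms(1,2,4) \<xi>_field])
  also have "\<dots> = (\<Sum>\<alpha>\<in>{1..s}. \<eta> \<alpha> V p *
      (g X \<xi>sum p * g (f Y) (f W) p - g Y \<xi>sum p * g (f X) (f W) p))"
    using assms Rm_skew34[OF assms(1,2) \<xi>_field assms(4)]
    by (intro sum.cong refl) (simp add: Rm_\<xi>)
  finally show ?thesis
    using assms by (simp only: sum_distrib_right[symmetric] g_\<xi>sum sum_fun_apply)
qed

text \<open>Split both vectors into horizontal and vertical parts at \<open>p\<close>. Since f kills
  the vertical part, inner products of horizontal parts are those of \<open>f X\<close> and
  \<open>f Y\<close>, and \<open>Rm_horizontal\<close> gives the term with c. Everything involving a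
  vertical argument comes from the curvature on the \<xi>_\<alpha>.\<close>

lemma Rm_sectional:
  assumes "X \<in> VF" "Y \<in> VF"
  shows "Rm p X Y Y X =
    (g Y \<xi>sum p)\<^sup>2 * g (f X) (f X) p - 2 * g X \<xi>sum p * g Y \<xi>sum p * g (f X) (f Y) p
    + (g X \<xi>sum p)\<^sup>2 * g (f Y) (f Y) p
    + c * (g (f X) (f X) p * g (f Y) (f Y) p - (g (f X) (f Y) p)\<^sup>2)"
proof -
  define vert where "vert V = (\<Sum>\<alpha>\<in>{1..s}. (\<lambda>_. \<eta> \<alpha> V p) \<odot> \<xi> \<alpha>)" for V
  have vert: "vert V \<in> VF" for V
    unfolding vert_def by (intro VF_sum VF_vscale SF_const \<xi>_field)
  have f_vert: "f (vert V) = 0" for V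
  proof -
    have "f (vert V) = (\<Sum>\<alpha>\<in>{1..s}. f ((\<lambda>_. \<eta> \<alpha> V p) \<odot> \<xi> \<alpha>))"
      unfolding vert_def by (intro f_sum VF_vscale SF_const \<xi>_field)
    also have "\<dots> = 0"
      by (intro sum.neutral ballI) (simp add: f_vscale SF_const \<xi>_field f_\<xi> vscale_zero_right)
    finally show ?thesis .
  qed
  have hor: "horizontal_at p (V - vert V)" if V: "V \<in> VF" for V
  proof (rule horizontalI)
    fix \<alpha> assume \<alpha>: "\<alpha> \<in> {1..s}"
    have "g (vert V) (\<xi> \<alpha>) = (\<Sum>\<beta>\<in>{1..s}. g ((\<lambda>_. \<eta> \<beta> V p) \<odot> \<xi> \<beta>) (\<xi> \<alpha>))"
      unfolding vert_def by (intro g_sum_left VF_vscale SF_const \<xi>_field \<alpha>)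
    then have "g (vert V) (\<xi> \<alpha>) p = (\<Sum>\<beta>\<in>{1..s}. g ((\<lambda>_. \<eta> \<beta> V p) \<odot> \<xi> \<beta>) (\<xi> \<alpha>) p)"
      by (simp only: sum_fun_apply)
    also have "\<dots> = (\<Sum>\<beta>\<in>{1..s}. if \<beta> = \<alpha> then \<eta> \<beta> V p else 0)"
      using \<alpha> by (intro sum.cong refl) (simp add: g_vscale_left SF_const \<xi>_field g_\<xi>_\<xi>)
    also have "\<dots> = \<eta> \<alpha> V p" using \<alpha> by simp
    finally show "g (V - vert V) (\<xi> \<alpha>) p = 0"
      using \<alpha> V vert by (simp add: g_diff_left \<xi>_field \<eta>_g)
  qed (use V vert in \<open>simp add: VF_diff\<close>)
  define X0 Y0 where "X0 = X - vert X" and "Y0 = Y - vert Y"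
  have hX: "horizontal_at p X0" and hY: "horizontal_at p Y0"
    using hor assms by (simp_all add: X0_def Y0_def)
  note VF = assms horizontal_VF[OF hX] horizontal_VF[OF hY] vert
  have X: "X = X0 + vert X" and Y: "Y = Y0 + vert Y" by (simp_all add: X0_def Y0_def)
  have f0: "f X0 = f X" "f Y0 = f Y"
    using assms vert by (simp_all add: X0_def Y0_def f_diff f_vert)
  have g0: "g X0 X0 p = g (f X) (f X) p" "g Y0 Y0 p = g (f Y) (f Y) p" "g X0 Y0 p = g (f X) (f Y) p"
    using g_f_f_horizontal[OF hX VF(3)] g_f_f_horizontal[OF hY VF(4)] g_f_f_horizontal[OF hX VF(4)]
    by (simp_all add: f0)
  have v: "Rm p U V W (vert Z) =
      g Z \<xi>sum p * (g U \<xi>sum p * g (f V) (f W) p - g V \<xi>sum p * g (f U) (f W) p)"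
    if "U \<in> VF" "V \<in> VF" "Z \<in> VF" "W \<in> VF" for U V Z W
    unfolding vert_def using that by (rule Rm_vertical_part)
  have split: "Rm p U V W Z = Rm p U V W (Z - vert Z) + Rm p U V W (vert Z)"
    if "U \<in> VF" "V \<in> VF" "W \<in> VF" "Z \<in> VF" for U V W Z
    using Rm_add(4)[OF that(1-3) VF_diff[OF that(4) vert] vert, of p Z Z] by simp
  \<comment> \<open>With both of the first two arguments horizontal, a vertical vector in the third
    or fourth place contributes nothing.\<close>
  have "Rm p X0 Y0 Y X0 = Rm p X0 Y0 Y0 X0"
    using split[of X0 Y0 X0 Y] v[of X0 Y0 Y X0] VF
      Rm_skew34[of X0 Y0 Y X0 p] Rm_skew34[of X0 Y0 Y0 X0 p]
      horizontal_\<xi>sum[OF hX] horizontal_\<xi>sum[OF hY] by (simp add: Y0_def[symmetric])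
  then have 1: "Rm p Y0 X0 X Y = Rm p X0 Y0 Y0 X0"
    using split[of X0 Y0 Y X] v[of X0 Y0 X Y] VF Rm_skew34[of Y0 X0 Y X p]
      Rm_skew12[of X0 Y0 Y X p] Rm_skew34[of X0 Y0 Y X p] Rm_skew12[of X0 Y0 X Y p]
      horizontal_\<xi>sum[OF hX] horizontal_\<xi>sum[OF hY] by (simp add: X0_def[symmetric])
  have "Rm p X Y Y X = Rm p X Y Y0 X0 + Rm p X Y Y0 (vert X) - Rm p X Y X (vert Y)"
    using split[of X Y X Y] split[of X Y Y0 X] Rm_skew34[of X Y Y X p] Rm_skew34[of X Y Y0 X p] VF
    by (simp add: X0_def[symmetric] Y0_def[symmetric])
  also have "Rm p X Y Y0 X0 = Rm p X0 Y0 Y0 X0" using Rm_pair[of X Y Y0 X0 p] VF 1 by simp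
  finally show ?thesis
    using Rm_horizontal[OF hX hY] v[of X Y X Y0] v[of X Y Y X] VF fun_cong[OF g_sym[of "f X" "f Y"], of p]
    by (simp add: g0 f0 f_VF power2_eq_square algebra_simps)
qed

text \<open>At \<open>p\<close>, x lists the components of the sum of the \<xi>_\<alpha> and M is
  the matrix of the projection onto the horizontal space. By Parseval x has squared length s, Mx =
  0, M^2 = M, and M has trace 2n; so every frame gives 2ns + 2ns + s((2n)^2 - 2n) before
  halving.\<close>

lemma sectional_sum:
  assumes "n \<ge> 2" "orthonormal_frame_at A g p e"
  shows "(\<Sum>i\<in>{1..DIM('e)}. \<Sum>j\<in>{1..DIM('e)} - {i}. sectional_curvature g D (e i) (e j) p) / 2
    = real (n * s * (2 * n + 1))"
proof -
  let ?I = "{1..DIM('e)}"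
  have e: "orthonormal_at p ?I e"
    using assms(2) by (simp add: orthonormal_at_def orthonormal_frame_at_def)
  have eV: "e i \<in> VF" if "i \<in> ?I" for i using e that by (simp add: orthonormal_at_def)
  have Pars: "(\<Sum>i\<in>?I. g X (e i) p * g Y (e i) p) = g X Y p" if "X \<in> VF" "Y \<in> VF" for X Y
    using Parseval[OF _ _ e that] by simp
  define x where "x i = g (e i) \<xi>sum p" for i
  define M where "M i j = g (f (e i)) (f (e j)) p" for i j
  have x': "g \<xi>sum (e i) p = x i" if "i \<in> ?I" for i
    using g_sym[OF \<xi>sum_VF eV[OF that]] by (simp add: x_def)
  have M': "g (f (f (e i))) (e j) p = - M i j" if "i \<in> ?I" "j \<in> ?I" for i j
    using eV that by (simp add: M_def g_f_f_square)
  have x2: "(\<Sum>i\<in>?I. x i * x i) = real s"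
  proof -
    have "(\<Sum>i\<in>?I. x i * x i) = g \<xi>sum \<xi>sum p"
      unfolding Pars[OF \<xi>sum_VF \<xi>sum_VF, symmetric] by (intro sum.cong refl) (simp add: x')
    also have "\<dots> = (\<Sum>\<alpha>\<in>{1..s}. g (\<xi> \<alpha>) \<xi>sum p)"
      using fun_cong[OF g_sum_left[of \<xi>sum "{1..s}" \<xi>], of p] \<xi>_field \<xi>sum_VF
      by (simp only: \<xi>sum_def[symmetric] sum_fun_apply)
    also have "\<dots> = real s" by (simp add: g_\<xi>_\<xi>sum)
    finally show ?thesis .
  qed
  have xM: "(\<Sum>j\<in>?I. x j * M i j) = 0" if i: "i \<in> ?I" for i
  proof -
    have "(\<Sum>j\<in>?I. x j * M i j) = - (\<Sum>j\<in>?I. g \<xi>sum (e j) p * g (f (f (e i))) (e j) p)"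
      unfolding sum_negf[symmetric] using i by (intro sum.cong refl) (simp add: x' M')
    also have "\<dots> = 0"
      unfolding Pars[OF \<xi>sum_VF f_VF[OF f_VF[OF eV[OF i]]]]
      using eV[OF i] by (simp add: f_VF g_\<xi>sum_f)
    finally show ?thesis .
  qed
  have MM: "(\<Sum>j\<in>?I. M i j * M i j) = M i i" if i: "i \<in> ?I" for i
  proof -
    have "(\<Sum>j\<in>?I. M i j * M i j)
        = (\<Sum>j\<in>?I. g (f (f (e i))) (e j) p * g (f (f (e i))) (e j) p)"
      using i by (intro sum.cong refl) (simp add: M')
    also have "\<dots> = M i i"
      unfolding Pars[OF f_VF[OF f_VF[OF eV[OF i]]] f_VF[OF f_VF[OF eV[OF i]]]]
      using eV[OF i] by (simp add: f_VF M_def g_f_f_square f_cube g_linear)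
    finally show ?thesis .
  qed
  have trace: "(\<Sum>i\<in>?I. M i i) = 2 * real n"
  proof -
    have "M i i = 1 - (\<Sum>\<alpha>\<in>{1..s}. g (\<xi> \<alpha>) (e i) p * g (\<xi> \<alpha>) (e i) p)" if i: "i \<in> ?I" for i
    proof -
      have "\<eta> \<alpha> (e i) p = g (\<xi> \<alpha>) (e i) p" if "\<alpha> \<in> {1..s}" for \<alpha>
        using \<eta>_g[OF that eV[OF i]] g_sym[OF \<xi>_field[OF that] eV[OF i]] by simp
      then show ?thesis
        using e i g_f_f[OF eV[OF i] eV[OF i]]
        by (simp add: M_def orthonormal_at_def sum_fun_apply)
    qed
    then have "(\<Sum>i\<in>?I. M i i)
        = (\<Sum>i\<in>?I. 1 - (\<Sum>\<alpha>\<in>{1..s}. g (\<xi> \<alpha>) (e i) p * g (\<xi> \<alpha>) (e i) p))"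
      by (intro sum.cong refl)
    also have "\<dots> = real DIM('e) - (\<Sum>\<alpha>\<in>{1..s}. \<Sum>i\<in>?I. g (\<xi> \<alpha>) (e i) p * g (\<xi> \<alpha>) (e i) p)"
      by (subst sum.swap) (simp add: sum_subtractf)
    also have "(\<Sum>\<alpha>\<in>{1..s}. \<Sum>i\<in>?I. g (\<xi> \<alpha>) (e i) p * g (\<xi> \<alpha>) (e i) p) = (\<Sum>\<alpha>\<in>{1..s}. 1)"
    proof (rule sum.cong[OF refl])
      fix \<alpha> assume \<alpha>: "\<alpha> \<in> {1..s}"
      have "g (\<xi> \<alpha>) (\<xi> \<alpha>) p = 1"
        using g_\<xi>_\<xi>[OF \<alpha> \<alpha>] by simp
      then show "(\<Sum>i\<in>?I. g (\<xi> \<alpha>) (e i) p * g (\<xi> \<alpha>) (e i) p) = 1"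
        using Pars[OF \<xi>_field[OF \<alpha>] \<xi>_field[OF \<alpha>]] by simp
    qed
    finally show ?thesis using dimension by simp
  qed
  have c: "c = real s" using curvature_constant_eq[OF assms(1)] .
  have K: "sectional_curvature g D (e i) (e j) p =
      M i i * (x j * x j) - 2 * x i * (x j * M i j) + x i * x i * M j j
      + real s * M i i * M j j - real s * (M i j * M i j)" if "i \<in> ?I" "j \<in> ?I" for i j
    using Rm_sectional[OF eV[OF that(1)] eV[OF that(2)], of p]
    by (simp add: sectional_curvature_def Rm_def x_def M_def c power2_eq_square algebra_simps)
  have row: "(\<Sum>j\<in>?I - {i}. sectional_curvature g D (e i) (e j) p) =
      M i i * real s + x i * x i * (2 * real n) + real s * M i i * (2 * real n) - real s * M i i"
    if i: "i \<in> ?I" for i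
  proof -
    \<comment> \<open>The diagonal term vanishes, so j may run over the whole frame, as Parseval
      requires.\<close>
    have "sectional_curvature g D (e i) (e i) p = 0"
      using Rm_same(1)[of "e i" "e i" "e i" p] eV[OF i] by (simp add: sectional_curvature_def Rm_def)
    then have "(\<Sum>j\<in>?I - {i}. sectional_curvature g D (e i) (e j) p) =
        (\<Sum>j\<in>?I. sectional_curvature g D (e i) (e j) p)"
      using i by (simp add: sum_diff1)
    also have "\<dots> = (\<Sum>j\<in>?I. M i i * (x j * x j) - 2 * x i * (x j * M i j) + x i * x i * M j j
        + real s * M i i * M j j - real s * (M i j * M i j))"
      using K i by (intro sum.cong refl)
    also have "\<dots> = M i i * (\<Sum>j\<in>?I. x j * x j) - 2 * x i * (\<Sum>j\<in>?I. x j * M i j)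
        + x i * x i * (\<Sum>j\<in>?I. M j j) + real s * M i i * (\<Sum>j\<in>?I. M j j)
        - real s * (\<Sum>j\<in>?I. M i j * M i j)"
      by (simp only: sum.distrib sum_subtractf sum_distrib_left)
    finally show ?thesis unfolding x2 xM[OF i] MM[OF i] trace by simp
  qed
  have "(\<Sum>i\<in>?I. \<Sum>j\<in>?I - {i}. sectional_curvature g D (e i) (e j) p) =
      (\<Sum>i\<in>?I. M i i * real s + x i * x i * (2 * real n) + real s * M i i * (2 * real n) - real s * M i i)"
    using row by (intro sum.cong refl)
  also have "\<dots> = (\<Sum>i\<in>?I. M i i) * real s + (\<Sum>i\<in>?I. x i * x i) * (2 * real n)
      + real s * (\<Sum>i\<in>?I. M i i) * (2 * real n) - real s * (\<Sum>i\<in>?I. M i i)"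
    by (simp only: sum.distrib sum_subtractf sum_distrib_left sum_distrib_right)
  also have "\<dots> = 2 * real (n * s * (2 * n + 1))"
    unfolding x2 trace by (simp add: algebra_simps)
  finally show ?thesis by simp
qed

lemma scalar_curvature_eq:
  assumes "n \<ge> 2"
  shows "scalar_curvature A g D p = real (n * s * (2 * n + 1))"
proof -
  obtain e where "orthonormal_at p {1..DIM('e)} e"
    using orthonormal_at_frame_exists by blast
  then have e: "orthonormal_frame_at A g p e"
    by (simp add: orthonormal_at_def orthonormal_frame_at_def)
  show ?thesis
    unfolding scalar_curvature_def
  proof (rule the_equality)
    show "\<exists>e. orthonormal_frame_at A g p e \<and> real (n * s * (2 * n + 1)) =
        (\<Sum>i\<in>{1..DIM('e)}. \<Sum>j\<in>{1..DIM('e)} - {i}. sectional_curvature g D (e i) (e j) p) / 2"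
      using e sectional_sum[OF assms e, symmetric] by blast
  next
    fix t
    assume "\<exists>e. orthonormal_frame_at A g p e \<and> t =
        (\<Sum>i\<in>{1..DIM('e)}. \<Sum>j\<in>{1..DIM('e)} - {i}. sectional_curvature g D (e i) (e j) p) / 2"
    then show "t = real (n * s * (2 * n + 1))" by (elim exE conjE) (simp only: sectional_sum[OF assms])
  qed
qed

end

theorem theorem3p1:
  fixes A :: "('a::{t2_space,second_countable_topology}, 'e::euclidean_space) atlas"
    and n s :: nat
    and f :: "'a vfield \<Rightarrow> 'a vfield"
    and \<xi> :: "nat \<Rightarrow> 'a vfield"
    and \<eta> :: "nat \<Rightarrow> 'a vfield \<Rightarrow> 'a \<Rightarrow> real"
    and g :: "'a vfield \<Rightarrow> 'a vfield \<Rightarrow> 'a \<Rightarrow> real"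
    and D :: "'a vfield \<Rightarrow> 'a vfield \<Rightarrow> 'a vfield"
    and c :: real
  assumes "S_manifold A n s f \<xi> \<eta> g"
    and "n \<ge> 2"
    and "levi_civita_connection A g D"
    and "constant_L_sectional_curvature A g s \<xi> D c"
  shows "c = real s \<and> (\<forall>p. scalar_curvature A g D p = real (n * s * (2 * n + 1)))"
proof -
  interpret S_manifold A n s f \<xi> \<eta> g by (fact assms(1))
  interpret constant_L_curvature A n s f \<xi> \<eta> g D c
    by unfold_locales (fact g_metric assms)+
  show ?thesis using curvature_constant_eq scalar_curvature_eq assms(2) by blast
qed

end
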